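(* Suppose that $\Omega\subset\mathbb{R}^n$, $n\ge2$, satisfies the basic assumptions on the nozzle (see context), and that $\varphi_1,\varphi_2$ are uniformly subsonic solutions of $$\operatorname{div}\big(\rho(|\nabla\varphi_k|^2)\nabla\varphi_k\big)=0\ \text{ in }\Omega,\qquad \frac{\partial\varphi_k}{\partial\vec n}=0\ \text{ on }\partial\Omega,\qquad k=1,2,$$ associated with the same incoming mass flux $m_0$. Then $$\nabla\varphi_1=\nabla\varphi_2\quad\text{in }\Omega.$$
   Context: Points of $\mathbb{R}^n$ are written $x=(x',x_n)$. Fix $\alpha\in(0,1)$. Basic assumptions on $\Omega$: let $B(0,1)$ be the unit ball of $\mathbb{R}^{n-1}$ centered at the origin and $\mathcal{C}=B(0,1)\times(-\infty,\infty)$. There is an invertible $C^{2,\alpha}$ map $T:\overline\Omega\to\overline{\mathcal C}$, $x\mapsto y$, with $T(\partial\Omega)=\partial\mathcal{C}$; $T(\Omega\cap\{x_n=k\})=B(0,1)\times\{y_n=k\}$ for every $k\in\mathbb{R}$; and $\|T\|_{C^{2,\alpha}},\|T^{-1}\|_{C^{2,\alpha}}\le K$ for a uniform constant $K$ (since $\Omega$ is unbounded and $T$ preserves $x_n$, these are understood as bounds on the first and second derivatives and on the $\alpha$-Hölder seminorm of the second derivatives). Density-speed relation: let $p=p(\rho)$ be smooth for $\rho>0$ with $p'>0$, $p''>0$, and $h(\rho)=\int_1^\rho \frac{p'(s)}{s}\,ds$. Bernoulli's law $\frac12 q^2+h(\rho)=\text{const}$ determines $\rho$ as a function $\rho(q^2)$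 of the speed $q$; speed and density are nondimensionalized by the critical speed $q_{cr}$ (the flow being subsonic, $q<\sqrt{p'(\rho)}$, exactly when $q<q_{cr}$) and by $\rho(q_{cr}^2)$. The nondimensional $\rho(\cdot)$ is positive, smooth and nonincreasing in $q\in[0,1]$, $\rho(1)=1$, $q\,\rho(q^2)\le1$ for $q\ge0$, $\rho(q^2)+2q^2\rho'(q^2)>0$ for $0\le q<1$, and the flow is subsonic exactly when $q<1$. $\vec n$ is the unit outer normal of $\Omega$. Uniformly subsonic means $\sup_\Omega|\nabla\varphi_k|<1$. The mass flux of $\varphi_k$ is $m_0=\int_{\Omega\cap\{x_n=t\}}\rho(|\nabla\varphi_k|^2)\,\partial_{x_n}\varphi_k\,dx'$, which is the same for every $t\in\mathbb{R}$. *)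

theory Defs
  imports "HOL-Analysis.Analysis"
begin

text \<open>
  Points $x = (x', x_n)$ of $\mathbb{R}^n$ are elements of \<^typ>\<open>(real^'m) \<times> real\<close>, so that
  $n = \mathrm{CARD}('m) + 1 \geq 2$; the norm of this product type is the Euclidean one.
\<close>

section \<open>Differential operators and function spaces\<close>

definition grad :: "('a::euclidean_space \<Rightarrow> real) \<Rightarrow> 'a \<Rightarrow> 'a" where
  "grad f x = (\<Sum>b\<in>Basis. frechet_derivative f (at x) b *\<^sub>R b)"

definition divergence :: "('a::euclidean_space \<Rightarrow> 'a) \<Rightarrow> 'a \<Rightarrow> real" where
  "divergence F x = (\<Sum>b\<in>Basis. frechet_derivative F (at x) b \<bullet> b)"

definition C2_on :: "'a::real_normed_vector set \<Rightarrow> ('a \<Rightarrow> 'b::real_normed_vector) \<Rightarrow> bool" where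
  "C2_on U f \<longleftrightarrow>
    (\<exists>(F1 :: 'a \<Rightarrow> 'a \<Rightarrow>\<^sub>L 'b) (F2 :: 'a \<Rightarrow> 'a \<Rightarrow>\<^sub>L 'a \<Rightarrow>\<^sub>L 'b).
      (\<forall>x\<in>U. (f has_derivative blinfun_apply (F1 x)) (at x) \<and>
        (F1 has_derivative blinfun_apply (F2 x)) (at x)) \<and>
      continuous_on U F2)"

text \<open>
  \<open>f\<close> is of class $C^{2,\alpha}$ on the closure of the open set \<open>U\<close>: the derivatives in \<open>U\<close> have
  continuous extensions \<open>F1\<close>, \<open>F2\<close> to the closure. Only the derivatives are bounded by \<open>K\<close>, not
  \<open>f\<close> itself.
\<close>

definition C2_holder_on_closure ::
    "real \<Rightarrow> real \<Rightarrow> 'a::real_normed_vector set \<Rightarrow> ('a \<Rightarrow> 'b::real_normed_vector) \<Rightarrow> bool" where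
  "C2_holder_on_closure \<alpha> K U f \<longleftrightarrow>
    (\<exists>(F1 :: 'a \<Rightarrow> 'a \<Rightarrow>\<^sub>L 'b) (F2 :: 'a \<Rightarrow> 'a \<Rightarrow>\<^sub>L 'a \<Rightarrow>\<^sub>L 'b).
      (\<forall>x\<in>U. (f has_derivative blinfun_apply (F1 x)) (at x) \<and>
        (F1 has_derivative blinfun_apply (F2 x)) (at x)) \<and>
      continuous_on (closure U) f \<and> continuous_on (closure U) F1 \<and>
      continuous_on (closure U) F2 \<and>
      (\<forall>x\<in>closure U. norm (F1 x) \<le> K \<and> norm (F2 x) \<le> K) \<and>
      (\<forall>x\<in>closure U. \<forall>y\<in>closure U. dist (F2 x) (F2 y) \<le> K * dist x y powr \<alpha>))"

text \<open>
  \<open>\<nu>\<close> is the unit outer normal of \<open>U\<close> at the boundary point \<open>x\<close>: to first order at \<open>x\<close>, the set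
  \<open>U\<close> is the half-space of all \<open>y\<close> with \<open>(y - x) \<bullet> \<nu> < 0\<close>. The two lemmas below state that such a
  \<open>\<nu>\<close> is unique and that it is the normalized gradient of any local defining function of \<open>U\<close>.
\<close>

definition is_outer_normal :: "'a::real_inner set \<Rightarrow> 'a \<Rightarrow> 'a \<Rightarrow> bool" where
  "is_outer_normal U x \<nu> \<longleftrightarrow> norm \<nu> = 1 \<and>
    (\<forall>\<epsilon>>0. \<exists>\<delta>>0. \<forall>y. dist y x < \<delta> \<longrightarrow>
      ((y - x) \<bullet> \<nu> < - \<epsilon> * norm (y - x) \<longrightarrow> y \<in> U) \<and>
      ((y - x) \<bullet> \<nu> > \<epsilon> * norm (y - x) \<longrightarrow> y \<notin> U))"

lemma is_outer_normal_unique: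
  assumes "is_outer_normal U x \<mu>" and "is_outer_normal U x \<nu>"
  shows "\<mu> = \<nu>"
proof (rule ccontr)
  assume ne: "\<mu> \<noteq> \<nu>"
  have n: "norm \<mu> = 1" "norm \<nu> = 1"
    using assms by (auto simp: is_outer_normal_def)
  define w where "w = \<nu> - \<mu>"
  have w0: "norm w > 0" using ne by (simp add: w_def)
  have "\<mu> \<bullet> \<mu> = 1" "\<nu> \<bullet> \<nu> = 1" using n by (simp_all add: norm_eq_1)
  then have "w \<bullet> w = 2 - 2 * (\<mu> \<bullet> \<nu>)" "w \<bullet> \<nu> = 1 - \<mu> \<bullet> \<nu>" "w \<bullet> \<mu> = \<mu> \<bullet> \<nu> - 1"
    by (simp_all add: w_def inner_diff_left inner_diff_right inner_commute[of \<nu> \<mu>])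
  then have wn: "w \<bullet> \<nu> = (norm w)\<^sup>2 / 2" "w \<bullet> \<mu> = - ((norm w)\<^sup>2 / 2)"
    unfolding power2_norm_eq_inner by linarith+
  define e where "e = norm w / 4"
  have e: "e > 0" using w0 by (simp add: e_def)
  obtain d1 where d1: "d1 > 0"
    "\<And>y. dist y x < d1 \<Longrightarrow> (y - x) \<bullet> \<mu> < - e * norm (y - x) \<Longrightarrow> y \<in> U"
    using assms(1) e unfolding is_outer_normal_def by blast
  obtain d2 where d2: "d2 > 0"
    "\<And>y. dist y x < d2 \<Longrightarrow> (y - x) \<bullet> \<nu> > e * norm (y - x) \<Longrightarrow> y \<notin> U"
    using assms(2) e unfolding is_outer_normal_def by blast
  define s where "s = min d1 d2 / (2 * norm w)"
  have s: "s > 0" using d1(1) d2(1) w0 by (simp add: s_def)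
  define y where "y = x + s *\<^sub>R w"
  have yx: "y - x = s *\<^sub>R w" by (simp add: y_def)
  have "dist y x = s * norm w" using s by (simp add: dist_norm yx)
  also have "\<dots> = min d1 d2 / 2" using w0 by (simp add: s_def)
  finally have dy: "dist y x < d1" "dist y x < d2" using d1(1) d2(1) by auto
  have sw: "0 < s * (norm w)\<^sup>2" using s w0 by simp
  have "(y - x) \<bullet> \<nu> = s * (norm w)\<^sup>2 / 2" "(y - x) \<bullet> \<mu> = - (s * (norm w)\<^sup>2 / 2)"
    "e * norm (y - x) = s * (norm w)\<^sup>2 / 4"
    using s by (simp_all add: yx wn e_def power2_eq_square)
  then have "y \<in> U" "y \<notin> U" using d1(2)[OF dy(1)] d2(2)[OF dy(2)] sw by auto
  then show False by simp
qed

lemma is_outer_normal_defining_function: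
  fixes g :: "'a::real_inner \<Rightarrow> real"
  assumes "open V" and "x \<in> V" and U: "U \<inter> V = {y \<in> V. g y < 0}" and "g x = 0"
    and g: "GDERIV g x :> D" and "D \<noteq> 0"
  shows "is_outer_normal U x (D /\<^sub>R norm D)"
  unfolding is_outer_normal_def
proof (intro conjI allI impI)
  show "norm (D /\<^sub>R norm D) = 1" using \<open>D \<noteq> 0\<close> by simp
next
  fix \<epsilon> :: real assume "\<epsilon> > 0"
  then have pos: "\<epsilon> * norm D > 0" using \<open>D \<noteq> 0\<close> by simp
  obtain d1 where d1: "d1 > 0" "ball x d1 \<subseteq> V"
    using \<open>open V\<close> \<open>x \<in> V\<close> open_contains_ball by blast
  have "(g has_derivative (\<lambda>h. h \<bullet> D)) (at x)"
    using g by (simp add: gderiv_def inner_commute)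
  then obtain d2 where d2: "d2 > 0"
    "\<And>y. norm (y - x) < d2 \<Longrightarrow> norm (g y - g x - (y - x) \<bullet> D) \<le> \<epsilon> * norm D * norm (y - x)"
    using pos unfolding has_derivative_at_alt by blast
  show "\<exists>\<delta>>0. \<forall>y. dist y x < \<delta> \<longrightarrow>
      ((y - x) \<bullet> (D /\<^sub>R norm D) < - \<epsilon> * norm (y - x) \<longrightarrow> y \<in> U) \<and>
      ((y - x) \<bullet> (D /\<^sub>R norm D) > \<epsilon> * norm (y - x) \<longrightarrow> y \<notin> U)"
  proof (rule exI[of _ "min d1 d2"], intro conjI allI impI)
    show "0 < min d1 d2" using d1 d2 by simp
  next
    fix y assume y: "dist y x < min d1 d2"
      and a: "(y - x) \<bullet> (D /\<^sub>R norm D) < - \<epsilon> * norm (y - x)"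
    have "(y - x) \<bullet> D < - (\<epsilon> * norm D * norm (y - x))"
      using a \<open>D \<noteq> 0\<close> by (simp add: field_simps)
    moreover have "\<bar>g y - (y - x) \<bullet> D\<bar> \<le> \<epsilon> * norm D * norm (y - x)"
      using d2(2)[of y] y \<open>g x = 0\<close> by (simp add: dist_norm)
    moreover have "y \<in> V" using y d1(2) by (meson mem_ball min_less_iff_conj subsetD dist_commute_lessI)
    ultimately have "y \<in> {y \<in> V. g y < 0}" by simp
    then show "y \<in> U" unfolding U[symmetric] by simp
  next
    fix y assume y: "dist y x < min d1 d2"
      and a: "(y - x) \<bullet> (D /\<^sub>R norm D) > \<epsilon> * norm (y - x)"
    have "(y - x) \<bullet> D > \<epsilon> * norm D * norm (y - x)"
      using a \<open>D \<noteq> 0\<close> by (simp add: field_simps)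
    moreover have "\<bar>g y - (y - x) \<bullet> D\<bar> \<le> \<epsilon> * norm D * norm (y - x)"
      using d2(2)[of y] y \<open>g x = 0\<close> by (simp add: dist_norm)
    moreover have "y \<in> V" using y d1(2) by (meson mem_ball min_less_iff_conj subsetD dist_commute_lessI)
    ultimately have "y \<in> V" "y \<notin> {y \<in> V. g y < 0}" by simp_all
    then show "y \<notin> U" unfolding U[symmetric] by simp
  qed
qed


section \<open>The nozzle\<close>

definition cylinder :: "((real^'m) \<times> real) set" where
  "cylinder = ball 0 1 \<times> UNIV"

definition nozzle :: "real \<Rightarrow> ((real^'m) \<times> real) set \<Rightarrow> bool" where
  "nozzle \<alpha> \<Omega> \<longleftrightarrow> open \<Omega> \<and>
    (\<exists>(T :: (real^'m) \<times> real \<Rightarrow> (real^'m) \<times> real) K.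
      bij_betw T (closure \<Omega>) (closure cylinder) \<and>
      T ` frontier \<Omega> = frontier cylinder \<and>
      (\<forall>k. T ` (\<Omega> \<inter> {x. snd x = k}) = ball 0 1 \<times> {k}) \<and>
      C2_holder_on_closure \<alpha> K \<Omega> T \<and>
      C2_holder_on_closure \<alpha> K cylinder (inv_into (closure \<Omega>) T))"


section \<open>Density-speed relation\<close>

definition pressure_law :: "(real \<Rightarrow> real) \<Rightarrow> bool" where
  "pressure_law p \<longleftrightarrow>
    (\<forall>k. \<forall>r>0. (deriv ^^ k) p differentiable (at r)) \<and>
    (\<forall>r>0. deriv p r > 0) \<and> (\<forall>r>0. deriv (deriv p) r > 0)"

definition enthalpy :: "(real \<Rightarrow> real) \<Rightarrow> real \<Rightarrow> real" where
  "enthalpy p r = (LBINT s=ereal 1..ereal r. deriv p s / s)"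

text \<open>
  The dimensional density as a function of $s = q^2$, where \<open>c\<close> is the constant in Bernoulli's law
  and $0$ (vacuum) is the value at speeds for which Bernoulli's law has no solution.
\<close>

definition bernoulli_density :: "(real \<Rightarrow> real) \<Rightarrow> real \<Rightarrow> real \<Rightarrow> real" where
  "bernoulli_density p c s =
    (if \<exists>r>0. s / 2 + enthalpy p r = c then THE r. r > 0 \<and> s / 2 + enthalpy p r = c else 0)"

definition critical_speed :: "(real \<Rightarrow> real) \<Rightarrow> real \<Rightarrow> real" where
  "critical_speed p c =
    (THE q. q > 0 \<and> (\<exists>r>0. q\<^sup>2 / 2 + enthalpy p r = c \<and> q\<^sup>2 = deriv p r))"

text \<open>The nondimensional density, a function of the square \<open>s\<close> of the nondimensional speed.\<close>

definition nondim_density :: "(real \<Rightarrow> real) \<Rightarrow> real \<Rightarrow> real \<Rightarrow> real" where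
  "nondim_density p c s =
    bernoulli_density p c ((critical_speed p c)\<^sup>2 * s) /
    bernoulli_density p c ((critical_speed p c)\<^sup>2)"


section \<open>Potential flows\<close>

text \<open>
  Classical solutions, in $C^2(\Omega) \cap C^1(\overline\Omega)$; \<open>v\<close> is the continuous extension of
  the gradient to the closure, which gives the normal derivative on the boundary.
\<close>

definition neumann_solution ::
    "(real \<Rightarrow> real) \<Rightarrow> 'a::euclidean_space set \<Rightarrow> ('a \<Rightarrow> real) \<Rightarrow> bool" where
  "neumann_solution \<rho> \<Omega> \<phi> \<longleftrightarrow>
    C2_on \<Omega> \<phi> \<and>
    (\<forall>x\<in>\<Omega>. divergence (\<lambda>y. \<rho> ((norm (grad \<phi> y))\<^sup>2) *\<^sub>R grad \<phi> y) x = 0) \<and>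
    continuous_on (closure \<Omega>) \<phi> \<and>
    (\<exists>v. continuous_on (closure \<Omega>) v \<and> (\<forall>x\<in>\<Omega>. v x = grad \<phi> x) \<and>
      (\<forall>x\<in>frontier \<Omega>. \<forall>\<nu>. is_outer_normal \<Omega> x \<nu> \<longrightarrow> v x \<bullet> \<nu> = 0))"

definition uniformly_subsonic :: "'a::euclidean_space set \<Rightarrow> ('a \<Rightarrow> real) \<Rightarrow> bool" where
  "uniformly_subsonic \<Omega> \<phi> \<longleftrightarrow> (SUP x\<in>\<Omega>. ereal (norm (grad \<phi> x))) < 1"

definition mass_flux ::
    "(real \<Rightarrow> real) \<Rightarrow> ((real^'m) \<times> real) set \<Rightarrow> ((real^'m) \<times> real \<Rightarrow> real) \<Rightarrow> real \<Rightarrow> real" where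
  "mass_flux \<rho> \<Omega> \<phi> t =
    (LINT x':{x'. (x', t) \<in> \<Omega>}|lborel.
      \<rho> ((norm (grad \<phi> (x', t)))\<^sup>2) * (grad \<phi> (x', t) \<bullet> (0, 1)))"

end

theory Submission
  imports Defs
begin

text \<open>
  Let \<open>u = \<phi>1 - \<phi>2\<close> and let \<open>G\<close> be the difference of the two mass flux vectors
  \<open>\<rho> (\<bar>\<nabla>\<phi>k\<bar>\<^sup>2) \<nabla>\<phi>k\<close>. Then \<open>div G = 0\<close>, and \<open>G\<close> is tangential on the wall. Since the flows are
  uniformly subsonic, the map \<open>v \<mapsto> \<rho> (\<bar>v\<bar>\<^sup>2) v\<close> is strongly monotone and Lipschitz on the ball of
  velocities that occur (\<open>elliptic_flux_monotone\<close>), so that the energy density \<open>w = G \<bullet> \<nabla>u\<close>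
  dominates both \<open>\<bar>\<nabla>u\<bar>\<^sup>2\<close> and \<open>\<bar>G\<bar>\<^sup>2\<close>. It has to be shown that \<open>w = 0\<close>.

  Testing \<open>div G = 0\<close> with \<open>\<eta> u\<close>, where \<open>\<eta>\<close> depends on \<open>x\<^sub>n\<close> alone, equals \<open>1\<close> for \<open>\<bar>x\<^sub>n\<bar> \<le> N\<close> and
  vanishes for \<open>\<bar>x\<^sub>n\<bar> \<ge> N + 1\<close>, gives \<open>\<integral> \<eta> w = - \<integral> \<eta>' u G\<^sub>n\<close>. Equality of the mass fluxes means that
  \<open>G\<^sub>n\<close> has integral zero over every cross-section, so by Fubini \<open>u\<close> may be replaced by \<open>u - c (x\<^sub>n)\<close>
  for any function \<open>c\<close> of \<open>x\<^sub>n\<close>. Let \<open>c (x\<^sub>n)\<close> be the value of \<open>u\<close> at the centre of the section. All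
  sections are images of the unit ball under maps with a common Lipschitz constant and
  \<open>\<bar>\<nabla>u\<bar> \<le> 2\<close>, hence \<open>u - c (x\<^sub>n)\<close> is bounded on \<open>\<Omega>\<close>. With \<open>E N\<close> the integral of \<open>w\<close> over
  \<open>\<bar>x\<^sub>n\<bar> \<le> N\<close> this says that \<open>E N\<close> is at most a constant times the integral of \<open>\<bar>G\<bar>\<close> over
  the slabs \<open>N < \<bar>x\<^sub>n\<bar> \<le> N + 1\<close>, whose volumes are bounded; as \<open>\<bar>G\<bar> \<le> \<delta> + \<bar>G\<bar>\<^sup>2 / \<delta>\<close>,

    \<open>E N \<le> A (\<delta> + (E (N + 1) - E N) / \<delta>)\<close>  for all \<open>\<delta> > 0\<close>.

  The increments of \<open>E\<close> are bounded, so \<open>\<delta> = 1\<close> shows that \<open>E\<close> is bounded; then its increments tend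
  to \<open>0\<close>, and small \<open>\<delta>\<close> give \<open>E = 0\<close> (\<open>energy_sequence_zero\<close>).

  The test is not immediate, because the potentials are twice differentiable only in the open set
  and \<open>G\<close> is merely continuous up to the wall. The function \<open>g = \<bar>T'\<bar>\<^sup>2 - 1\<close>, where \<open>T'\<close> denotes the
  first component of the straightening map, is negative in \<open>\<Omega>\<close>, zero on the wall, and its gradient
  there is a nonzero multiple of the outer normal (\<open>nozzle_geometry\<close>). Cutting off with a smooth step
  in \<open>- g / \<epsilon>\<close> leaves an error \<open>(1/\<epsilon>) \<integral> \<bar>G \<bullet> \<nabla>g\<bar>\<close> over the shell \<open>\<epsilon> < - g < 2 \<epsilon>\<close>. Here
  \<open>G \<bullet> \<nabla>g\<close> tends to \<open>0\<close> uniformly on bounded sets, while \<open>(1/\<epsilon>) \<integral> \<bar>\<nabla>g\<bar>\<^sup>2\<close> over the shell stays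
  bounded: this follows by applying the same cut-off to the vector field \<open>\<nabla>g\<close> itself
  (\<open>weak_form_of_zero_divergence\<close>).
\<close>

section \<open>Smooth cut-off functions\<close>

text \<open>
  The squared positive part is the simplest \<open>C\<^sup>1\<close> function that vanishes on a half-line; second
  differences of it produce a \<open>C\<^sup>1\<close> step.
\<close>

definition pos_square :: "real \<Rightarrow> real" where
  "pos_square s = (max 0 s)\<^sup>2"

lemma pos_square_deriv: "(pos_square has_real_derivative 2 * max 0 s) (at s)"
proof (cases s "0::real" rule: linorder_cases)
  case less
  have "((\<lambda>s::real. 0) has_real_derivative 0) (at s)" by simp
  then have "(pos_square has_real_derivative 0) (at s)"
    by (rule DERIV_cong_ev[THEN iffD1, rotated -1, OF _ refl _ refl])
      (use less in \<open>auto simp: pos_square_def intro!: eventually_mono[OF eventually_nhds_in_open[of "{..<0}"]]\<close>)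
  then show ?thesis using less by simp
next
  case equal
  have "((\<lambda>h. (pos_square (0 + h) - pos_square 0) / h) \<longlongrightarrow> 0) (at 0)"
  proof (rule Lim_null_comparison[where g = "\<lambda>h. \<bar>h\<bar>"])
    show "\<forall>\<^sub>F h in at 0. norm ((pos_square (0 + h) - pos_square 0) / h) \<le> \<bar>h\<bar>"
      by (rule always_eventually) (auto simp: pos_square_def power2_eq_square max_def)
    show "((\<lambda>h::real. \<bar>h\<bar>) \<longlongrightarrow> 0) (at 0)" by (rule tendsto_rabs_zero) (rule tendsto_ident_at)
  qed
  then show ?thesis using equal by (simp add: DERIV_def)
next
  case greater
  have "((\<lambda>s::real. s\<^sup>2) has_real_derivative 2 * s) (at s)" by (auto intro!: derivative_eq_intros)
  then have "(pos_square has_real_derivative 2 * s) (at s)"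
    by (rule DERIV_cong_ev[THEN iffD1, rotated -1, OF _ refl _ refl])
      (use greater in \<open>auto simp: pos_square_def intro!: eventually_mono[OF eventually_nhds_in_open[of "{0<..}"]]\<close>)
  then show ?thesis using greater by simp
qed

text \<open>
  The derivative is the tent of height \<open>2\<close> over \<open>[0, 1]\<close>, hence the step rises from \<open>0\<close> to \<open>1\<close>.
\<close>

definition smooth_step :: "real \<Rightarrow> real" where
  "smooth_step s = 2 * pos_square s - 4 * pos_square (s - 1/2) + 2 * pos_square (s - 1)"

definition smooth_step_deriv :: "real \<Rightarrow> real" where
  "smooth_step_deriv s = 4 * max 0 s - 8 * max 0 (s - 1/2) + 4 * max 0 (s - 1)"

lemma smooth_step_has_derivative [derivative_intros]:
  assumes "(f has_derivative f') (at x)"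
  shows "((\<lambda>x. smooth_step (f x)) has_derivative (\<lambda>h. smooth_step_deriv (f x) * f' h)) (at x)"
proof -
  have "((\<lambda>s. pos_square (s - a)) has_real_derivative 2 * max 0 (s - a)) (at s)" for a s
  proof -
    have "((\<lambda>s. s - a) has_real_derivative 1) (at s)" by (auto intro!: derivative_eq_intros)
    from DERIV_chain2[where f = pos_square and g = "\<lambda>s. s - a", OF pos_square_deriv this]
    show ?thesis by simp
  qed
  from this[of 0] this[of "1/2"] this[of 1]
  have "(smooth_step has_real_derivative smooth_step_deriv (f x)) (at (f x))"
    unfolding smooth_step_def[abs_def] smooth_step_deriv_def
    by (auto intro!: derivative_eq_intros simp: algebra_simps)
  from has_derivative_compose[OF assms this[unfolded has_field_derivative_def]] show ?thesis
    by simp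
qed

lemma continuous_on_smooth_step [continuous_intros]:
  "continuous_on A f \<Longrightarrow> continuous_on A (\<lambda>x. smooth_step (f x))"
  unfolding smooth_step_def pos_square_def by (intro continuous_intros)

lemma continuous_on_smooth_step_deriv [continuous_intros]:
  "continuous_on A f \<Longrightarrow> continuous_on A (\<lambda>x. smooth_step_deriv (f x))"
  unfolding smooth_step_deriv_def by (intro continuous_intros)

lemma smooth_step_eq_0: "s \<le> 0 \<Longrightarrow> smooth_step s = 0"
  by (simp add: smooth_step_def pos_square_def)

lemma smooth_step_eq_1: "1 \<le> s \<Longrightarrow> smooth_step s = 1"
  by (simp add: smooth_step_def pos_square_def power2_eq_square field_simps)

lemma smooth_step_bounds: "0 \<le> smooth_step s" "smooth_step s \<le> 1"
proof -
  consider "s \<le> 0" | "0 \<le> s" "s \<le> 1/2" | "1/2 \<le> s" "s \<le> 1" | "1 \<le> s" by linarith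
  then have "0 \<le> smooth_step s \<and> smooth_step s \<le> 1"
  proof cases
    case 2
    have "s\<^sup>2 \<le> (1/2)\<^sup>2" using 2 by (intro power_mono) auto
    with 2 show ?thesis by (simp add: smooth_step_def pos_square_def power2_eq_square)
  next
    case 3
    have "(1 - s)\<^sup>2 \<le> (1/2)\<^sup>2" using 3 by (intro power_mono) auto
    moreover have "smooth_step s = 1 - 2 * (1 - s)\<^sup>2"
      using 3 by (simp add: smooth_step_def pos_square_def power2_eq_square field_simps)
    ultimately show ?thesis by (simp add: power2_eq_square)
  qed (simp_all add: smooth_step_eq_0 smooth_step_eq_1)
  then show "0 \<le> smooth_step s" "smooth_step s \<le> 1" by auto
qed

lemma smooth_step_deriv_bounds: "0 \<le> smooth_step_deriv s" "smooth_step_deriv s \<le> 2"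
  by (auto simp: smooth_step_deriv_def max_def)

lemma smooth_step_deriv_eq_0: "s \<le> 0 \<or> 1 \<le> s \<Longrightarrow> smooth_step_deriv s = 0"
  by (auto simp: smooth_step_deriv_def max_def)

section \<open>Integration by parts inside an open set\<close>

lemma set_integrable_continuous_bounded:
  fixes f :: "'a::euclidean_space \<Rightarrow> real"
  assumes A: "A \<in> sets borel" and f: "continuous_on A f" "\<And>x. x \<in> A \<Longrightarrow> \<bar>f x\<bar> \<le> B"
    and supp: "\<And>x. x \<in> A \<Longrightarrow> f x \<noteq> 0 \<Longrightarrow> norm x \<le> R"
  shows "set_integrable lborel A f"
  unfolding set_integrable_def
proof (rule Bochner_Integration.integrable_bound)
  show "integrable lborel (\<lambda>x. indicator (cball 0 R) x *\<^sub>R B)"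
    by (intro integrable_scaleR_left)
      (use emeasure_lborel_cball_finite[of 0 R] in \<open>auto simp: integrable_indicator_iff less_top\<close>)
  show "(\<lambda>x. indicator A x *\<^sub>R f x) \<in> borel_measurable lborel"
    using borel_measurable_continuous_on_indicator[OF A f(1)] by simp
  show "AE x in lborel. norm (indicat_real A x *\<^sub>R f x) \<le> norm (indicat_real (cball 0 R) x *\<^sub>R B)"
    using f(2) supp by (intro AE_I2) (force simp: indicator_def)
qed

text \<open>
  The difference quotients in direction \<open>e\<close> have integral zero by translation invariance of Lebesgue
  measure. By the mean value theorem they are dominated by a constant on a fixed ball, so the limit
  has integral zero as well.
\<close>

lemma integral_directional_derivative_eq_0:
  fixes f :: "'a::euclidean_space \<Rightarrow> real"
  assumes der: "\<And>x. (f has_derivative f' x) (at x)"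
    and bound: "\<And>x. \<bar>f' x e\<bar> \<le> B"
    and supp: "\<And>x. f x \<noteq> 0 \<Longrightarrow> norm x \<le> R"
  shows "integrable lborel (\<lambda>x. f' x e)" "(\<integral>x. f' x e \<partial>lborel) = 0"
proof -
  define q where "q n x = (f (x + (1 / real (Suc n)) *\<^sub>R e) - f x) * real (Suc n)" for n x
  have cont: "continuous_on UNIV f"
    by (auto intro!: continuous_at_imp_continuous_on has_derivative_continuous[OF der])
  have fint: "integrable lborel f"
  proof -
    have "bounded (f ` cball 0 R)"
      by (intro compact_imp_bounded compact_continuous_image continuous_on_subset[OF cont]) auto
    then obtain M where M: "\<forall>y\<in>f ` cball 0 R. norm y \<le> M" unfolding bounded_iff by blast
    have "\<bar>f x\<bar> \<le> max 0 M" for x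
      using M supp[of x] by (cases "norm x \<le> R") (auto simp: le_max_iff_disj)
    then have "set_integrable lborel UNIV f"
      using supp by (intro set_integrable_continuous_bounded[OF _ cont]) auto
    then show ?thesis by (simp add: set_integrable_def)
  qed
  have mv: "\<bar>q n x\<bar> \<le> B" for n x
  proof -
    define t where "t = 1 / real (Suc n)"
    have t: "t > 0" by (simp add: t_def)
    define k where "k s = f (x + s *\<^sub>R e)" for s
    have kd: "(k has_derivative (\<lambda>r. r * f' (x + s *\<^sub>R e) e)) (at s within {0..t})" for s
    proof -
      have "((\<lambda>s. x + s *\<^sub>R e) has_derivative (\<lambda>r. r *\<^sub>R e)) (at s within {0..t})"
        by (auto intro!: derivative_eq_intros)
      from has_derivative_compose[OF this der]
      have "(k has_derivative (\<lambda>r. f' (x + s *\<^sub>R e) (r *\<^sub>R e))) (at s within {0..t})"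
        by (simp add: k_def[abs_def])
      moreover have "f' (x + s *\<^sub>R e) (r *\<^sub>R e) = r * f' (x + s *\<^sub>R e) e" for r
        using linear_scale[OF has_derivative_linear[OF der]] by simp
      ultimately show ?thesis by simp
    qed
    have "norm (k t - k 0) \<le> B * norm (t - 0)"
    proof (rule differentiable_bound[OF convex_real_interval(5) kd])
      fix s assume "s \<in> {0..t}"
      show "onorm (\<lambda>r. r * f' (x + s *\<^sub>R e) e) \<le> B"
        using bound by (intro onorm_le) (simp add: abs_mult mult.commute[of B] mult_left_mono)
    qed (use t in auto)
    then have "\<bar>k t - k 0\<bar> * real (Suc n) \<le> B" using t by (simp add: t_def field_simps)
    then show ?thesis by (simp add: q_def k_def t_def abs_mult)
  qed
  have B0: "0 \<le> B" using bound[of 0] by linarith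
  have qint: "integrable lborel (q n)" "(\<integral>x. q n x \<partial>lborel) = 0" for n
  proof -
    have fm: "f \<in> borel_measurable borel" using fint by simp
    have d: "distr lborel borel ((+) ((1 / real (Suc n)) *\<^sub>R e)) = (lborel :: 'a measure)"
      by (rule lborel_distr_plus)
    have "integrable lborel (\<lambda>x. f (x + (1 / real (Suc n)) *\<^sub>R e))"
      using integrable_distr_eq[of "(+) ((1 / real (Suc n)) *\<^sub>R e)" lborel borel f] fint fm
      unfolding d by (simp add: add.commute)
    moreover have "(\<integral>x. f (x + (1 / real (Suc n)) *\<^sub>R e) \<partial>lborel) = (\<integral>x. f x \<partial>lborel)"
      using integral_distr[of "(+) ((1 / real (Suc n)) *\<^sub>R e)" lborel borel f] fm
      unfolding d by (simp add: add.commute)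
    ultimately show "integrable lborel (q n)" "(\<integral>x. q n x \<partial>lborel) = 0"
      using fint unfolding q_def[abs_def] by auto
  qed
  have lim: "(\<lambda>n. q n x) \<longlonglongrightarrow> f' x e" for x
  proof -
    have "((\<lambda>s. x + s *\<^sub>R e) has_derivative (\<lambda>r. r *\<^sub>R e)) (at 0)"
      by (auto intro!: derivative_eq_intros)
    from has_derivative_compose[OF this, of f "f' x"] der[of x]
    have "((\<lambda>s. f (x + s *\<^sub>R e)) has_derivative (\<lambda>r. f' x (r *\<^sub>R e))) (at 0)" by simp
    moreover have "f' x (r *\<^sub>R e) = f' x e * r" for r
      using linear_scale[OF has_derivative_linear[OF der]] by simp
    ultimately have "((\<lambda>s. f (x + s *\<^sub>R e)) has_real_derivative f' x e) (at 0)"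
      by (simp add: has_field_derivative_def)
    then have "((\<lambda>h. (f (x + h *\<^sub>R e) - f x) / h) \<longlongrightarrow> f' x e) (at 0)" by (simp add: DERIV_def)
    moreover have "filterlim (\<lambda>n. 1 / real (Suc n)) (at 0) sequentially"
      using LIMSEQ_inverse_real_of_nat by (intro filterlim_atI) (auto simp: inverse_eq_divide)
    ultimately have "(\<lambda>n. (f (x + (1 / real (Suc n)) *\<^sub>R e) - f x) / (1 / real (Suc n))) \<longlonglongrightarrow> f' x e"
      by (rule filterlim_compose)
    then show ?thesis by (simp add: q_def)
  qed
  have meas: "(\<lambda>x. f' x e) \<in> borel_measurable lborel"
    by (rule borel_measurable_LIMSEQ_real[OF lim]) (use qint in auto)
  define w where "w x = indicat_real (cball 0 (R + norm e)) x *\<^sub>R B" for x :: 'a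
  have wint: "integrable lborel w" unfolding w_def
    by (intro integrable_scaleR_left)
      (use emeasure_lborel_cball_finite[of 0 "R + norm e"] in \<open>auto simp: integrable_indicator_iff less_top\<close>)
  have dom: "norm (q n x) \<le> w x" for n x
  proof (cases "norm x \<le> R + norm e")
    case True then show ?thesis using mv by (simp add: w_def)
  next
    case False
    define y where "y = x + (1 / real (Suc n)) *\<^sub>R e"
    have "norm ((1 / real (Suc n)) *\<^sub>R e) \<le> norm e" by (simp add: divide_le_eq mult_le_cancel_left1)
    moreover have "norm x \<le> norm y + norm ((1 / real (Suc n)) *\<^sub>R e)"
      using norm_triangle_ineq4[of y "(1 / real (Suc n)) *\<^sub>R e"] by (simp add: y_def)
    ultimately have "\<not> norm y \<le> R" "\<not> norm x \<le> R" using False norm_ge_zero[of e] by linarith+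
    then have "f y = 0" "f x = 0" using supp by blast+
    then show ?thesis using B0 by (simp add: q_def y_def w_def)
  qed
  show "integrable lborel (\<lambda>x. f' x e)"
    by (rule integrable_dominated_convergence[where s = q, OF meas _ wint _ AE_I2[OF dom]])
      (use qint lim in auto)
  have "(\<lambda>n. \<integral>x. q n x \<partial>lborel) \<longlonglongrightarrow> (\<integral>x. f' x e \<partial>lborel)"
    by (rule integral_dominated_convergence[where s = q, OF meas _ wint _ AE_I2[OF dom]])
      (use qint lim in auto)
  then show "(\<integral>x. f' x e \<partial>lborel) = 0"
    by (simp add: qint LIMSEQ_const_iff)
qed

text \<open>
  The integrand is the divergence of \<open>h F\<close>. Extended by zero this field is differentiable everywhere,
  because its support is a compact subset of the open set, and each of its diagonal partial
  derivatives integrates to zero.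
\<close>

lemma integral_by_parts_compact_support:
  fixes h :: "'a::euclidean_space \<Rightarrow> real" and F :: "'a \<Rightarrow> 'a"
    and F' :: "'a \<Rightarrow> 'a \<Rightarrow> 'a"
  assumes "open \<Omega>" and C: "compact C" "C \<subseteq> \<Omega>"
    and h: "\<And>x. x \<in> \<Omega> \<Longrightarrow> (h has_derivative (\<lambda>y. Dh x \<bullet> y)) (at x)" "continuous_on \<Omega> Dh"
    and supp: "\<And>x. x \<in> \<Omega> - C \<Longrightarrow> h x = 0"
    and F: "\<And>x. x \<in> \<Omega> \<Longrightarrow> (F has_derivative F' x) (at x)" "\<And>b. continuous_on \<Omega> (\<lambda>x. F' x b)"
  shows "(LINT x:\<Omega>|lborel. Dh x \<bullet> F x + h x * (\<Sum>b\<in>Basis. F' x b \<bullet> b)) = 0"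
proof -
  define f where "f b x = (if x \<in> \<Omega> then h x * (F x \<bullet> b) else 0)" for b x
  define f' where "f' b x y = (if x \<in> C then (Dh x \<bullet> y) * (F x \<bullet> b) + h x * (F' x y \<bullet> b) else 0)" for b x y
  have "closed C" using C compact_imp_closed by blast
  have der: "(f b has_derivative f' b x) (at x)" for b x
  proof (cases "x \<in> C")
    case True
    then have x: "x \<in> \<Omega>" using C by auto
    have "((\<lambda>x. h x * (F x \<bullet> b)) has_derivative f' b x) (at x)"
      using True by (auto intro!: derivative_eq_intros h(1)[OF x] F(1)[OF x] simp: f'_def fun_eq_iff algebra_simps)
    then show ?thesis
      by (rule has_derivative_transform_within_open[OF _ \<open>open \<Omega>\<close> x]) (simp add: f_def)
  next
    case False
    have "((\<lambda>_. 0) has_derivative f' b x) (at x)" using False by (simp add: f'_def[abs_def])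
    then show ?thesis
    proof (rule has_derivative_transform_within_open)
      show "open (- C)" using \<open>closed C\<close> by auto
      show "x \<in> - C" using False by simp
    qed (use supp in \<open>auto simp: f_def\<close>)
  qed
  have Fc: "continuous_on \<Omega> F" and hc: "continuous_on \<Omega> h"
    by (auto intro!: continuous_at_imp_continuous_on has_derivative_continuous[OF F(1)]
      has_derivative_continuous[OF h(1)])
  have ex: "\<exists>B. \<forall>x. \<bar>f' b x b\<bar> \<le> B" for b
  proof -
    have "continuous_on C (\<lambda>x. (Dh x \<bullet> b) * (F x \<bullet> b) + h x * (F' x b \<bullet> b))"
      using C by (intro continuous_intros continuous_on_subset[OF Fc] continuous_on_subset[OF hc]
        continuous_on_subset[OF h(2)] continuous_on_subset[OF F(2)])
    then have "bounded ((\<lambda>x. (Dh x \<bullet> b) * (F x \<bullet> b) + h x * (F' x b \<bullet> b)) ` C)"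
      using C(1) compact_continuous_image compact_imp_bounded by blast
    then obtain B where "\<forall>x\<in>C. \<bar>(Dh x \<bullet> b) * (F x \<bullet> b) + h x * (F' x b \<bullet> b)\<bar> \<le> B"
      unfolding bounded_iff by auto
    then have "\<bar>f' b x b\<bar> \<le> max 0 B" for x by (auto simp: f'_def le_max_iff_disj)
    then show ?thesis by blast
  qed
  obtain R where "\<forall>x\<in>C. norm x \<le> R" using C(1) compact_imp_bounded bounded_iff by metis
  then have R: "f b x \<noteq> 0 \<Longrightarrow> norm x \<le> R" for b x using supp by (auto simp: f_def split: if_splits)
  have int: "integrable lborel (\<lambda>x. f' b x b)" "(\<integral>x. f' b x b \<partial>lborel) = 0" for b
  proof -
    obtain B where "\<And>x. \<bar>f' b x b\<bar> \<le> B" using ex by blast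
    from integral_directional_derivative_eq_0[of "f b", OF der this R]
    show "integrable lborel (\<lambda>x. f' b x b)" "(\<integral>x. f' b x b \<partial>lborel) = 0" by auto
  qed
  have Dh0: "Dh x = 0" if x: "x \<in> \<Omega> - C" for x
  proof -
    have "(h has_derivative (\<lambda>y. 0)) (at x)"
    proof (rule has_derivative_transform_within_open)
      show "((\<lambda>_. 0) has_derivative (\<lambda>y. 0)) (at x)" by simp
      show "open (\<Omega> - C)" using \<open>open \<Omega>\<close> \<open>closed C\<close> by blast
    qed (use x supp in auto)
    with h(1)[of x] x have "(\<lambda>y. Dh x \<bullet> y) = (\<lambda>y. 0)" using has_derivative_unique by blast
    from fun_cong[OF this, of "Dh x"] show ?thesis by simp
  qed
  have "indicat_real \<Omega> x *\<^sub>R (Dh x \<bullet> F x + h x * (\<Sum>b\<in>Basis. F' x b \<bullet> b)) = (\<Sum>b\<in>Basis. f' b x b)" for x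
  proof (cases "x \<in> C")
    case True
    have "Dh x \<bullet> F x = (\<Sum>b\<in>Basis. (Dh x \<bullet> b) * (F x \<bullet> b))" by (rule euclidean_inner)
    with True show ?thesis using C(2)
      by (auto simp: f'_def sum.distrib sum_distrib_left)
  next
    case False
    then show ?thesis using Dh0[of x] supp[of x] by (auto simp: f'_def indicator_def)
  qed
  then show ?thesis by (simp add: set_lebesgue_integral_def int)
qed

section \<open>Divergence-free fields tangential to the boundary\<close>

text \<open>
  The boundary is described by a \<open>C\<^sup>2\<close> defining function \<open>g\<close> with gradient \<open>D\<close>, and \<open>F\<close> is tangential
  in the sense that \<open>F \<bullet> D\<close> vanishes on it. No trace or surface measure enters: a cut-off in \<open>- g / \<epsilon>\<close>
  moves the test function into the interior, and the resulting error is controlled by applying the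
  interior integration by parts a second time, with \<open>D\<close> in place of \<open>F\<close>.
\<close>

lemma weak_form_of_zero_divergence:
  fixes g \<psi> :: "'a::euclidean_space \<Rightarrow> real" and D F D\<psi> :: "'a \<Rightarrow> 'a"
    and D' F' :: "'a \<Rightarrow> 'a \<Rightarrow> 'a"
  assumes "open \<Omega>"
    and g: "continuous_on (closure \<Omega>) g" "\<And>x. x \<in> \<Omega> \<Longrightarrow> g x < 0" "\<And>x. x \<in> frontier \<Omega> \<Longrightarrow> g x = 0"
      "\<And>x. x \<in> \<Omega> \<Longrightarrow> (g has_derivative (\<lambda>y. D x \<bullet> y)) (at x)"
    and D: "continuous_on (closure \<Omega>) D" "\<And>x. x \<in> frontier \<Omega> \<Longrightarrow> D x \<noteq> 0"
      "\<And>x. x \<in> \<Omega> \<Longrightarrow> (D has_derivative D' x) (at x)" "\<And>b. continuous_on \<Omega> (\<lambda>x. D' x b)"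
      "\<And>x. x \<in> \<Omega> \<Longrightarrow> \<bar>\<Sum>b\<in>Basis. D' x b \<bullet> b\<bar> \<le> A"
    and F: "continuous_on (closure \<Omega>) F" "\<And>x. x \<in> frontier \<Omega> \<Longrightarrow> F x \<bullet> D x = 0"
      "\<And>x. x \<in> \<Omega> \<Longrightarrow> (F has_derivative F' x) (at x)" "\<And>b. continuous_on \<Omega> (\<lambda>x. F' x b)"
      "\<And>x. x \<in> \<Omega> \<Longrightarrow> (\<Sum>b\<in>Basis. F' x b \<bullet> b) = 0"
    and \<psi>: "\<And>x. x \<in> \<Omega> \<Longrightarrow> (\<psi> has_derivative (\<lambda>y. D\<psi> x \<bullet> y)) (at x)" "continuous_on \<Omega> D\<psi>"
      "\<And>x. x \<in> \<Omega> \<Longrightarrow> \<bar>\<psi> x\<bar> \<le> M" "\<And>x. x \<in> \<Omega> \<Longrightarrow> norm (D\<psi> x) \<le> M"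
      "\<And>x. x \<in> \<Omega> \<Longrightarrow> r < norm x \<Longrightarrow> \<psi> x = 0"
  shows "(LINT x:\<Omega>|lborel. D\<psi> x \<bullet> F x) = 0"
proof -
  define R where "R = max 0 r"
  have R: "R \<ge> 0" and \<psi>R: "\<And>x. x \<in> \<Omega> \<Longrightarrow> R < norm x \<Longrightarrow> \<psi> x = 0"
    using \<psi>(5) by (auto simp: R_def)
  have D\<psi>R: "D\<psi> x = 0" if x: "x \<in> \<Omega>" "R < norm x" for x
  proof -
    have "(\<psi> has_derivative (\<lambda>y. 0)) (at x)"
    proof (rule has_derivative_transform_within_open)
      show "((\<lambda>_. 0) has_derivative (\<lambda>y. 0)) (at x)" by simp
      have "open (- cball 0 R :: 'a set)" by auto
      then show "open (\<Omega> \<inter> - cball 0 R)" using \<open>open \<Omega>\<close> by blast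
    qed (use x \<psi>R in auto)
    with \<psi>(1)[of x] x have "(\<lambda>y. D\<psi> x \<bullet> y) = (\<lambda>y. 0)" using has_derivative_unique by blast
    from fun_cong[OF this, of "D\<psi> x"] show ?thesis by simp
  qed
  define C where "C = closure \<Omega> \<inter> cball 0 (R + 1)"
  have C: "compact C" "C \<subseteq> closure \<Omega>" unfolding C_def by (auto intro: closed_Int_compact)
  have sub: "\<Omega> \<subseteq> closure \<Omega>" by (rule closure_subset)
  have frontier: "x \<in> \<Omega>" if "x \<in> closure \<Omega>" "x \<notin> frontier \<Omega>" for x
    using that \<open>open \<Omega>\<close> by (auto simp: frontier_def interior_open)
  obtain L where L0: "0 \<le> L" and L: "\<And>x. x \<in> C \<Longrightarrow> norm (D x) \<le> L" "\<And>x. x \<in> C \<Longrightarrow> norm (F x) \<le> L"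
  proof -
    have "bounded (D ` C)" "bounded (F ` C)"
      using C D(1) F(1) by (meson compact_continuous_image compact_imp_bounded continuous_on_subset)+
    then obtain L1 L2 where "\<forall>x\<in>C. norm (D x) \<le> L1" "\<forall>x\<in>C. norm (F x) \<le> L2"
      unfolding bounded_iff by auto
    then show ?thesis by (intro that[of "max 0 (max L1 L2)"]) force+
  qed

  \<comment> \<open>Localization to a bounded set: \<open>\<zeta>\<close> equals \<open>1\<close> where \<open>\<psi>\<close> lives.\<close>
  define \<zeta> where "\<zeta> x = smooth_step ((R + 1)\<^sup>2 - x \<bullet> x)" for x :: 'a
  define D\<zeta> where "D\<zeta> x = (- 2 * smooth_step_deriv ((R + 1)\<^sup>2 - x \<bullet> x)) *\<^sub>R x" for x :: 'a
  have \<zeta>: "(\<zeta> has_derivative (\<lambda>y. D\<zeta> x \<bullet> y)) (at x)" for x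
    unfolding \<zeta>_def D\<zeta>_def by (auto intro!: derivative_eq_intros simp: fun_eq_iff algebra_simps inner_commute)
  have \<zeta>c: "continuous_on S \<zeta>" "continuous_on S D\<zeta>" for S
    unfolding \<zeta>_def D\<zeta>_def by (intro continuous_intros)+
  have \<zeta>1: "\<zeta> x = 1" if "norm x \<le> R" for x
  proof -
    have "x \<bullet> x \<le> R\<^sup>2" using that by (simp add: dot_square_norm power_mono)
    then show ?thesis unfolding \<zeta>_def using R
      by (intro smooth_step_eq_1) (simp add: power2_eq_square algebra_simps)
  qed
  have \<zeta>0: "\<zeta> x = 0" "D\<zeta> x = 0" if "\<not> norm x \<le> R + 1" for x
  proof -
    have "(R + 1)\<^sup>2 \<le> x \<bullet> x" using that R by (simp add: dot_square_norm power_mono)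
    then show "\<zeta> x = 0" "D\<zeta> x = 0" unfolding \<zeta>_def D\<zeta>_def
      by (auto simp: smooth_step_eq_0 smooth_step_deriv_eq_0)
  qed
  have D\<zeta>b: "norm (D\<zeta> x) \<le> 4 * (R + 1)" for x
  proof (cases "norm x \<le> R + 1")
    case True
    have "norm (D\<zeta> x) = 2 * smooth_step_deriv ((R + 1)\<^sup>2 - x \<bullet> x) * norm x"
      using smooth_step_deriv_bounds(1) by (simp add: D\<zeta>_def abs_mult)
    also have "\<dots> \<le> 4 * (R + 1)"
      by (intro mult_mono) (use True smooth_step_deriv_bounds[of "(R + 1)\<^sup>2 - x \<bullet> x"] in auto)
    finally show ?thesis .
  qed (use \<zeta>0 R in auto)

  \<comment> \<open>Cut-off near the boundary: \<open>\<kappa> \<epsilon>\<close> vanishes for \<open>- g \<le> \<epsilon>\<close> and equals \<open>1\<close> for \<open>- g \<ge> 2 \<epsilon>\<close>; its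
    gradient is \<open>- s \<epsilon>\<close> times \<open>D\<close>.\<close>
  define \<kappa> where "\<kappa> \<epsilon> x = smooth_step (- g x / \<epsilon> - 1)" for \<epsilon> x
  define s where "s \<epsilon> x = smooth_step_deriv (- g x / \<epsilon> - 1) / \<epsilon>" for \<epsilon> x
  have \<kappa>: "(\<kappa> \<epsilon> has_derivative (\<lambda>y. (- s \<epsilon> x) *\<^sub>R D x \<bullet> y)) (at x)"
    if "x \<in> \<Omega>" "\<epsilon> > 0" for \<epsilon> x
    unfolding \<kappa>_def[abs_def] s_def
    by (auto intro!: derivative_eq_intros g(4)[OF that(1)] simp: that(2)[THEN less_imp_neq, symmetric] fun_eq_iff field_simps)
  have gc: "continuous_on \<Omega> g" and Dc: "continuous_on \<Omega> D" and Fc: "continuous_on \<Omega> F"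
    using g(1) D(1) F(1) sub continuous_on_subset by blast+
  have \<psi>c: "continuous_on \<Omega> \<psi>"
    by (auto intro!: continuous_at_imp_continuous_on has_derivative_continuous[OF \<psi>(1)])
  have \<kappa>c: "continuous_on \<Omega> (\<kappa> \<epsilon>)" "continuous_on \<Omega> (s \<epsilon>)" if "\<epsilon> > 0" for \<epsilon>
    unfolding \<kappa>_def[abs_def] s_def[abs_def] using that by (auto intro!: continuous_intros gc)
  have \<kappa>b: "0 \<le> \<kappa> \<epsilon> x" "\<kappa> \<epsilon> x \<le> 1" for \<epsilon> x unfolding \<kappa>_def by (simp_all add: smooth_step_bounds)
  have sb: "0 \<le> s \<epsilon> x" "s \<epsilon> x \<le> 2 / \<epsilon>" if "\<epsilon> > 0" for \<epsilon> x
    unfolding s_def using that smooth_step_deriv_bounds by (simp_all add: divide_right_mono)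

  \<comment> \<open>As \<open>g = 0\<close> on the frontier, the sublevel sets of \<open>g\<close> do not touch it.\<close>
  define K where "K \<epsilon> = {x \<in> C. g x \<le> - \<epsilon>}" for \<epsilon>
  have K: "compact (K \<epsilon>)" "K \<epsilon> \<subseteq> \<Omega>" if "\<epsilon> > 0" for \<epsilon>
  proof -
    have gC: "continuous_on C g" using g(1) C(2) continuous_on_subset by blast
    have "closed (K \<epsilon>)" unfolding K_def
      by (intro continuous_on_closed_Collect_le gC continuous_on_const compact_imp_closed C)
    then have "compact (C \<inter> K \<epsilon>)" using C(1) by blast
    moreover have "C \<inter> K \<epsilon> = K \<epsilon>" by (auto simp: K_def)
    ultimately show "compact (K \<epsilon>)" by simp
    show "K \<epsilon> \<subseteq> \<Omega>" using C(2) frontier g(3) that unfolding K_def by fastforce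
  qed
  have \<kappa>K: "\<kappa> \<epsilon> x = 0" if "x \<in> \<Omega> - K \<epsilon>" "norm x \<le> R + 1" "\<epsilon> > 0" for \<epsilon> x
  proof -
    have "- g x / \<epsilon> \<le> 1" using that sub by (auto simp: K_def C_def field_simps)
    then show ?thesis unfolding \<kappa>_def by (intro smooth_step_eq_0) simp
  qed
  have bounded_integrable: "set_integrable lborel \<Omega> f"
    if "continuous_on \<Omega> f" "\<And>x. x \<in> \<Omega> \<Longrightarrow> norm x \<le> R + 1 \<Longrightarrow> \<bar>f x\<bar> \<le> B"
      "\<And>x. x \<in> \<Omega> \<Longrightarrow> \<not> norm x \<le> R + 1 \<Longrightarrow> f x = 0"
    for f :: "'a \<Rightarrow> real" and B
  proof (rule set_integrable_continuous_bounded[OF _ that(1)])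
    fix x assume "x \<in> \<Omega>"
    then show "\<bar>f x\<bar> \<le> max 0 B" using that(2,3)[of x] by (cases "norm x \<le> R + 1") (auto simp: le_max_iff_disj)
    show "f x \<noteq> 0 \<Longrightarrow> norm x \<le> R + 1" using that(3)[of x] \<open>x \<in> \<Omega>\<close> by auto
  qed (use \<open>open \<Omega>\<close> in auto)
  have inC: "x \<in> C" if "x \<in> \<Omega>" "norm x \<le> R + 1" for x using that sub by (auto simp: C_def)

  \<comment> \<open>The shell estimate. Integrating the divergence of \<open>\<zeta> \<kappa> D\<close> expresses the integral of
    \<open>\<zeta> s \<bar>D\<bar>\<^sup>2\<close> through terms without \<open>1 / \<epsilon>\<close>.\<close>
  define P where "P = 4 * (R + 1) * L + \<bar>A\<bar>"
  define Q where "Q = P * measure lborel (cball (0::'a) (R + 1))"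
  define E where "E \<epsilon> x = \<zeta> x * s \<epsilon> x * (D x \<bullet> D x)" for \<epsilon> x
  have Eint: "set_integrable lborel \<Omega> (E \<epsilon>)" if "\<epsilon> > 0" for \<epsilon>
  proof (rule bounded_integrable)
    show "continuous_on \<Omega> (E \<epsilon>)" unfolding E_def[abs_def]
      by (intro continuous_intros \<kappa>c that \<zeta>c Dc)
    fix x assume x: "x \<in> \<Omega>" "norm x \<le> R + 1"
    have "D x \<bullet> D x \<le> L\<^sup>2" using L(1)[OF inC[OF x]] by (simp add: dot_square_norm power_mono)
    then have "\<zeta> x * s \<epsilon> x * (D x \<bullet> D x) \<le> 1 * (2 / \<epsilon>) * L\<^sup>2"
      using sb[OF that, of x] smooth_step_bounds that by (intro mult_mono) (auto simp: \<zeta>_def)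
    then show "\<bar>E \<epsilon> x\<bar> \<le> 1 * (2 / \<epsilon>) * L\<^sup>2"
      using sb[OF that, of x] smooth_step_bounds by (simp add: E_def \<zeta>_def)
  qed (use \<zeta>0 in \<open>auto simp: E_def\<close>)
  have shell: "(LINT x:\<Omega>|lborel. E \<epsilon> x) \<le> Q" if "\<epsilon> > 0" for \<epsilon>
  proof -
    define k where "k x = \<kappa> \<epsilon> x * (D\<zeta> x \<bullet> D x) + \<zeta> x * \<kappa> \<epsilon> x * (\<Sum>b\<in>Basis. D' x b \<bullet> b)" for x
    have kb: "\<bar>k x\<bar> \<le> P" if x: "x \<in> \<Omega>" "norm x \<le> R + 1" for x
    proof -
      have "\<bar>D\<zeta> x \<bullet> D x\<bar> \<le> norm (D\<zeta> x) * norm (D x)" by (rule Cauchy_Schwarz_ineq2)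
      also have "\<dots> \<le> 4 * (R + 1) * L" using D\<zeta>b L(1)[OF inC[OF x]] R by (intro mult_mono) auto
      finally have 1: "\<bar>\<kappa> \<epsilon> x * (D\<zeta> x \<bullet> D x)\<bar> \<le> 1 * (4 * (R + 1) * L)"
        unfolding abs_mult by (intro mult_mono) (use \<kappa>b[of \<epsilon> x] in auto)
      have "\<bar>\<zeta> x * \<kappa> \<epsilon> x\<bar> \<le> 1" using \<kappa>b[of \<epsilon> x] smooth_step_bounds
        by (simp add: abs_mult \<zeta>_def mult_le_one)
      then have 2: "\<bar>\<zeta> x * \<kappa> \<epsilon> x * (\<Sum>b\<in>Basis. D' x b \<bullet> b)\<bar> \<le> 1 * A"
        unfolding abs_mult[of "\<zeta> x * \<kappa> \<epsilon> x"] using D(5)[OF x(1)] by (intro mult_mono) auto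
      show ?thesis using 1 2 unfolding k_def P_def by linarith
    qed
    have k0: "k x = 0" if "\<not> norm x \<le> R + 1" for x using \<zeta>0[OF that] by (simp add: k_def)
    have kint: "set_integrable lborel \<Omega> k"
    proof (rule bounded_integrable[OF _ kb k0])
      show "continuous_on \<Omega> k" unfolding k_def[abs_def]
        by (intro continuous_intros \<kappa>c \<open>\<epsilon> > 0\<close> \<zeta>c Dc D(4))
    qed
    have "(LINT x:\<Omega>|lborel. (\<zeta> x *\<^sub>R ((- s \<epsilon> x) *\<^sub>R D x) + \<kappa> \<epsilon> x *\<^sub>R D\<zeta> x) \<bullet> D x
        + (\<zeta> x * \<kappa> \<epsilon> x) * (\<Sum>b\<in>Basis. D' x b \<bullet> b)) = 0"
    proof (rule integral_by_parts_compact_support[OF \<open>open \<Omega>\<close> K(1,2)[OF that] _ _ _ D(3,4)])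
      fix x assume "x \<in> \<Omega>"
      show "((\<lambda>x. \<zeta> x * \<kappa> \<epsilon> x) has_derivative
          (\<lambda>y. (\<zeta> x *\<^sub>R ((- s \<epsilon> x) *\<^sub>R D x) + \<kappa> \<epsilon> x *\<^sub>R D\<zeta> x) \<bullet> y)) (at x)"
        by (auto intro!: derivative_eq_intros \<zeta> \<kappa>[OF \<open>x \<in> \<Omega>\<close> that] simp: fun_eq_iff algebra_simps)
    next
      show "continuous_on \<Omega> (\<lambda>x. \<zeta> x *\<^sub>R ((- s \<epsilon> x) *\<^sub>R D x) + \<kappa> \<epsilon> x *\<^sub>R D\<zeta> x)"
        by (intro continuous_intros \<kappa>c that \<zeta>c Dc)
    next
      fix x assume "x \<in> \<Omega> - K \<epsilon>"
      then show "\<zeta> x * \<kappa> \<epsilon> x = 0" using \<kappa>K[of x \<epsilon>] \<zeta>0[of x] that by auto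
    qed
    also have "(\<lambda>x. (\<zeta> x *\<^sub>R ((- s \<epsilon> x) *\<^sub>R D x) + \<kappa> \<epsilon> x *\<^sub>R D\<zeta> x) \<bullet> D x
        + (\<zeta> x * \<kappa> \<epsilon> x) * (\<Sum>b\<in>Basis. D' x b \<bullet> b)) = (\<lambda>x. k x - E \<epsilon> x)"
      by (simp add: k_def E_def fun_eq_iff algebra_simps)
    finally have "(LINT x:\<Omega>|lborel. E \<epsilon> x) = (LINT x:\<Omega>|lborel. k x)"
      using set_integral_diff(2)[OF kint Eint[OF that]] by simp
    also have "\<dots> \<le> (LINT x|lborel. indicator (cball (0::'a) (R + 1)) x *\<^sub>R P)"
      unfolding set_lebesgue_integral_def
    proof (rule integral_mono)
      show "integrable lborel (\<lambda>x. indicat_real \<Omega> x *\<^sub>R k x)" using kint by (simp add: set_integrable_def)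
      show "integrable lborel (\<lambda>x. indicator (cball (0::'a) (R + 1)) x *\<^sub>R P)"
        by (intro integrable_scaleR_left)
          (use emeasure_lborel_cball_finite[of "0::'a" "R + 1"] in \<open>auto simp: integrable_indicator_iff less_top\<close>)
      fix x
      have "0 \<le> P" using L0 R by (simp add: P_def)
      then show "indicat_real \<Omega> x *\<^sub>R k x \<le> indicator (cball 0 (R + 1)) x *\<^sub>R P"
        using kb[of x] k0[of x] by (auto simp: indicator_def)
    qed
    also have "\<dots> = Q" by (simp add: Q_def)
    finally show ?thesis .
  qed

  \<comment> \<open>By compactness, \<open>\<bar>D \<bullet> F\<bar>\<close> is small relative to \<open>\<bar>D\<bar>\<^sup>2\<close> close to the boundary.\<close>
  have near: "\<exists>\<epsilon>0>0. \<forall>x\<in>C. - g x < \<epsilon>0 \<longrightarrow> \<bar>D x \<bullet> F x\<bar> \<le> \<delta> * (D x \<bullet> D x)" if "\<delta> > 0" for \<delta>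
  proof -
    define k where "k x = \<delta> * (D x \<bullet> D x) - \<bar>D x \<bullet> F x\<bar>" for x
    have kc: "continuous_on C k" unfolding k_def[abs_def] using C(2)
      by (intro continuous_intros continuous_on_subset[OF D(1)] continuous_on_subset[OF F(1)])
    define Z where "Z = {x \<in> C. k x \<le> 0}"
    have "closed Z" unfolding Z_def
      by (intro continuous_on_closed_Collect_le kc continuous_on_const compact_imp_closed C)
    then have "compact (C \<inter> Z)" using C(1) by blast
    moreover have "C \<inter> Z = Z" by (auto simp: Z_def)
    ultimately have Z: "compact Z" "Z \<subseteq> C" by (auto simp: Z_def)
    have gZ: "g x < 0" if "x \<in> Z" for x
    proof -
      have "x \<notin> frontier \<Omega>"
      proof
        assume x: "x \<in> frontier \<Omega>"
        then have "k x = \<delta> * (D x \<bullet> D x)" using F(2)[OF x] by (simp add: k_def inner_commute)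
        also have "\<dots> > 0" using D(2)[OF x] \<open>\<delta> > 0\<close> by simp
        finally show False using that by (simp add: Z_def)
      qed
      then show ?thesis using frontier g(2) that C(2) Z(2) by blast
    qed
    show ?thesis
    proof (cases "Z = {}")
      case True
      then show ?thesis by (intro exI[of _ 1]) (force simp: Z_def k_def)
    next
      case False
      have "continuous_on Z g" using g(1) Z(2) C(2) by (meson continuous_on_subset)
      then obtain z where z: "z \<in> Z" "\<And>x. x \<in> Z \<Longrightarrow> g x \<le> g z"
        using continuous_attains_sup[OF Z(1) False] by blast
      show ?thesis
      proof (intro exI[of _ "- g z"] conjI ballI impI)
        show "- g z > 0" using gZ[OF z(1)] by simp
        fix x assume "x \<in> C" "- g x < - g z"
        then have "x \<notin> Z" using z(2)[of x] by auto
        then show "\<bar>D x \<bullet> F x\<bar> \<le> \<delta> * (D x \<bullet> D x)" using \<open>x \<in> C\<close> by (auto simp: Z_def k_def)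
      qed
    qed
  qed

  define a where "a \<epsilon> = (LINT x:\<Omega>|lborel. \<kappa> \<epsilon> x * (D\<psi> x \<bullet> F x))" for \<epsilon>
  have \<kappa>Fint: "set_integrable lborel \<Omega> (\<lambda>x. \<kappa> \<epsilon> x * (D\<psi> x \<bullet> F x))" if "\<epsilon> > 0" for \<epsilon>
  proof (rule bounded_integrable)
    show "continuous_on \<Omega> (\<lambda>x. \<kappa> \<epsilon> x * (D\<psi> x \<bullet> F x))" by (intro continuous_intros \<kappa>c that \<psi> Fc)
    fix x assume x: "x \<in> \<Omega>" "norm x \<le> R + 1"
    have "\<bar>D\<psi> x \<bullet> F x\<bar> \<le> norm (D\<psi> x) * norm (F x)" by (rule Cauchy_Schwarz_ineq2)
    also have "\<dots> \<le> M * L" using \<psi>(4)[OF x(1)] L(2)[OF inC[OF x]]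
      by (intro mult_mono) (auto intro: order_trans[OF norm_ge_zero])
    finally show "\<bar>\<kappa> \<epsilon> x * (D\<psi> x \<bullet> F x)\<bar> \<le> 1 * (M * L)"
      unfolding abs_mult by (intro mult_mono) (use \<kappa>b[of \<epsilon> x] in auto)
  qed (use D\<psi>R in auto)
  \<comment> \<open>Integrating the divergence of \<open>\<psi> \<kappa> F\<close>: the error term carries \<open>s (D \<bullet> F)\<close>, which the two previous
    facts bound by \<open>\<delta>\<close> times the shell integral.\<close>
  have small: "\<bar>a \<epsilon>\<bar> \<le> M * \<delta> * Q"
    if e: "\<epsilon> > 0" "\<delta> > 0" "2 * \<epsilon> < \<epsilon>0" "\<forall>x\<in>C. - g x < \<epsilon>0 \<longrightarrow> \<bar>D x \<bullet> F x\<bar> \<le> \<delta> * (D x \<bullet> D x)"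
      and "\<Omega> \<noteq> {}" for \<epsilon> \<epsilon>0 \<delta>
  proof -
    have M: "M \<ge> 0" using \<psi>(3) \<open>\<Omega> \<noteq> {}\<close> by (meson abs_ge_zero all_not_in_conv order_trans)
    define k where "k x = \<psi> x * s \<epsilon> x * (D x \<bullet> F x)" for x
    have kE: "\<bar>k x\<bar> \<le> M * \<delta> * E \<epsilon> x" if x: "x \<in> \<Omega>" for x
    proof -
      have E0: "0 \<le> E \<epsilon> x" unfolding E_def \<zeta>_def using sb[OF e(1)] smooth_step_bounds by simp
      consider "R < norm x" | "s \<epsilon> x = 0" | "norm x \<le> R" "s \<epsilon> x \<noteq> 0" by linarith
      then show ?thesis
      proof cases
        case 3
        then have "\<not> (1 \<le> - g x / \<epsilon> - 1)" unfolding s_def using smooth_step_deriv_eq_0 by force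
        then have "- g x < \<epsilon>0" using e(1,3) by (simp add: field_simps)
        then have "\<bar>D x \<bullet> F x\<bar> \<le> \<delta> * (D x \<bullet> D x)" using e(4) inC[OF x] 3 by simp
        then have "\<bar>\<psi> x\<bar> * s \<epsilon> x * \<bar>D x \<bullet> F x\<bar> \<le> M * s \<epsilon> x * (\<delta> * (D x \<bullet> D x))"
          using \<psi>(3)[OF x] sb(1)[OF e(1)] M by (intro mult_mono) auto
        then show ?thesis using sb(1)[OF e(1)] \<zeta>1[OF 3(1)] by (simp add: k_def E_def abs_mult mult_ac)
      qed (use \<psi>R[OF x] M e(2) E0 in \<open>auto simp: k_def\<close>)
    qed
    have kint: "set_integrable lborel \<Omega> k"
      unfolding set_integrable_def
    proof (rule Bochner_Integration.integrable_bound)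
      show "integrable lborel (\<lambda>x. indicat_real \<Omega> x *\<^sub>R (M * \<delta> * E \<epsilon> x))"
        using set_integrable_mult_right[OF Eint[OF e(1)], of "M * \<delta>"] by (simp add: set_integrable_def)
      have "continuous_on \<Omega> k" unfolding k_def[abs_def] by (intro continuous_intros \<kappa>c e \<psi>c Dc Fc)
      then show "(\<lambda>x. indicat_real \<Omega> x *\<^sub>R k x) \<in> borel_measurable lborel"
        using borel_measurable_continuous_on_indicator[of \<Omega> k] \<open>open \<Omega>\<close> by simp
      show "AE x in lborel. norm (indicat_real \<Omega> x *\<^sub>R k x) \<le> norm (indicat_real \<Omega> x *\<^sub>R (M * \<delta> * E \<epsilon> x))"
        using kE by (intro AE_I2) (force simp: indicator_def)
    qed
    have "(LINT x:\<Omega>|lborel. (\<psi> x *\<^sub>R ((- s \<epsilon> x) *\<^sub>R D x) + \<kappa> \<epsilon> x *\<^sub>R D\<psi> x) \<bullet> F x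
        + (\<psi> x * \<kappa> \<epsilon> x) * (\<Sum>b\<in>Basis. F' x b \<bullet> b)) = 0"
    proof (rule integral_by_parts_compact_support[OF \<open>open \<Omega>\<close> K(1,2)[OF e(1)] _ _ _ F(3,4)])
      fix x assume "x \<in> \<Omega>"
      show "((\<lambda>x. \<psi> x * \<kappa> \<epsilon> x) has_derivative
          (\<lambda>y. (\<psi> x *\<^sub>R ((- s \<epsilon> x) *\<^sub>R D x) + \<kappa> \<epsilon> x *\<^sub>R D\<psi> x) \<bullet> y)) (at x)"
        by (auto intro!: derivative_eq_intros \<psi>(1)[OF \<open>x \<in> \<Omega>\<close>] \<kappa>[OF \<open>x \<in> \<Omega>\<close> e(1)] simp: fun_eq_iff algebra_simps)
    next
      show "continuous_on \<Omega> (\<lambda>x. \<psi> x *\<^sub>R ((- s \<epsilon> x) *\<^sub>R D x) + \<kappa> \<epsilon> x *\<^sub>R D\<psi> x)"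
        by (intro continuous_intros \<kappa>c e \<psi>c \<psi> Dc)
    next
      fix x assume "x \<in> \<Omega> - K \<epsilon>"
      then show "\<psi> x * \<kappa> \<epsilon> x = 0" using \<kappa>K[of x \<epsilon>] \<psi>R[of x] e by force
    qed
    also have "(LINT x:\<Omega>|lborel. (\<psi> x *\<^sub>R ((- s \<epsilon> x) *\<^sub>R D x) + \<kappa> \<epsilon> x *\<^sub>R D\<psi> x) \<bullet> F x
        + (\<psi> x * \<kappa> \<epsilon> x) * (\<Sum>b\<in>Basis. F' x b \<bullet> b)) = (LINT x:\<Omega>|lborel. \<kappa> \<epsilon> x * (D\<psi> x \<bullet> F x) - k x)"
      using \<open>open \<Omega>\<close> by (intro set_lebesgue_integral_cong) (auto simp: F(5) k_def algebra_simps)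
    finally have "a \<epsilon> = (LINT x:\<Omega>|lborel. k x)"
      using set_integral_diff(2)[OF \<kappa>Fint[OF e(1)] kint] by (simp add: a_def)
    also have "\<bar>\<dots>\<bar> \<le> (LINT x:\<Omega>|lborel. M * \<delta> * E \<epsilon> x)"
      unfolding set_lebesgue_integral_def
    proof (rule order_trans[OF integral_abs_bound integral_mono])
      show "integrable lborel (\<lambda>x. \<bar>indicat_real \<Omega> x *\<^sub>R k x\<bar>)" using kint by (simp add: set_integrable_def)
      show "integrable lborel (\<lambda>x. indicat_real \<Omega> x *\<^sub>R (M * \<delta> * E \<epsilon> x))"
        using set_integrable_mult_right[OF Eint[OF e(1)], of "M * \<delta>"] by (simp add: set_integrable_def)
    qed (use kE in \<open>auto simp: indicator_def\<close>)
    also have "\<dots> \<le> M * \<delta> * Q"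
      using shell[OF e(1)] M e(2) by (simp add: mult_left_mono)
    finally show ?thesis .
  qed

  show ?thesis
  proof (cases "\<Omega> = {}")
    case True then show ?thesis by (simp add: set_lebesgue_integral_def)
  next
    case False
    define \<epsilon> where "\<epsilon> n = 1 / real (Suc n)" for n
    have \<epsilon>: "\<epsilon> n > 0" for n by (simp add: \<epsilon>_def)
    have \<epsilon>0: "\<epsilon> \<longlonglongrightarrow> 0" unfolding \<epsilon>_def[abs_def] using LIMSEQ_inverse_real_of_nat by (simp add: inverse_eq_divide)
    have "(\<lambda>n. a (\<epsilon> n)) \<longlonglongrightarrow> 0"
    proof (rule LIMSEQ_I)
      fix e :: real assume "e > 0"
      define \<delta> where "\<delta> = e / (\<bar>M * Q\<bar> + 1)"
      have \<delta>: "\<delta> > 0" using \<open>e > 0\<close> by (simp add: \<delta>_def add_nonneg_pos)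
      obtain \<epsilon>0 where e0: "\<epsilon>0 > 0" "\<forall>x\<in>C. - g x < \<epsilon>0 \<longrightarrow> \<bar>D x \<bullet> F x\<bar> \<le> \<delta> * (D x \<bullet> D x)"
        using near[OF \<delta>] by blast
      obtain N where N: "\<And>n. n \<ge> N \<Longrightarrow> \<epsilon> n < \<epsilon>0 / 2"
        using LIMSEQ_D[OF \<epsilon>0, of "\<epsilon>0 / 2"] e0(1) \<epsilon> by (auto simp: abs_of_pos)
      have "norm (a (\<epsilon> n) - 0) < e" if "n \<ge> N" for n
      proof -
        have "\<bar>a (\<epsilon> n)\<bar> \<le> M * \<delta> * Q"
          using small[OF \<epsilon> \<delta> _ e0(2) False, of n] N[OF that] by simp
        also have "\<dots> \<le> \<delta> * \<bar>M * Q\<bar>" using \<delta> abs_ge_self[of "M * Q"]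
          by (simp only: mult.assoc mult.left_commute[of M] mult_left_mono less_imp_le)
        also have "\<dots> < e" using \<open>e > 0\<close> by (simp add: \<delta>_def field_simps)
        finally show ?thesis by simp
      qed
      then show "\<exists>N. \<forall>n\<ge>N. norm (a (\<epsilon> n) - 0) < e" by blast
    qed
    moreover have "(\<lambda>n. a (\<epsilon> n)) \<longlonglongrightarrow> (LINT x:\<Omega>|lborel. D\<psi> x \<bullet> F x)"
      unfolding a_def set_lebesgue_integral_def
    proof (rule integral_dominated_convergence[where w = "\<lambda>x. \<bar>indicat_real \<Omega> x *\<^sub>R (D\<psi> x \<bullet> F x)\<bar>"])
      have "set_integrable lborel \<Omega> (\<lambda>x. D\<psi> x \<bullet> F x)"
      proof (rule bounded_integrable)
        show "continuous_on \<Omega> (\<lambda>x. D\<psi> x \<bullet> F x)" by (intro continuous_intros \<psi> Fc)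
        fix x assume x: "x \<in> \<Omega>" "norm x \<le> R + 1"
        have "\<bar>D\<psi> x \<bullet> F x\<bar> \<le> norm (D\<psi> x) * norm (F x)" by (rule Cauchy_Schwarz_ineq2)
        also have "\<dots> \<le> M * L" using \<psi>(4)[OF x(1)] L(2)[OF inC[OF x]]
          by (intro mult_mono) (auto intro: order_trans[OF norm_ge_zero])
        finally show "\<bar>D\<psi> x \<bullet> F x\<bar> \<le> M * L" .
      qed (use D\<psi>R in auto)
      then have int: "integrable lborel (\<lambda>x. indicat_real \<Omega> x *\<^sub>R (D\<psi> x \<bullet> F x))"
        by (simp add: set_integrable_def)
      then show "(\<lambda>x. indicat_real \<Omega> x *\<^sub>R (D\<psi> x \<bullet> F x)) \<in> borel_measurable lborel"
        "integrable lborel (\<lambda>x. \<bar>indicat_real \<Omega> x *\<^sub>R (D\<psi> x \<bullet> F x)\<bar>)" by auto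
      show "(\<lambda>x. indicat_real \<Omega> x *\<^sub>R (\<kappa> (\<epsilon> n) x * (D\<psi> x \<bullet> F x))) \<in> borel_measurable lborel" for n
        using \<kappa>Fint[OF \<epsilon>[of n]] unfolding set_integrable_def by auto
      show "AE x in lborel. (\<lambda>n. indicat_real \<Omega> x *\<^sub>R (\<kappa> (\<epsilon> n) x * (D\<psi> x \<bullet> F x)))
          \<longlonglongrightarrow> indicat_real \<Omega> x *\<^sub>R (D\<psi> x \<bullet> F x)"
      proof (rule AE_I2)
        fix x
        show "(\<lambda>n. indicat_real \<Omega> x *\<^sub>R (\<kappa> (\<epsilon> n) x * (D\<psi> x \<bullet> F x)))
          \<longlonglongrightarrow> indicat_real \<Omega> x *\<^sub>R (D\<psi> x \<bullet> F x)"
        proof (cases "x \<in> \<Omega>")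
          case True
          obtain N where N: "2 / (- g x) < real N" using reals_Archimedean2 by blast
          have "\<kappa> (\<epsilon> n) x = 1" if "n \<ge> N" for n
          proof -
            have "2 / (- g x) \<le> real (Suc n)" using N that by linarith
            then have "2 \<le> - g x * real (Suc n)" using g(2)[OF True]
              by (simp add: field_simps)
            then show ?thesis unfolding \<kappa>_def \<epsilon>_def by (intro smooth_step_eq_1) simp
          qed
          then have "\<forall>\<^sub>F n in sequentially. indicat_real \<Omega> x *\<^sub>R (\<kappa> (\<epsilon> n) x * (D\<psi> x \<bullet> F x))
              = indicat_real \<Omega> x *\<^sub>R (D\<psi> x \<bullet> F x)"
            unfolding eventually_sequentially by auto
          then show ?thesis by (rule tendsto_eventually)
        qed simp
      qed
      show "AE x in lborel. norm (indicat_real \<Omega> x *\<^sub>R (\<kappa> (\<epsilon> n) x * (D\<psi> x \<bullet> F x)))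
          \<le> \<bar>indicat_real \<Omega> x *\<^sub>R (D\<psi> x \<bullet> F x)\<bar>" for n
        using \<kappa>b[of "\<epsilon> n"] by (intro AE_I2) (auto simp: indicator_def abs_mult mult_left_le_one_le)
    qed
    ultimately show ?thesis using LIMSEQ_unique by blast
  qed
qed

section \<open>The density as a function of the speed\<close>

text \<open>
  With \<open>s = q\<^sup>2\<close>, the quantity \<open>\<rho> s + 2 s \<rho>' s\<close> is the derivative of the mass flux \<open>q \<rho> (q\<^sup>2)\<close> with
  respect to the speed \<open>q\<close>; its positivity is ellipticity of the potential equation.
\<close>

definition elliptic_density :: "(real \<Rightarrow> real) \<Rightarrow> (real \<Rightarrow> real) \<Rightarrow> bool" where
  "elliptic_density \<rho> \<rho>' \<longleftrightarrow> continuous_on {0..<1} \<rho>' \<and>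
    (\<forall>s\<in>{0..<1}. (\<rho> has_real_derivative \<rho>' s) (at s) \<and> 0 < \<rho> s \<and> 0 < \<rho> s + 2 * s * \<rho>' s)"

lemma pressure_law_derivs:
  assumes "pressure_law p" "0 < r"
  shows "(deriv p has_real_derivative deriv (deriv p) r) (at r)" "0 < deriv p r" "0 < deriv (deriv p) r"
proof -
  have "(deriv ^^ 1) p differentiable (at r)" using assms unfolding pressure_law_def by blast
  then show "(deriv p has_real_derivative deriv (deriv p) r) (at r)"
    by (simp add: DERIV_deriv_iff_real_differentiable)
  show "0 < deriv p r" "0 < deriv (deriv p) r" using assms unfolding pressure_law_def by auto
qed

lemma deriv_pressure_strict_mono:
  assumes "pressure_law p" "0 < r" "r < s"
  shows "deriv p r < deriv p s"
proof (rule DERIV_pos_imp_increasing[OF \<open>r < s\<close>])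
  fix x assume "r \<le> x"
  then have "0 < x" using assms by simp
  from pressure_law_derivs[OF assms(1) this]
  show "\<exists>y. (deriv p has_real_derivative y) (at x) \<and> 0 < y" by blast
qed

lemma enthalpy_has_derivative:
  assumes "pressure_law p" "0 < r"
  shows "(enthalpy p has_real_derivative deriv p r / r) (at r)"
proof -
  define a b where "a = min 1 (r / 2)" and "b = max 1 (2 * r)"
  have ab: "0 < a" "a \<le> 1" "1 \<le> b" "a < r" "r < b" using \<open>0 < r\<close> by (auto simp: a_def b_def)
  have cont: "continuous_on {a..b} (\<lambda>s. deriv p s / s)"
  proof (intro continuous_intros ballI)
    show "continuous_on {a..b} (deriv p)"
    proof (intro continuous_at_imp_continuous_on ballI)
      fix x assume "x \<in> {a..b}"
      then show "isCont (deriv p) x"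
        using pressure_law_derivs(1)[OF assms(1), of x] ab(1) by (auto intro: DERIV_isCont)
    qed
  qed (use ab in auto)
  have "((\<lambda>u. LBINT s=ereal 1..ereal u. deriv p s / s) has_vector_derivative deriv p r / r) (at r within {a..b})"
    by (rule interval_integral_FTC2[OF ab(2,3) cont]) (use ab in auto)
  then have "((\<lambda>u. LBINT s=ereal 1..ereal u. deriv p s / s) has_vector_derivative deriv p r / r) (at r)"
    using at_within_interior[of r "{a..b}"] ab by simp
  then show ?thesis by (simp add: enthalpy_def[abs_def] has_real_derivative_iff_has_vector_derivative)
qed

lemma enthalpy_strict_mono:
  assumes "pressure_law p" "0 < r" "r < s"
  shows "enthalpy p r < enthalpy p s"
proof (rule DERIV_pos_imp_increasing[OF \<open>r < s\<close>])
  fix x assume "r \<le> x"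
  then have "0 < x" using assms by simp
  from enthalpy_has_derivative[OF assms(1) this] pressure_law_derivs(2)[OF assms(1) this] \<open>0 < x\<close>
  show "\<exists>y. (enthalpy p has_real_derivative y) (at x) \<and> 0 < y" by (meson divide_pos_pos)
qed

lemma enthalpy_inj:
  assumes "pressure_law p" "0 < r" "0 < s" "enthalpy p r = enthalpy p s"
  shows "r = s"
  using enthalpy_strict_mono[OF assms(1), of r s] enthalpy_strict_mono[OF assms(1), of s r] assms
  by (cases r s rule: linorder_cases) auto

lemma bernoulli_density_eq:
  assumes "pressure_law p" "0 < r" "s / 2 + enthalpy p r = c"
  shows "bernoulli_density p c s = r"
proof -
  have "(THE r. 0 < r \<and> s / 2 + enthalpy p r = c) = r"
    by (rule the_equality) (use assms enthalpy_inj[OF assms(1)] in auto)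
  then show ?thesis using assms by (auto simp: bernoulli_density_def)
qed

text \<open>
  The left-hand side is increasing in \<open>r\<close> and exceeds \<open>c\<close> at the stagnation density \<open>r0\<close>. It is below
  \<open>c\<close> at \<open>a = r0 / e\<close>: since \<open>p'\<close> increases, the enthalpy drops between \<open>r0\<close> and \<open>a\<close> by at least
  \<open>p' a\<close> times the integral of \<open>1 / s\<close>, that is by \<open>p' a\<close>, more than the kinetic term \<open>p' a / 2\<close>.
\<close>

lemma critical_density_exists:
  assumes p: "pressure_law p" and r0: "0 < r0" "enthalpy p r0 = c"
  shows "\<exists>r>0. deriv p r / 2 + enthalpy p r = c"
proof -
  define a where "a = r0 * exp (- 1)"
  have a: "0 < a" "a < r0" using r0 by (auto simp: a_def)
  note d = pressure_law_derivs[OF p] enthalpy_has_derivative[OF p]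
  have "enthalpy p a - deriv p a * ln a \<le> enthalpy p r0 - deriv p a * ln r0"
  proof (rule DERIV_nonneg_imp_nondecreasing[of a r0 "\<lambda>r. enthalpy p r - deriv p a * ln r"])
    fix x assume "a \<le> x"
    then have x: "0 < x" using a by simp
    have "deriv p a \<le> deriv p x"
      using deriv_pressure_strict_mono[OF p a(1), of x] \<open>a \<le> x\<close> by (cases "a = x") auto
    then have "0 \<le> deriv p x / x - deriv p a * (1 / x)" using x by (simp add: divide_right_mono)
    moreover have "((\<lambda>r. enthalpy p r - deriv p a * ln r) has_real_derivative
        deriv p x / x - deriv p a * (1 / x)) (at x)"
      using x by (auto intro!: derivative_eq_intros d(4) simp: inverse_eq_divide)
    ultimately show "\<exists>y. ((\<lambda>r. enthalpy p r - deriv p a * ln r) has_real_derivative y) (at x) \<and> 0 \<le> y"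
      by blast
  qed (use a in auto)
  moreover have "ln r0 = ln a + 1" using r0 by (simp add: a_def ln_mult)
  ultimately have "enthalpy p a + deriv p a \<le> c" using r0 by (simp add: algebra_simps)
  then have lo: "deriv p a / 2 + enthalpy p a \<le> c" using d(2)[OF a(1)] by simp
  have hi: "c \<le> deriv p r0 / 2 + enthalpy p r0" using r0 d(2)[OF r0(1)] by simp
  have "\<exists>x. a \<le> x \<and> x \<le> r0 \<and> deriv p x / 2 + enthalpy p x = c"
  proof (rule IVT[of "\<lambda>x. deriv p x / 2 + enthalpy p x", OF lo hi])
    show "\<forall>x. a \<le> x \<and> x \<le> r0 \<longrightarrow> isCont (\<lambda>x. deriv p x / 2 + enthalpy p x) x"
      using a by (auto intro!: continuous_intros DERIV_isCont[OF d(1)] DERIV_isCont[OF d(4)])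
  qed (use a in auto)
  then obtain x where "a \<le> x" "deriv p x / 2 + enthalpy p x = c" by blast
  with a show ?thesis by (intro exI[of _ x]) auto
qed

lemma critical_speed_eq:
  assumes p: "pressure_law p" and r: "0 < r" "deriv p r / 2 + enthalpy p r = c"
  shows "critical_speed p c = sqrt (deriv p r)"
  unfolding critical_speed_def
proof (rule the_equality)
  show "0 < sqrt (deriv p r) \<and>
    (\<exists>ra>0. (sqrt (deriv p r))\<^sup>2 / 2 + enthalpy p ra = c \<and> (sqrt (deriv p r))\<^sup>2 = deriv p ra)"
    using r pressure_law_derivs(2)[OF p r(1)] by auto
  fix q assume "0 < q \<and> (\<exists>r>0. q\<^sup>2 / 2 + enthalpy p r = c \<and> q\<^sup>2 = deriv p r)"
  then obtain s where s: "0 < q" "0 < s" "deriv p s / 2 + enthalpy p s = c" "q\<^sup>2 = deriv p s" by auto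
  have "s = r"
  proof (cases r s rule: linorder_cases)
    case less
    then show ?thesis using s r deriv_pressure_strict_mono[OF p r(1) less] enthalpy_strict_mono[OF p r(1) less]
      by linarith
  next
    case greater
    then show ?thesis using s r deriv_pressure_strict_mono[OF p s(2) greater]
        enthalpy_strict_mono[OF p s(2) greater] by linarith
  qed simp
  with s show "q = sqrt (deriv p r)" by (metis abs_of_pos real_sqrt_abs)
qed

text \<open>
  Bernoulli's law gives the dimensional density as the inverse of \<open>S r = 2 (c - h r)\<close>, so its derivative
  at \<open>S r\<close> is \<open>- r / (2 p' r)\<close>. With \<open>q2\<close> the square of the critical speed, ellipticity at \<open>s\<close> becomes
  \<open>q2 s < p' r\<close>. This holds for \<open>s < 1\<close>, because then \<open>r\<close> exceeds the critical density \<open>rc\<close>, where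
  \<open>p' rc = q2\<close>.
\<close>

lemma nondim_density_elliptic:
  assumes p: "pressure_law p" and c: "\<exists>r>0. enthalpy p r = c"
  shows "\<exists>\<rho>'. elliptic_density (nondim_density p c) \<rho>'"
proof -
  obtain r0 where r0: "0 < r0" "enthalpy p r0 = c" using c by blast
  obtain rc where rc: "0 < rc" "deriv p rc / 2 + enthalpy p rc = c"
    using critical_density_exists[OF p r0] by blast
  define q2 where "q2 = deriv p rc"
  have q2: "(critical_speed p c)\<^sup>2 = q2" "0 < q2"
    using critical_speed_eq[OF p rc] pressure_law_derivs(2)[OF p rc(1)] by (auto simp: q2_def)
  define B where "B = bernoulli_density p c"
  define S where "S r = 2 * (c - enthalpy p r)" for r
  have BS: "B (S r) = r" if "0 < r" for r
    unfolding B_def by (rule bernoulli_density_eq[OF p that]) (simp add: S_def field_simps)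
  have Sd: "(S has_real_derivative - 2 * deriv p r / r) (at r)" if "0 < r" for r
    unfolding S_def[abs_def] using that
    by (auto intro!: derivative_eq_intros enthalpy_has_derivative[OF p that])
  have Bd: "(B has_real_derivative - (r / (2 * deriv p r))) (at (S r))" if r: "0 < r" for r
  proof -
    have p': "0 < deriv p r" using pressure_law_derivs(2)[OF p r] .
    have "(B has_derivative (\<lambda>h. - (r / (2 * deriv p r)) * h)) (at (S r))"
    proof (rule has_derivative_inverse_strong[where S = "{0<..}" and f = S])
      show "(S has_derivative (\<lambda>h. (- 2 * deriv p r / r) * h)) (at r)"
        using Sd[OF r] unfolding has_field_derivative_def .
      show "(\<lambda>h. (- 2 * deriv p r / r) * h) \<circ> (\<lambda>h. - (r / (2 * deriv p r)) * h) = id"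
        using r p' by (auto simp: fun_eq_iff)
      show "continuous_on {0<..} S"
        by (intro continuous_at_imp_continuous_on ballI DERIV_isCont[OF Sd]) simp
    qed (use r BS in auto)
    then show ?thesis unfolding has_field_derivative_def .
  qed
  have Src: "S rc = q2" "S r0 = 0" using rc r0 by (auto simp: S_def q2_def)
  have Bq2: "B q2 = rc" using BS[OF rc(1)] Src by simp
  have rc0: "rc < r0"
  proof (rule ccontr)
    assume "\<not> rc < r0"
    then have "enthalpy p r0 \<le> enthalpy p rc"
      using enthalpy_strict_mono[OF p r0(1), of rc] by (cases "r0 = rc") auto
    then show False using rc r0 q2 by (simp add: q2_def)
  qed
  have ex: "\<exists>r>rc. S r = q2 * s" if s: "0 \<le> s" "s < 1" for s
  proof -
    have "\<exists>r. rc \<le> r \<and> r \<le> r0 \<and> S r = q2 * s"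
    proof (rule IVT2)
      show "S r0 \<le> q2 * s" "q2 * s \<le> S rc" using Src q2 s by (auto simp: mult_left_le)
      show "\<forall>x. rc \<le> x \<and> x \<le> r0 \<longrightarrow> isCont S x" using rc by (auto intro: DERIV_isCont[OF Sd])
    qed (use rc0 in auto)
    then obtain r where r: "rc \<le> r" "S r = q2 * s" by blast
    have "q2 * s < q2" using q2 s by simp
    then have "r \<noteq> rc" using r Src by auto
    with r show ?thesis by (intro exI[of _ r]) auto
  qed
  define \<rho> where "\<rho> = nondim_density p c"
  have \<rho>: "\<rho> s = B (q2 * s) / rc" for s
    by (simp add: \<rho>_def nondim_density_def q2 Bq2[unfolded B_def] B_def)
  define \<rho>' where "\<rho>' s = - (q2 / (2 * rc)) * (B (q2 * s) / deriv p (B (q2 * s)))" for s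
  have pos: "rc < B (q2 * s)" and der: "(B has_real_derivative
      - (B (q2 * s) / (2 * deriv p (B (q2 * s))))) (at (q2 * s))" if s: "0 \<le> s" "s < 1" for s
  proof -
    obtain r where r: "rc < r" "S r = q2 * s" using ex[OF s] by blast
    then have "B (q2 * s) = r" using BS[of r] rc by simp
    then show "rc < B (q2 * s)" "(B has_real_derivative
      - (B (q2 * s) / (2 * deriv p (B (q2 * s))))) (at (q2 * s))"
      using r Bd[of r] rc by auto
  qed
  have "elliptic_density \<rho> \<rho>'"
    unfolding elliptic_density_def
  proof (intro conjI ballI)
    show "continuous_on {0..<1} \<rho>'"
    proof (intro continuous_at_imp_continuous_on ballI)
      fix s :: real assume "s \<in> {0..<1}"
      then have s: "0 \<le> s" "s < 1" by auto
      have B0: "0 < B (q2 * s)" using pos[OF s] rc by simp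
      have 1: "isCont (\<lambda>s. B (q2 * s)) s"
        by (rule isCont_o2[where f = "\<lambda>s. q2 * s" and g = B])
          (use DERIV_isCont[OF der[OF s]] in \<open>auto intro!: continuous_intros\<close>)
      have 2: "isCont (\<lambda>s. deriv p (B (q2 * s))) s"
        by (rule isCont_o2[OF 1 DERIV_isCont[OF pressure_law_derivs(1)[OF p B0]]])
      show "isCont \<rho>' s" unfolding \<rho>'_def[abs_def]
        using 1 2 pressure_law_derivs(2)[OF p B0] by (intro continuous_intros) auto
    qed
    fix s :: real assume "s \<in> {0..<1}"
    then have s: "0 \<le> s" "s < 1" by auto
    define r where "r = B (q2 * s)"
    have r: "rc < r" "0 < r" using pos[OF s] rc by (auto simp: r_def)
    have "((\<lambda>s. B (q2 * s)) has_real_derivative - (r / (2 * deriv p r)) * q2) (at s)"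
      unfolding r_def by (rule DERIV_chain2[where f = B and g = "\<lambda>s. q2 * s", OF der[OF s]])
        (auto intro!: derivative_eq_intros)
    from DERIV_cdivide[OF this, of rc]
    show "(\<rho> has_real_derivative \<rho>' s) (at s)"
      by (simp add: \<rho>[abs_def] \<rho>'_def r_def[symmetric] mult_ac)
    show "0 < \<rho> s" using r rc by (simp add: \<rho> r_def[symmetric])
    have dq: "q2 < deriv p r" using deriv_pressure_strict_mono[OF p rc(1) r(1)] by (simp add: q2_def)
    have "q2 * s \<le> q2" using q2 s by (simp add: mult_left_le)
    then have "q2 * s < deriv p r" using dq by linarith
    moreover have "0 < deriv p r" using dq q2 by linarith
    ultimately have "q2 * s / deriv p r < 1" by simp
    then have "0 < r / rc * (1 - q2 * s / deriv p r)" using r rc by simp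
    also have "\<dots> = \<rho> s + 2 * s * \<rho>' s"
      using rc by (simp add: \<rho> \<rho>'_def r_def[symmetric] field_simps)
    finally show "0 < \<rho> s + 2 * s * \<rho>' s" .
  qed
  then show ?thesis unfolding \<rho>_def by blast
qed

text \<open>
  The inner product splits into a radial part \<open>(f a - f b) (a - b)\<close>, where \<open>a = \<bar>v\<bar>\<close>, \<open>b = \<bar>w\<bar>\<close>
  and \<open>f a = \<rho> (a\<^sup>2) a\<close>, and an angular part \<open>(\<rho> (a\<^sup>2) + \<rho> (b\<^sup>2)) (a b - v \<bullet> w)\<close>. Ellipticity bounds the
  first from below, positivity of \<open>\<rho>\<close> the second, and \<open>\<bar>v - w\<bar>\<^sup>2\<close> splits in the same way. The constants
  come from compactness of \<open>[0, \<theta>]\<close>, which is where \<open>\<theta> < 1\<close> enters.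
\<close>

lemma elliptic_flux_monotone:
  assumes \<rho>: "elliptic_density \<rho> \<rho>'" and \<theta>: "0 \<le> \<theta>" "\<theta> < 1"
  obtains \<mu> \<Lambda> where "0 < \<mu>" "0 \<le> \<Lambda>"
    "\<And>v w :: 'a::real_inner. norm v \<le> \<theta> \<Longrightarrow> norm w \<le> \<theta> \<Longrightarrow>
      \<mu> * (norm (v - w))\<^sup>2 \<le> (\<rho> ((norm v)\<^sup>2) *\<^sub>R v - \<rho> ((norm w)\<^sup>2) *\<^sub>R w) \<bullet> (v - w)"
    "\<And>v w :: 'a::real_inner. norm v \<le> \<theta> \<Longrightarrow> norm w \<le> \<theta> \<Longrightarrow>
      norm (\<rho> ((norm v)\<^sup>2) *\<^sub>R v - \<rho> ((norm w)\<^sup>2) *\<^sub>R w) \<le> \<Lambda> * norm (v - w)"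
proof -
  have sq: "a\<^sup>2 \<in> {0..<1}" if "0 \<le> a" "a \<le> \<theta>" for a
  proof -
    have "a < 1" using that \<theta> by simp
    then show ?thesis using that by (simp add: abs_square_less_1)
  qed
  have d\<rho>: "((\<lambda>a. \<rho> (a\<^sup>2)) has_real_derivative 2 * a * \<rho>' (a\<^sup>2)) (at a)" if "0 \<le> a" "a \<le> \<theta>" for a
  proof -
    have "(\<rho> has_real_derivative \<rho>' (a\<^sup>2)) (at (a\<^sup>2))"
      using \<rho> sq[OF that] unfolding elliptic_density_def by blast
    moreover have "((\<lambda>a. a\<^sup>2) has_real_derivative 2 * a) (at a)" by (auto intro!: derivative_eq_intros)
    ultimately have "((\<lambda>a. \<rho> (a\<^sup>2)) has_real_derivative \<rho>' (a\<^sup>2) * (2 * a)) (at a)"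
      by (rule DERIV_chain2)
    then show ?thesis by (simp add: mult_ac)
  qed
  have c\<rho>: "continuous_on {0..\<theta>} (\<lambda>a. \<rho> (a\<^sup>2))"
    by (intro continuous_at_imp_continuous_on ballI DERIV_isCont[OF d\<rho>]) auto
  have c\<rho>': "continuous_on {0..\<theta>} (\<lambda>a. \<rho>' (a\<^sup>2))"
    by (rule continuous_on_compose2[of "{0..<1}" \<rho>']) (use \<rho> sq in \<open>auto simp: elliptic_density_def intro!: continuous_intros\<close>)
  have lower: "\<exists>m>0. \<forall>a\<in>{0..\<theta>}. m \<le> k a" if k: "continuous_on {0..\<theta>} k" "\<forall>a\<in>{0..\<theta>}. 0 < k a"
    for k :: "real \<Rightarrow> real"
  proof -
    obtain z where "z \<in> {0..\<theta>}" "\<forall>a\<in>{0..\<theta>}. k z \<le> k a"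
      using continuous_attains_inf[OF compact_Icc _ k(1)] \<theta> by auto
    then show ?thesis using k(2) by blast
  qed
  have upper: "\<exists>M. \<forall>a\<in>{0..\<theta>}. \<bar>k a\<bar> \<le> M" if "continuous_on {0..\<theta>} k" for k :: "real \<Rightarrow> real"
    using compact_imp_bounded[OF compact_continuous_image[OF that compact_Icc]]
    unfolding bounded_iff by auto
  have p\<rho>: "0 < \<rho> (a\<^sup>2)" "0 < \<rho> (a\<^sup>2) + 2 * a\<^sup>2 * \<rho>' (a\<^sup>2)" if "0 \<le> a" "a \<le> \<theta>" for a
    using \<rho> sq[OF that] unfolding elliptic_density_def by auto
  obtain m1 where m1: "m1 > 0" "\<And>a. 0 \<le> a \<Longrightarrow> a \<le> \<theta> \<Longrightarrow> m1 \<le> \<rho> (a\<^sup>2)"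
    using lower[OF c\<rho>] p\<rho> by auto
  obtain m2 where m2: "m2 > 0" "\<And>a. 0 \<le> a \<Longrightarrow> a \<le> \<theta> \<Longrightarrow> m2 \<le> \<rho> (a\<^sup>2) + 2 * a\<^sup>2 * \<rho>' (a\<^sup>2)"
  proof -
    have "continuous_on {0..\<theta>} (\<lambda>a. \<rho> (a\<^sup>2) + 2 * a\<^sup>2 * \<rho>' (a\<^sup>2))"
      by (intro continuous_intros c\<rho> c\<rho>')
    from lower[OF this] p\<rho>(2) that show thesis by force
  qed
  obtain M1 where M1: "\<And>a. 0 \<le> a \<Longrightarrow> a \<le> \<theta> \<Longrightarrow> \<bar>\<rho> (a\<^sup>2)\<bar> \<le> M1" using upper[OF c\<rho>] by force
  obtain M2 where M2: "\<And>a. 0 \<le> a \<Longrightarrow> a \<le> \<theta> \<Longrightarrow> \<bar>2 * a * \<rho>' (a\<^sup>2)\<bar> \<le> M2"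
  proof -
    have "continuous_on {0..\<theta>} (\<lambda>a. 2 * a * \<rho>' (a\<^sup>2))" by (intro continuous_intros c\<rho>')
    from upper[OF this] that show thesis by force
  qed
  have M0: "0 \<le> M1" "0 \<le> M2" using M1[of 0] M2[of 0] \<theta> by auto
  define \<mu> where "\<mu> = min m1 m2"
  define \<Lambda> where "\<Lambda> = M1 + M2 * \<theta>"
  have \<mu>: "\<mu> > 0" "\<mu> \<le> m1" "\<mu> \<le> m2" using m1 m2 by (auto simp: \<mu>_def)
  define f where "f a = \<rho> (a\<^sup>2) * a" for a
  have f_inc: "\<mu> * (b - a) \<le> f b - f a" if ab: "0 \<le> a" "a \<le> b" "b \<le> \<theta>" for a b
  proof -
    have "f a - \<mu> * a \<le> f b - \<mu> * b"
    proof (rule DERIV_nonneg_imp_nondecreasing[OF ab(2)])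
      fix x assume "a \<le> x" "x \<le> b"
      then have x: "0 \<le> x" "x \<le> \<theta>" using ab by auto
      have "((\<lambda>x. f x - \<mu> * x) has_real_derivative \<rho> (x\<^sup>2) + 2 * x\<^sup>2 * \<rho>' (x\<^sup>2) - \<mu>) (at x)"
        unfolding f_def by (rule derivative_eq_intros d\<rho>[OF x] refl)+ (simp add: power2_eq_square)
      moreover have "0 \<le> \<rho> (x\<^sup>2) + 2 * x\<^sup>2 * \<rho>' (x\<^sup>2) - \<mu>" using m2(2)[OF x] \<mu> by simp
      ultimately show "\<exists>y. ((\<lambda>x. f x - \<mu> * x) has_real_derivative y) (at x) \<and> 0 \<le> y" by blast
    qed
    then show ?thesis by (simp add: algebra_simps)
  qed
  have f_mono: "\<mu> * (a - b)\<^sup>2 \<le> (f a - f b) * (a - b)" if "0 \<le> a" "a \<le> \<theta>" "0 \<le> b" "b \<le> \<theta>" for a b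
  proof (cases "a \<le> b")
    case True
    then have "\<mu> * (b - a) * (b - a) \<le> (f b - f a) * (b - a)"
      using f_inc[of a b] that by (intro mult_right_mono) auto
    then show ?thesis by (simp add: power2_eq_square algebra_simps)
  next
    case False
    then have "\<mu> * (a - b) * (a - b) \<le> (f a - f b) * (a - b)"
      using f_inc[of b a] that by (intro mult_right_mono) auto
    then show ?thesis by (simp add: power2_eq_square algebra_simps)
  qed
  show thesis
  proof (rule that[of \<mu> \<Lambda>])
    show "0 < \<mu>" "0 \<le> \<Lambda>" using \<mu> M0 \<theta> by (auto simp: \<Lambda>_def)
    fix v w :: 'a assume vw: "norm v \<le> \<theta>" "norm w \<le> \<theta>"
    define a b where "a = norm v" and "b = norm w"
    have ab: "0 \<le> a" "a \<le> \<theta>" "0 \<le> b" "b \<le> \<theta>" using vw by (auto simp: a_def b_def)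
    have aa: "v \<bullet> v = a\<^sup>2" "w \<bullet> w = b\<^sup>2" by (simp_all add: a_def b_def dot_square_norm)
    have cs: "0 \<le> a * b - v \<bullet> w" using norm_cauchy_schwarz[of v w] by (simp add: a_def b_def)
    have "\<mu> * (norm (v - w))\<^sup>2 = \<mu> * (a - b)\<^sup>2 + 2 * \<mu> * (a * b - v \<bullet> w)"
    proof -
      have "(norm (v - w))\<^sup>2 = a\<^sup>2 + b\<^sup>2 - 2 * (v \<bullet> w)"
        by (simp add: power2_norm_eq_inner inner_diff aa inner_commute[of w v])
      then show ?thesis by (simp only:) (simp add: power2_eq_square algebra_simps)
    qed
    also have "2 * \<mu> * (a * b - v \<bullet> w) \<le> (\<rho> (a\<^sup>2) + \<rho> (b\<^sup>2)) * (a * b - v \<bullet> w)"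
      using m1(2)[OF ab(1,2)] m1(2)[OF ab(3,4)] \<mu> cs by (intro mult_right_mono) auto
    also have "\<mu> * (a - b)\<^sup>2 \<le> (f a - f b) * (a - b)" by (rule f_mono[OF ab])
    also have "(f a - f b) * (a - b) + (\<rho> (a\<^sup>2) + \<rho> (b\<^sup>2)) * (a * b - v \<bullet> w)
        = (\<rho> (a\<^sup>2) *\<^sub>R v - \<rho> (b\<^sup>2) *\<^sub>R w) \<bullet> (v - w)"
      by (simp add: inner_diff aa inner_commute[of w v] f_def power2_eq_square algebra_simps)
    finally show "\<mu> * (norm (v - w))\<^sup>2 \<le> (\<rho> ((norm v)\<^sup>2) *\<^sub>R v - \<rho> ((norm w)\<^sup>2) *\<^sub>R w) \<bullet> (v - w)"
      by (simp add: a_def b_def)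
    have "norm (\<rho> (a\<^sup>2) - \<rho> (b\<^sup>2)) \<le> M2 * norm (a - b)"
    proof (rule field_differentiable_bound[OF convex_real_interval(5)])
      show "\<And>x. x \<in> {0..\<theta>} \<Longrightarrow> ((\<lambda>a. \<rho> (a\<^sup>2)) has_real_derivative 2 * x * \<rho>' (x\<^sup>2)) (at x within {0..\<theta>})"
        by (rule has_field_derivative_at_within[OF d\<rho>]) auto
    qed (use M2 ab in auto)
    moreover have "\<bar>a - b\<bar> \<le> norm (v - w)" unfolding a_def b_def by (rule norm_triangle_ineq3)
    ultimately have "\<bar>\<rho> (a\<^sup>2) - \<rho> (b\<^sup>2)\<bar> \<le> M2 * norm (v - w)"
      using M0 by (auto intro: order_trans mult_left_mono)
    then have "\<bar>\<rho> (a\<^sup>2) - \<rho> (b\<^sup>2)\<bar> * b \<le> M2 * norm (v - w) * \<theta>"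
      using ab M0 by (intro mult_mono) auto
    moreover have "\<bar>\<rho> (a\<^sup>2)\<bar> * norm (v - w) \<le> M1 * norm (v - w)"
      using M1[OF ab(1,2)] by (intro mult_right_mono) auto
    moreover have "\<rho> (a\<^sup>2) *\<^sub>R v - \<rho> (b\<^sup>2) *\<^sub>R w = \<rho> (a\<^sup>2) *\<^sub>R (v - w) + (\<rho> (a\<^sup>2) - \<rho> (b\<^sup>2)) *\<^sub>R w"
      by (simp add: algebra_simps)
    moreover have "norm (\<rho> (a\<^sup>2) *\<^sub>R (v - w) + (\<rho> (a\<^sup>2) - \<rho> (b\<^sup>2)) *\<^sub>R w)
        \<le> \<bar>\<rho> (a\<^sup>2)\<bar> * norm (v - w) + \<bar>\<rho> (a\<^sup>2) - \<rho> (b\<^sup>2)\<bar> * b"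
      by (rule norm_triangle_le) (simp add: b_def)
    ultimately have "norm (\<rho> (a\<^sup>2) *\<^sub>R v - \<rho> (b\<^sup>2) *\<^sub>R w) \<le> M1 * norm (v - w) + M2 * norm (v - w) * \<theta>"
      by simp
    then show "norm (\<rho> ((norm v)\<^sup>2) *\<^sub>R v - \<rho> ((norm w)\<^sup>2) *\<^sub>R w) \<le> \<Lambda> * norm (v - w)"
      by (simp add: a_def b_def \<Lambda>_def algebra_simps)
  qed
qed

section \<open>Differentiability and normals at the boundary\<close>

lemma linear_functional_inner:
  fixes f :: "'a::euclidean_space \<Rightarrow> real"
  assumes "linear f"
  shows "(\<Sum>b\<in>Basis. f b *\<^sub>R b) \<bullet> h = f h"
proof -
  have "f h = f (\<Sum>b\<in>Basis. (h \<bullet> b) *\<^sub>R b)" by (simp add: euclidean_representation)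
  also have "\<dots> = (\<Sum>b\<in>Basis. (h \<bullet> b) * f b)"
    by (simp add: linear_sum[OF assms] linear_scale[OF assms])
  also have "\<dots> = (\<Sum>b\<in>Basis. f b *\<^sub>R b) \<bullet> h"
    by (simp add: inner_sum_left inner_commute[of h] mult.commute)
  finally show ?thesis by simp
qed

lemma lipschitz_on_closure_bounded_derivative:
  fixes S :: "'a::real_normed_vector \<Rightarrow> 'b::real_normed_vector" and S' :: "'a \<Rightarrow> 'a \<Rightarrow>\<^sub>L 'b"
  assumes "convex V" "0 \<le> K"
    and "\<And>b. b \<in> V \<Longrightarrow> (S has_derivative blinfun_apply (S' b)) (at b)"
    and "\<And>b. b \<in> V \<Longrightarrow> norm (S' b) \<le> K"
    and "continuous_on (closure V) S"
  shows "K-lipschitz_on (closure V) S"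
proof (rule lipschitz_on_closure)
  show "K-lipschitz_on V S"
    by (rule bounded_derivative_imp_lipschitz[where f' = "\<lambda>b. blinfun_apply (S' b)"])
      (use assms in \<open>auto intro: has_derivative_at_withinI simp: norm_blinfun.rep_eq[symmetric]\<close>)
qed (fact assms)

text \<open>
  On a convex set the mean value inequality makes \<open>S\<close> differentiable at boundary points, with the
  extended derivative. No such argument is available for \<open>T\<close>, whose domain need not be convex. But the
  extended derivatives of \<open>S\<close> and \<open>T\<close> are inverse to each other by continuity, so an expansion of
  \<open>S\<close> at \<open>T x\<close> can be solved for the increment of \<open>T\<close>.
\<close>

lemma inverse_differentiable_at_boundary:
  fixes S :: "'a::real_normed_vector \<Rightarrow> 'b::real_normed_vector" and T :: "'b \<Rightarrow> 'a"
    and S1 :: "'a \<Rightarrow> 'a \<Rightarrow>\<^sub>L 'b" and T1 :: "'b \<Rightarrow> 'b \<Rightarrow>\<^sub>L 'a"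
  assumes V: "convex V" "open V"
    and S: "\<And>b. b \<in> V \<Longrightarrow> (S has_derivative blinfun_apply (S1 b)) (at b)"
      "continuous_on (closure V) S" "continuous_on (closure V) S1"
    and T: "\<And>y. y \<in> \<Omega> \<Longrightarrow> (T has_derivative blinfun_apply (T1 y)) (at y)"
      "continuous_on (closure \<Omega>) T" "continuous_on (closure \<Omega>) T1"
    and ST: "\<And>y. y \<in> \<Omega> \<Longrightarrow> T y \<in> V" "\<And>y. y \<in> \<Omega> \<Longrightarrow> S (T y) = y"
      "\<And>b. b \<in> V \<Longrightarrow> S b \<in> \<Omega>" "\<And>b. b \<in> V \<Longrightarrow> T (S b) = b"
    and x: "x \<in> closure \<Omega>" "T x \<in> closure V" "S (T x) = x"
  shows "(T has_derivative blinfun_apply (T1 x)) (at x within \<Omega>)"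
proof -
  define b0 where "b0 = T x"
  define A where "A = S1 b0"
  define L where "L = T1 x"
  have b0: "b0 \<in> closure V" "S b0 = x" using x by (auto simp: b0_def)
  have Scl: "S ` closure V \<subseteq> closure \<Omega>"
    by (rule image_closure_subset[OF S(2)]) (use ST(3) closure_subset in auto)
  have LA: "L (A h) = h" for h
  proof -
    have "T1 (S b) (S1 b h) = h" if b: "b \<in> V" for b
    proof -
      have "((\<lambda>b. T (S b)) has_derivative (\<lambda>h. T1 (S b) (S1 b h))) (at b)"
        using has_derivative_compose[OF S(1)[OF b] T(1)[OF ST(3)[OF b]]] .
      moreover have "((\<lambda>b. T (S b)) has_derivative (\<lambda>h. h)) (at b)"
        by (rule has_derivative_transform_within_open[OF has_derivative_ident V(2) b]) (simp add: ST)
      ultimately have "(\<lambda>h. T1 (S b) (S1 b h)) = (\<lambda>h. h)" by (rule has_derivative_unique)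
      then show ?thesis by (rule fun_cong)
    qed
    moreover have "continuous_on (closure V) (\<lambda>b. T1 (S b) (S1 b h))"
      by (intro continuous_intros S continuous_on_compose2[OF T(3) S(2) Scl])
    ultimately have "T1 (S b0) (S1 b0 h) = h"
      using continuous_constant_on_closure[of V "\<lambda>b. T1 (S b) (S1 b h)" h b0] b0 by blast
    then show ?thesis by (simp add: L_def A_def b0)
  qed
  have Sapprox: "\<exists>\<delta>>0. \<forall>b\<in>V. norm (b - b0) < \<delta> \<longrightarrow> norm (S b - x - A (b - b0)) \<le> \<epsilon> * norm (b - b0)"
    if e: "\<epsilon> > 0" for \<epsilon>
  proof -
    obtain \<delta> where d: "\<delta> > 0" "\<And>b. b \<in> closure V \<Longrightarrow> dist b b0 < \<delta> \<Longrightarrow> dist (S1 b) A < \<epsilon>"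
      using S(3) b0(1) e unfolding continuous_on_iff A_def by blast
    define W where "W = ball b0 \<delta> \<inter> V"
    have W: "convex W" "W \<subseteq> V" using V by (auto simp: W_def intro: convex_Int)
    have Wcl: "closure W \<subseteq> closure V" using W(2) by (rule closure_mono)
    have b0W: "b0 \<in> closure W"
      using open_Int_closure_subset[of "ball b0 \<delta>" V] b0 d(1) by (auto simp: W_def)
    have "\<epsilon>-lipschitz_on (closure W) (\<lambda>b. S b - A b)"
    proof (rule lipschitz_on_closure_bounded_derivative[where S' = "\<lambda>b. S1 b - A"])
      fix b assume "b \<in> W"
      then have b: "b \<in> V" "dist b b0 < \<delta>" by (auto simp: W_def dist_commute)
      show "((\<lambda>b. S b - A b) has_derivative blinfun_apply (S1 b - A)) (at b)"
        by (auto intro!: derivative_eq_intros S(1)[OF b(1)] simp: blinfun.diff_left)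
      show "norm (S1 b - A) \<le> \<epsilon>" using d(2)[of b] b closure_subset[of V] by (force simp: dist_norm)
    qed (use W Wcl e in \<open>auto intro!: continuous_intros continuous_on_subset[OF S(2)]\<close>)
    then have lip: "norm ((S b - A b) - (S b0 - A b0)) \<le> \<epsilon> * norm (b - b0)" if "b \<in> W" for b
      using lipschitz_onD[of \<epsilon> "closure W" "\<lambda>b. S b - A b" b b0] b0W that closure_subset[of W]
      by (auto simp: dist_norm)
    show ?thesis
    proof (intro exI[of _ \<delta>] conjI ballI impI d(1))
      fix b assume "b \<in> V" "norm (b - b0) < \<delta>"
      then have "b \<in> W" by (simp add: W_def dist_norm norm_minus_commute)
      from lip[OF this] show "norm (S b - x - A (b - b0)) \<le> \<epsilon> * norm (b - b0)"
        by (simp add: b0(2) blinfun.diff_right algebra_simps)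
    qed
  qed
  show ?thesis
    unfolding has_derivative_within_alt
  proof (intro conjI allI impI)
    show "bounded_linear (T1 x)" by (rule blinfun.bounded_linear_right)
    fix e :: real assume e: "0 < e"
    define M where "M = norm L + 1"
    have M: "M > 0" by (simp add: M_def add_nonneg_pos)
    have LM: "norm (L h) \<le> M * norm h" for h
    proof -
      have "M * norm h = norm L * norm h + norm h" by (simp add: M_def algebra_simps)
      then show ?thesis using norm_blinfun[of L h] norm_ge_zero[of h] by linarith
    qed
    \<comment> \<open>The first bound lets the error be absorbed, giving \<open>\<bar>T y - T x\<bar> \<le> 2 M \<bar>y - x\<bar>\<close>; the second
      then turns the error into \<open>e \<bar>y - x\<bar>\<close>.\<close>
    define \<epsilon> where "\<epsilon> = min (1 / (2 * M)) (e / (2 * M * M))"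
    have \<epsilon>: "\<epsilon> > 0" "M * \<epsilon> \<le> 1 / 2" "M * \<epsilon> * (2 * M) \<le> e"
    proof -
      show "\<epsilon> > 0" using e M by (simp add: \<epsilon>_def)
      have "M * \<epsilon> \<le> M * (1 / (2 * M))" using M by (intro mult_left_mono) (auto simp: \<epsilon>_def)
      then show "M * \<epsilon> \<le> 1 / 2" using M by simp
      have "M * (2 * M) * \<epsilon> \<le> M * (2 * M) * (e / (2 * M * M))"
        using M by (intro mult_left_mono) (auto simp: \<epsilon>_def)
      then show "M * \<epsilon> * (2 * M) \<le> e" using M by (simp add: mult_ac)
    qed
    obtain \<delta> where d: "\<delta> > 0" "\<And>b. b \<in> V \<Longrightarrow> norm (b - b0) < \<delta> \<Longrightarrow>
        norm (S b - x - A (b - b0)) \<le> \<epsilon> * norm (b - b0)"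
      using Sapprox[OF \<epsilon>(1)] by blast
    obtain d' where d': "d' > 0" "\<And>y. y \<in> closure \<Omega> \<Longrightarrow> dist y x < d' \<Longrightarrow> dist (T y) (T x) < \<delta>"
      using T(2) x(1) d(1) unfolding continuous_on_iff by blast
    show "\<exists>d>0. \<forall>y\<in>\<Omega>. norm (y - x) < d \<longrightarrow> norm (T y - T x - T1 x (y - x)) \<le> e * norm (y - x)"
    proof (intro exI[of _ d'] conjI ballI impI d'(1))
      fix y assume y: "y \<in> \<Omega>" "norm (y - x) < d'"
      define k where "k = T y - b0"
      have "norm k < \<delta>" using d'(2)[of y] y closure_subset[of \<Omega>] by (auto simp: dist_norm k_def b0_def)
      then have 1: "norm (y - x - A k) \<le> \<epsilon> * norm k"
        using d(2)[OF ST(1)[OF y(1)]] ST(2)[OF y(1)] by (simp add: k_def)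
      have "L (y - x) - k = L (y - x - A k)" by (simp add: blinfun.diff_right LA)
      then have 2: "norm (L (y - x) - k) \<le> M * \<epsilon> * norm k"
      proof -
        have "M * norm (y - x - A k) \<le> M * (\<epsilon> * norm k)" using 1 M by (intro mult_left_mono) auto
        with LM[of "y - x - A k"] show ?thesis
          unfolding \<open>L (y - x) - k = L (y - x - A k)\<close> by (simp add: mult.assoc)
      qed
      have "norm k \<le> norm (L (y - x)) + norm (L (y - x) - k)"
        using norm_triangle_ineq4[of "L (y - x)" "L (y - x) - k"] by simp
      moreover have "M * \<epsilon> * norm k \<le> 1 / 2 * norm k" using \<epsilon>(2) by (intro mult_right_mono) auto
      ultimately have "norm k \<le> 2 * M * norm (y - x)" using 2 LM[of "y - x"] by linarith
      then have "M * \<epsilon> * norm k \<le> M * \<epsilon> * (2 * M * norm (y - x))"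
        using M \<epsilon>(1) by (intro mult_left_mono) auto
      also have "\<dots> \<le> e * norm (y - x)"
        using mult_right_mono[OF \<epsilon>(3), of "norm (y - x)"] by (simp add: mult_ac)
      finally show "norm (T y - T x - T1 x (y - x)) \<le> e * norm (y - x)"
        using 2 by (simp add: k_def b0_def L_def norm_minus_commute)
    qed
  qed
qed

text \<open>
  Only values of \<open>g\<close> on the closure of \<open>\<Omega>\<close> are known, so membership in \<open>\<Omega>\<close> cannot be read off from the
  sign of \<open>g\<close>. Points of \<open>\<Omega>\<close> and of its frontier near \<open>x\<close> avoid, respectively, the cone around \<open>d\<close> and
  the cone around \<open>- d\<close>. The latter is convex, hence connected, and does not meet the frontier, so it
  lies in \<open>\<Omega>\<close> as soon as it contains one point of it. The assumption on \<open>c\<close> provides such a point: a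
  non-tangential approach to \<open>x\<close> from inside.
\<close>

lemma outer_normal_of_one_sided_defining_function:
  fixes g :: "'a::real_inner \<Rightarrow> real"
  assumes "open \<Omega>" and x: "x \<in> frontier \<Omega>"
    and g: "continuous_on (closure \<Omega>) g" "\<And>y. y \<in> \<Omega> \<Longrightarrow> g y < 0" "\<And>y. y \<in> frontier \<Omega> \<Longrightarrow> g y = 0"
    and d: "(g has_derivative (\<lambda>h. d \<bullet> h)) (at x within \<Omega>)"
    and c: "c > 0" "\<And>\<delta>. \<delta> > 0 \<Longrightarrow> \<exists>y\<in>\<Omega>. norm (y - x) < \<delta> \<and> g y \<le> - c * norm (y - x)"
  shows "d \<noteq> 0" "is_outer_normal \<Omega> x (d /\<^sub>R norm d)"
proof -
  have gx: "g x = 0" and x\<Omega>: "x \<notin> \<Omega>" using g(2,3) x by fastforce+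
  have approx: "\<exists>\<delta>>0. \<forall>y\<in>closure \<Omega>. norm (y - x) < \<delta> \<longrightarrow> \<bar>g y - d \<bullet> (y - x)\<bar> \<le> \<eta> * norm (y - x)"
    if "\<eta> > 0" for \<eta>
  proof -
    obtain \<delta> where \<delta>: "\<delta> > 0" "\<And>y. y \<in> \<Omega> \<Longrightarrow> norm (y - x) < \<delta> \<Longrightarrow>
        norm (g y - g x - d \<bullet> (y - x)) \<le> \<eta> * norm (y - x)"
    proof -
      have "\<exists>\<delta>>0. \<forall>y\<in>\<Omega>. norm (y - x) < \<delta> \<longrightarrow>
          norm (g y - g x - d \<bullet> (y - x)) \<le> \<eta> * norm (y - x)"
        using d[unfolded has_derivative_within_alt, THEN conjunct2, rule_format, OF \<open>\<eta> > 0\<close>] .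
      then show thesis using that by blast
    qed
    have "\<bar>g y - d \<bullet> (y - x)\<bar> \<le> \<eta> * norm (y - x)" if y: "y \<in> closure \<Omega>" "norm (y - x) < \<delta>" for y
    proof -
      define W where "W = ball x \<delta> \<inter> \<Omega>"
      have "y \<in> closure W" using open_Int_closure_subset[of "ball x \<delta>" \<Omega>] y
        by (auto simp: W_def dist_norm norm_minus_commute)
      moreover have "closure W \<subseteq> closure \<Omega>" by (intro closure_mono) (auto simp: W_def)
      then have "continuous_on (closure W) (\<lambda>y. \<eta> * norm (y - x) - \<bar>g y - d \<bullet> (y - x)\<bar>)"
        by (intro continuous_intros continuous_on_subset[OF g(1)])
      moreover have "0 \<le> \<eta> * norm (y - x) - \<bar>g y - d \<bullet> (y - x)\<bar>" if "y \<in> W" for y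
        using \<delta>(2)[of y] that gx by (auto simp: W_def dist_norm norm_minus_commute)
      ultimately have "0 \<le> \<eta> * norm (y - x) - \<bar>g y - d \<bullet> (y - x)\<bar>"
        using continuous_ge_on_closure[of W "\<lambda>y. \<eta> * norm (y - x) - \<bar>g y - d \<bullet> (y - x)\<bar>" y 0] by metis
      then show ?thesis by simp
    qed
    then show ?thesis using \<delta>(1) by blast
  qed
  show d0: "d \<noteq> 0"
  proof
    assume "d = 0"
    obtain \<delta> where "\<delta> > 0" "\<forall>y\<in>closure \<Omega>. norm (y - x) < \<delta> \<longrightarrow> \<bar>g y - d \<bullet> (y - x)\<bar> \<le> c / 2 * norm (y - x)"
      using approx[of "c / 2"] c by auto
    moreover then obtain y where y: "y \<in> \<Omega>" "norm (y - x) < \<delta>" "g y \<le> - c * norm (y - x)" using c(2) by blast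
    ultimately have "\<bar>g y\<bar> \<le> c / 2 * norm (y - x)" using \<open>d = 0\<close> closure_subset by fastforce
    moreover have "norm (y - x) > 0" using y x\<Omega> by auto
    then have "c * norm (y - x) > 0" using c by simp
    ultimately show False using y(3) by (simp add: abs_if split: if_splits)
  qed
  show "is_outer_normal \<Omega> x (d /\<^sub>R norm d)"
    unfolding is_outer_normal_def
  proof (intro conjI allI impI)
    show "norm (d /\<^sub>R norm d) = 1" using d0 by simp
    fix \<epsilon> :: real assume \<epsilon>: "\<epsilon> > 0"
    define \<eta> where "\<eta> = min (\<epsilon> * norm d) c / 3"
    have \<eta>: "\<eta> > 0" "\<eta> \<le> \<epsilon> * norm d" "2 * \<eta> < c" using \<epsilon> d0 c by (auto simp: \<eta>_def min_def not_le)
    obtain \<delta> where \<delta>: "\<delta> > 0"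
      "\<And>y. y \<in> closure \<Omega> \<Longrightarrow> norm (y - x) < \<delta> \<Longrightarrow> \<bar>g y - d \<bullet> (y - x)\<bar> \<le> \<eta> * norm (y - x)"
      using approx[OF \<eta>(1)] by blast
    \<comment> \<open>The truncated cone of directions into the domain.\<close>
    define N where "N = {y. norm (y - x) < \<delta> \<and> d \<bullet> (y - x) + \<eta> * norm (y - x) < 0}"
    have "convex N"
    proof (rule convexI)
      fix a b and u v :: real assume ab: "a \<in> N" "b \<in> N" and uv: "0 \<le> u" "0 \<le> v" "u + v = 1"
      have eq: "u *\<^sub>R a + v *\<^sub>R b - x = u *\<^sub>R (a - x) + v *\<^sub>R (b - x)"
        using uv(3) by (simp add: algebra_simps flip: scaleR_add_left)
      have n: "norm (u *\<^sub>R a + v *\<^sub>R b - x) \<le> u * norm (a - x) + v * norm (b - x)"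
        unfolding eq using uv by (intro norm_triangle_le) simp
      have lt: "u * s + v * t < r" if "s < r" "t < r" for s t r :: real
      proof (cases "u = 0")
        case True then show ?thesis using that uv by simp
      next
        case False
        then have "u * s < u * r" "v * t \<le> v * r" using that uv by (auto intro: mult_left_mono)
        moreover have "u * r + v * r = r" using uv(3) by (simp flip: distrib_right)
        ultimately show ?thesis by linarith
      qed
      have "u * (d \<bullet> (a - x) + \<eta> * norm (a - x)) + v * (d \<bullet> (b - x) + \<eta> * norm (b - x)) < 0"
        by (rule lt) (use ab in \<open>auto simp: N_def\<close>)
      moreover have "\<eta> * norm (u *\<^sub>R a + v *\<^sub>R b - x) \<le> \<eta> * (u * norm (a - x) + v * norm (b - x))"
        using n \<eta>(1) by (intro mult_left_mono) auto
      moreover have "d \<bullet> (u *\<^sub>R a + v *\<^sub>R b - x) = u * (d \<bullet> (a - x)) + v * (d \<bullet> (b - x))"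
        unfolding eq by (simp add: inner_add_right)
      ultimately have "d \<bullet> (u *\<^sub>R a + v *\<^sub>R b - x) + \<eta> * norm (u *\<^sub>R a + v *\<^sub>R b - x) < 0"
        by (simp add: algebra_simps)
      moreover have "norm (u *\<^sub>R a + v *\<^sub>R b - x) < \<delta>"
        using n lt[of "norm (a - x)" \<delta> "norm (b - x)"] ab by (auto simp: N_def)
      ultimately show "u *\<^sub>R a + v *\<^sub>R b \<in> N" by (simp add: N_def)
    qed
    moreover have "N \<inter> \<Omega> \<noteq> {}"
    proof -
      obtain y where y: "y \<in> \<Omega>" "norm (y - x) < \<delta>" "g y \<le> - c * norm (y - x)" using c(2)[OF \<delta>(1)] by blast
      have "norm (y - x) > 0" using y x\<Omega> by auto
      then have "2 * \<eta> * norm (y - x) < c * norm (y - x)" using \<eta>(3) by simp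
      moreover have "\<bar>g y - d \<bullet> (y - x)\<bar> \<le> \<eta> * norm (y - x)" using \<delta>(2) y closure_subset by blast
      ultimately have "d \<bullet> (y - x) + \<eta> * norm (y - x) < 0" using y(3) by linarith
      then show ?thesis using y by (auto simp: N_def)
    qed
    moreover have "N \<inter> frontier \<Omega> = {}"
    proof -
      have False if "y \<in> N" "y \<in> frontier \<Omega>" for y
      proof -
        have "\<bar>g y - d \<bullet> (y - x)\<bar> \<le> \<eta> * norm (y - x)"
          using \<delta>(2) that by (auto simp: N_def frontier_def)
        then show False using that g(3)[OF that(2)] by (auto simp: N_def)
      qed
      then show ?thesis by blast
    qed
    ultimately have N: "N \<subseteq> \<Omega>" using connected_Int_frontier[of N \<Omega>] convex_connected by blast
    have scale: "(y - x) \<bullet> (d /\<^sub>R norm d) = (d \<bullet> (y - x)) / norm d" for y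
      by (simp add: inner_commute divide_inverse)
    have \<eta>n: "\<eta> * norm (y - x) \<le> \<epsilon> * norm (y - x) * norm d" for y
      using mult_right_mono[OF \<eta>(2), of "norm (y - x)"] by (simp add: mult_ac)
    show "\<exists>\<delta>>0. \<forall>y. dist y x < \<delta> \<longrightarrow>
      ((y - x) \<bullet> (d /\<^sub>R norm d) < - \<epsilon> * norm (y - x) \<longrightarrow> y \<in> \<Omega>) \<and>
      ((y - x) \<bullet> (d /\<^sub>R norm d) > \<epsilon> * norm (y - x) \<longrightarrow> y \<notin> \<Omega>)"
    proof (intro exI[of _ \<delta>] conjI allI impI \<delta>(1))
      fix y assume y: "dist y x < \<delta>" "(y - x) \<bullet> (d /\<^sub>R norm d) < - \<epsilon> * norm (y - x)"
      then have "d \<bullet> (y - x) < - \<epsilon> * norm (y - x) * norm d"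
        using d0 by (simp only: scale) (simp add: divide_less_eq)
      then have "d \<bullet> (y - x) + \<eta> * norm (y - x) < 0" using \<eta>n[of y] by simp
      then show "y \<in> \<Omega>" using N y by (auto simp: N_def dist_norm)
    next
      fix y assume y: "dist y x < \<delta>" "(y - x) \<bullet> (d /\<^sub>R norm d) > \<epsilon> * norm (y - x)"
      then have "d \<bullet> (y - x) > \<epsilon> * norm (y - x) * norm d"
        using d0 by (simp only: scale) (simp add: less_divide_eq)
      then have *: "d \<bullet> (y - x) > \<eta> * norm (y - x)" using \<eta>n[of y] by simp
      show "y \<notin> \<Omega>"
      proof
        assume "y \<in> \<Omega>"
        then have "\<bar>g y - d \<bullet> (y - x)\<bar> \<le> \<eta> * norm (y - x)"
          using \<delta>(2)[of y] y(1) closure_subset by (auto simp: dist_norm)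
        then show False using * g(2)[OF \<open>y \<in> \<Omega>\<close>] by linarith
      qed
    qed
  qed
qed

section \<open>Geometry of the nozzle\<close>

lemma closure_cylinder: "closure cylinder = cball (0::real^'m) 1 \<times> (UNIV::real set)"
  by (simp add: cylinder_def closure_Times)

lemma convex_cylinder: "convex cylinder" and open_cylinder: "open cylinder"
  by (auto simp: cylinder_def intro: convex_Times open_Times)

lemma frontier_cylinder: "frontier cylinder = sphere (0::real^'m) 1 \<times> (UNIV::real set)"
proof -
  have "frontier cylinder = cball (0::real^'m) 1 \<times> (UNIV::real set) - cylinder"
    by (simp only: frontier_def interior_open[OF open_cylinder] closure_cylinder)
  moreover have "y \<in> cball (0::real^'m) 1 \<times> (UNIV::real set) - cylinder \<longleftrightarrow> norm (fst y) = 1" for y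
    unfolding cylinder_def mem_Times_iff Diff_iff by (simp, linarith)
  ultimately show ?thesis by (intro set_eqI) (simp add: mem_Times_iff)
qed

lemma nozzle_parametrization:
  fixes \<Omega> :: "((real^'m) \<times> real) set"
  assumes "nozzle \<alpha> \<Omega>"
  obtains K :: real and T S :: "(real^'m) \<times> real \<Rightarrow> (real^'m) \<times> real"
  where "open \<Omega>" "0 \<le> K"
    "\<And>y. y \<in> \<Omega> \<Longrightarrow> T y \<in> cylinder" "\<And>y. y \<in> \<Omega> \<Longrightarrow> S (T y) = y" "\<And>y. y \<in> \<Omega> \<Longrightarrow> snd (T y) = snd y"
    "\<And>b. b \<in> cylinder \<Longrightarrow> S b \<in> \<Omega>" "\<And>b. b \<in> cylinder \<Longrightarrow> T (S b) = b"
    "\<And>y. y \<in> frontier \<Omega> \<Longrightarrow> T y \<in> frontier cylinder" "\<And>y. y \<in> frontier \<Omega> \<Longrightarrow> S (T y) = y"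
    "C2_holder_on_closure \<alpha> K \<Omega> T" "C2_holder_on_closure \<alpha> K cylinder S"
proof -
  obtain T :: "(real^'m) \<times> real \<Rightarrow> (real^'m) \<times> real" and K where
    op: "open \<Omega>" and bij: "bij_betw T (closure \<Omega>) (closure cylinder)"
    and fr: "T ` frontier \<Omega> = frontier cylinder"
    and sl: "\<And>k. T ` (\<Omega> \<inter> {x. snd x = k}) = ball 0 1 \<times> {k}"
    and C2: "C2_holder_on_closure \<alpha> K \<Omega> T" "C2_holder_on_closure \<alpha> K cylinder (inv_into (closure \<Omega>) T)"
    using assms unfolding nozzle_def by blast
  define S where "S = inv_into (closure \<Omega>) T"
  have ST: "S (T y) = y" if "y \<in> closure \<Omega>" for y
    unfolding S_def using bij that by (simp add: bij_betw_inv_into_left)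
  have T: "T y \<in> cylinder \<and> snd (T y) = snd y" if "y \<in> \<Omega>" for y
  proof -
    have "T y \<in> T ` (\<Omega> \<inter> {x. snd x = snd y})" using that by auto
    then show ?thesis unfolding sl by (auto simp: cylinder_def)
  qed
  have S: "S b \<in> \<Omega> \<and> T (S b) = b" if "b \<in> cylinder" for b
  proof -
    have "b \<in> T ` (\<Omega> \<inter> {x. snd x = snd b})" unfolding sl using that by (auto simp: cylinder_def)
    then obtain y where "y \<in> \<Omega>" "T y = b" by auto
    moreover then have "S b = y" using ST[of y] closure_subset[of \<Omega>] by blast
    ultimately show ?thesis by simp
  qed
  have "0 \<in> closure (cylinder :: ((real^'m) \<times> real) set)" by (simp add: closure_cylinder zero_prod_def)
  then have "0 \<le> K" using C2(2) unfolding C2_holder_on_closure_def by (meson norm_ge_zero order_trans)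
  show thesis
  proof (rule that[of K T S])
    show "S (T y) = y" if "y \<in> \<Omega>" for y using ST[of y] that closure_subset[of \<Omega>] by blast
    show "S (T y) = y" if "y \<in> frontier \<Omega>" for y using ST[of y] that by (simp add: frontier_def)
  qed (use op \<open>0 \<le> K\<close> T S fr C2 in \<open>auto simp: S_def[symmetric]\<close>)
qed

text \<open>
  The defining function is \<open>g y = \<bar>T' y\<bar>\<^sup>2 - 1\<close> with \<open>T'\<close> the first component of the straightening
  map, and \<open>D\<close> is its gradient. Bounds on the first two derivatives of \<open>T\<close> bound the divergence of \<open>D\<close>.
  The map \<open>S\<close> is the inverse of \<open>T\<close>.
\<close>

lemma nozzle_geometry:
  fixes \<Omega> :: "((real^'m) \<times> real) set"
  assumes "nozzle \<alpha> \<Omega>"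
  obtains K :: real and S :: "(real^'m) \<times> real \<Rightarrow> (real^'m) \<times> real" and S' g D D' and A :: real
  where "open \<Omega>" "0 \<le> K"
    "\<And>b. b \<in> cylinder \<Longrightarrow> S b \<in> \<Omega> \<and> snd (S b) = snd b" "\<And>y. y \<in> \<Omega> \<Longrightarrow> \<exists>b\<in>cylinder. S b = y"
    "\<And>b. b \<in> cylinder \<Longrightarrow> (S has_derivative blinfun_apply (S' b)) (at b)"
    "\<And>b. b \<in> cylinder \<Longrightarrow> norm (S' b) \<le> K"
    "continuous_on (closure \<Omega>) g" "\<And>y. y \<in> \<Omega> \<Longrightarrow> g y < 0" "\<And>y. y \<in> frontier \<Omega> \<Longrightarrow> g y = 0"
    "\<And>y. y \<in> \<Omega> \<Longrightarrow> (g has_derivative (\<lambda>h. D y \<bullet> h)) (at y)"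
    "continuous_on (closure \<Omega>) D" "\<And>y. y \<in> frontier \<Omega> \<Longrightarrow> D y \<noteq> 0"
    "\<And>y. y \<in> \<Omega> \<Longrightarrow> (D has_derivative D' y) (at y)" "\<And>h. continuous_on \<Omega> (\<lambda>y. D' y h)"
    "\<And>y. y \<in> \<Omega> \<Longrightarrow> \<bar>\<Sum>b\<in>Basis. D' y b \<bullet> b\<bar> \<le> A"
    "\<And>y. y \<in> frontier \<Omega> \<Longrightarrow> is_outer_normal \<Omega> y (D y /\<^sub>R norm (D y))"
proof -
  obtain K :: real and T S :: "(real^'m) \<times> real \<Rightarrow> (real^'m) \<times> real" where op: "open \<Omega>" and K: "0 \<le> K"
    and T: "\<And>y. y \<in> \<Omega> \<Longrightarrow> T y \<in> cylinder" "\<And>y. y \<in> \<Omega> \<Longrightarrow> S (T y) = y" "\<And>y. y \<in> \<Omega> \<Longrightarrow> snd (T y) = snd y"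
    and S: "\<And>b. b \<in> cylinder \<Longrightarrow> S b \<in> \<Omega>" "\<And>b. b \<in> cylinder \<Longrightarrow> T (S b) = b"
    and fr: "\<And>y. y \<in> frontier \<Omega> \<Longrightarrow> T y \<in> frontier cylinder" "\<And>y. y \<in> frontier \<Omega> \<Longrightarrow> S (T y) = y"
    and C2T: "C2_holder_on_closure \<alpha> K \<Omega> T" and C2S: "C2_holder_on_closure \<alpha> K cylinder S"
    using that by (rule nozzle_parametrization[OF assms])
  obtain T1 T2 where T1: "\<And>y. y \<in> \<Omega> \<Longrightarrow> (T has_derivative blinfun_apply (T1 y)) (at y)"
      "\<And>y. y \<in> \<Omega> \<Longrightarrow> (T1 has_derivative blinfun_apply (T2 y)) (at y)"
      "continuous_on (closure \<Omega>) T" "continuous_on (closure \<Omega>) T1" "continuous_on (closure \<Omega>) T2"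
      "\<And>y. y \<in> closure \<Omega> \<Longrightarrow> norm (T1 y) \<le> K" "\<And>y. y \<in> closure \<Omega> \<Longrightarrow> norm (T2 y) \<le> K"
    using C2T unfolding C2_holder_on_closure_def by blast
  obtain S1 where S1: "\<And>b. b \<in> cylinder \<Longrightarrow> (S has_derivative blinfun_apply (S1 b)) (at b)"
      "continuous_on (closure cylinder) S" "continuous_on (closure cylinder) S1"
      "\<And>b. b \<in> closure cylinder \<Longrightarrow> norm (S1 b) \<le> K"
    using C2S unfolding C2_holder_on_closure_def by blast
  have sub: "\<Omega> \<subseteq> closure \<Omega>" by (rule closure_subset)

  define g where "g y = fst (T y) \<bullet> fst (T y) - 1" for y
  define D where "D y = (\<Sum>b\<in>Basis. (2 * (fst (T y) \<bullet> fst (T1 y b))) *\<^sub>R b)" for y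
  define D' where "D' y h = (\<Sum>b\<in>Basis. (2 * (fst (T1 y h) \<bullet> fst (T1 y b) + fst (T y) \<bullet> fst (T2 y h b))) *\<^sub>R b)"
    for y h
  have Dinner: "D y \<bullet> h = 2 * (fst (T y) \<bullet> fst (T1 y h))" for y h
    unfolding D_def
    by (rule linear_functional_inner, rule linearI)
      (simp_all add: blinfun.add_right blinfun.scaleR_right inner_add_right algebra_simps)
  have gder: "(g has_derivative (\<lambda>h. D y \<bullet> h)) (at y within X)"
    if "(T has_derivative blinfun_apply (T1 y)) (at y within X)" for y X
    unfolding g_def[abs_def] Dinner
    by (auto intro!: derivative_eq_intros that simp: inner_commute)
  have neg: "g y < 0" if "y \<in> \<Omega>" for y
  proof -
    have "norm (fst (T y)) < 1" using T(1)[OF that] by (auto simp: cylinder_def)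
    then show ?thesis by (simp add: g_def dot_square_norm abs_square_less_1)
  qed
  have zero: "norm (fst (T y)) = 1" "g y = 0" if "y \<in> frontier \<Omega>" for y
  proof -
    show "norm (fst (T y)) = 1" using fr(1)[OF that] by (auto simp: frontier_cylinder)
    then show "g y = 0" by (simp add: g_def dot_square_norm)
  qed
  have gc: "continuous_on (closure \<Omega>) g" unfolding g_def[abs_def] by (intro continuous_intros T1)
  have Dc: "continuous_on (closure \<Omega>) D" unfolding D_def[abs_def] by (intro continuous_intros T1)
  have Dd: "(D has_derivative D' y) (at y)" if "y \<in> \<Omega>" for y
    unfolding D_def[abs_def] D'_def
    by (auto intro!: derivative_eq_intros T1(1)[OF that] T1(2)[OF that] sum.cong simp: algebra_simps)
  have D'c: "continuous_on \<Omega> (\<lambda>y. D' y h)" for h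
  proof -
    have "continuous_on \<Omega> T" "continuous_on \<Omega> T1" "continuous_on \<Omega> T2"
      using T1(3-5) sub continuous_on_subset by blast+
    then show ?thesis unfolding D'_def by (intro continuous_intros)
  qed
  define A where "A = real (card (Basis :: ((real^'m) \<times> real) set)) * (2 * (K * K + K))"
  have D'b: "\<bar>\<Sum>b\<in>Basis. D' y b \<bullet> b\<bar> \<le> A" if y: "y \<in> \<Omega>" for y
  proof -
    have "\<bar>D' y b \<bullet> b\<bar> \<le> 2 * (K * K + K)" if b: "b \<in> Basis" for b
    proof -
      have eq: "D' y b \<bullet> b = 2 * (fst (T1 y b) \<bullet> fst (T1 y b) + fst (T y) \<bullet> fst (T2 y b b))"
        using b by (simp add: D'_def inner_sum_left inner_Basis if_distrib if_distribR sum.delta cong: if_cong)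
      have y': "y \<in> closure \<Omega>" using y sub by auto
      have nb: "norm b = 1" using b by simp
      have n1: "norm (fst (T1 y b)) \<le> K"
        using norm_blinfun[of "T1 y" b] T1(6)[OF y'] nb
          norm_fst_le[of "fst (T1 y b)" "snd (T1 y b)"] by simp
      have "norm (T2 y b b) \<le> norm (T2 y b) * 1" using norm_blinfun[of "T2 y b" b] nb by simp
      also have "\<dots> \<le> norm (T2 y)" using norm_blinfun[of "T2 y" b] nb by simp
      finally have n2: "norm (fst (T2 y b b)) \<le> K"
        using T1(7)[OF y'] norm_fst_le[of "fst (T2 y b b)" "snd (T2 y b b)"] by simp
      have "norm (fst (T y)) \<le> 1" using T(1)[OF y] by (auto simp: cylinder_def)
      then have "\<bar>fst (T y) \<bullet> fst (T2 y b b)\<bar> \<le> 1 * K"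
        by (intro order_trans[OF Cauchy_Schwarz_ineq2] mult_mono n2) auto
      moreover have "\<bar>fst (T1 y b) \<bullet> fst (T1 y b)\<bar> \<le> K * K"
        by (intro order_trans[OF Cauchy_Schwarz_ineq2] mult_mono n1 K) auto
      ultimately have "\<bar>fst (T1 y b) \<bullet> fst (T1 y b) + fst (T y) \<bullet> fst (T2 y b b)\<bar> \<le> K * K + K"
        by linarith
      then show ?thesis unfolding eq abs_mult by simp
    qed
    then show ?thesis unfolding A_def by (intro order_trans[OF sum_abs] sum_bounded_above) auto
  qed
  have normal: "D x \<noteq> 0" "is_outer_normal \<Omega> x (D x /\<^sub>R norm (D x))" if x: "x \<in> frontier \<Omega>" for x
  proof -
    have xc: "x \<in> closure \<Omega>" using x by (simp add: frontier_def)
    have Tx: "T x \<in> closure cylinder" using fr(1)[OF x] by (simp add: frontier_def)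
    have gd: "(g has_derivative (\<lambda>h. D x \<bullet> h)) (at x within \<Omega>)"
      by (rule gder, rule inverse_differentiable_at_boundary[OF convex_cylinder open_cylinder S1(1-3) T1(1,3,4)])
        (use T S xc Tx fr(2)[OF x] in auto)
    have lip: "K-lipschitz_on (closure cylinder) S"
      by (rule lipschitz_on_closure_bounded_derivative[OF convex_cylinder K S1(1) _ S1(2)])
        (use S1(4) closure_subset in auto)
    define c where "c = 1 / (K + 1)"
    have c: "c > 0" using K by (simp add: c_def add_nonneg_pos)
    have "\<exists>y\<in>\<Omega>. norm (y - x) < \<delta> \<and> g y \<le> - c * norm (y - x)" if d: "\<delta> > 0" for \<delta>
    proof -
      \<comment> \<open>The radial approach in the cylinder is mapped to a non-tangential one in the nozzle: \<open>g\<close> drops by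
        at least \<open>s\<close> over a distance of at most \<open>K s\<close>.\<close>
      define s where "s = min (1 / 2) (\<delta> / (2 * (K + 1)))"
      have s: "0 < s" "s < 1" "(K + 1) * s < \<delta>"
      proof -
        show "0 < s" "s < 1" using d K by (auto simp: s_def)
        have "(K + 1) * s \<le> (K + 1) * (\<delta> / (2 * (K + 1)))"
          using K by (intro mult_left_mono) (auto simp: s_def)
        also have "\<dots> = \<delta> / 2" using K by (simp add: field_simps)
        finally show "(K + 1) * s < \<delta>" using d by simp
      qed
      define b where "b = ((1 - s) *\<^sub>R fst (T x), snd (T x))"
      have nx: "norm (fst (T x)) = 1" by (rule zero(1)[OF x])
      have b: "b \<in> cylinder" using s nx by (simp add: b_def cylinder_def)
      have "b - T x = (- s *\<^sub>R fst (T x), 0)" by (simp add: b_def prod_eq_iff algebra_simps)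
      then have nb: "norm (b - T x) = s" using s nx by (simp add: norm_Pair)
      have "dist (S b) (S (T x)) \<le> K * dist b (T x)"
        using lipschitz_onD[OF lip] b Tx closure_subset by blast
      then have "norm (S b - x) \<le> K * s" using fr(2)[OF x] nb by (simp add: dist_norm)
      then have n: "norm (S b - x) \<le> (K + 1) * s" using s by (simp add: algebra_simps)
      have "fst (T (S b)) = (1 - s) *\<^sub>R fst (T x)" by (simp only: S(2)[OF b]) (simp add: b_def)
      moreover have "fst (T x) \<bullet> fst (T x) = 1" using nx by (simp add: dot_square_norm)
      ultimately have "g (S b) = (1 - s)\<^sup>2 - 1" by (simp add: g_def power2_eq_square)
      also have "\<dots> \<le> - s"
      proof -
        have "s * s \<le> 1 * s" using s by (intro mult_right_mono) auto
        then show ?thesis by (simp add: power2_eq_square algebra_simps)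
      qed
      also have "\<dots> \<le> - c * norm (S b - x)"
        using n K by (simp add: c_def field_simps)
      finally show ?thesis using S(1)[OF b] n s(3) by (intro bexI[of _ "S b"]) auto
    qed
    from outer_normal_of_one_sided_defining_function[OF op x gc neg zero(2) gd c this]
    show "D x \<noteq> 0" "is_outer_normal \<Omega> x (D x /\<^sub>R norm (D x))" by auto
  qed
  show thesis
  proof (rule that[OF op K _ _ S1(1) _ gc neg zero(2) gder[OF T1(1)] Dc normal(1) Dd D'c D'b normal(2)])
    show "S b \<in> \<Omega> \<and> snd (S b) = snd b" if "b \<in> cylinder" for b
      using S[OF that] T(3)[of "S b"] by auto
    show "\<exists>b\<in>cylinder. S b = y" if "y \<in> \<Omega>" for y using T[OF that] by blast
    show "norm (S1 b) \<le> K" if "b \<in> cylinder" for b using S1(4) that closure_subset by blast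
  qed
qed

section \<open>Uniformly subsonic flows\<close>

text \<open>
  Here \<open>v\<close> is the velocity, extended continuously to the wall, and \<open>\<theta>\<close> is a bound for the speed.
\<close>

lemma neumann_solution_flux:
  fixes \<phi> :: "'a::euclidean_space \<Rightarrow> real"
  assumes op: "open \<Omega>" and \<rho>: "elliptic_density \<rho> \<rho>'"
    and sol: "neumann_solution \<rho> \<Omega> \<phi>" and subsonic: "uniformly_subsonic \<Omega> \<phi>"
  obtains \<theta> :: real and v :: "'a \<Rightarrow> 'a" and F' :: "'a \<Rightarrow> 'a \<Rightarrow> 'a"
  where "0 \<le> \<theta>" "\<theta> < 1"
    "continuous_on (closure \<Omega>) v" "\<And>x. x \<in> closure \<Omega> \<Longrightarrow> norm (v x) \<le> \<theta>"
    "\<And>x. x \<in> \<Omega> \<Longrightarrow> v x = grad \<phi> x"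
    "\<And>x. x \<in> \<Omega> \<Longrightarrow> (\<phi> has_derivative (\<lambda>h. v x \<bullet> h)) (at x)"
    "continuous_on (closure \<Omega>) \<phi>"
    "continuous_on (closure \<Omega>) (\<lambda>x. \<rho> ((norm (v x))\<^sup>2) *\<^sub>R v x)"
    "\<And>x. x \<in> \<Omega> \<Longrightarrow> ((\<lambda>x. \<rho> ((norm (v x))\<^sup>2) *\<^sub>R v x) has_derivative F' x) (at x)"
    "\<And>h. continuous_on \<Omega> (\<lambda>x. F' x h)"
    "\<And>x. x \<in> \<Omega> \<Longrightarrow> (\<Sum>b\<in>Basis. F' x b \<bullet> b) = 0"
    "\<And>x \<nu>. x \<in> frontier \<Omega> \<Longrightarrow> is_outer_normal \<Omega> x \<nu> \<Longrightarrow> v x \<bullet> \<nu> = 0"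
proof -
  obtain F1 :: "'a \<Rightarrow> 'a \<Rightarrow>\<^sub>L real" and F2 :: "'a \<Rightarrow> 'a \<Rightarrow>\<^sub>L 'a \<Rightarrow>\<^sub>L real"
    where F1: "\<And>x. x \<in> \<Omega> \<Longrightarrow> (\<phi> has_derivative blinfun_apply (F1 x)) (at x)"
      and F2: "\<And>x. x \<in> \<Omega> \<Longrightarrow> (F1 has_derivative blinfun_apply (F2 x)) (at x)"
      and F2c: "continuous_on \<Omega> F2"
    using sol unfolding neumann_solution_def C2_on_def by blast
  obtain v where v: "continuous_on (closure \<Omega>) v" "\<And>x. x \<in> \<Omega> \<Longrightarrow> v x = grad \<phi> x"
      and normal: "\<And>x \<nu>. x \<in> frontier \<Omega> \<Longrightarrow> is_outer_normal \<Omega> x \<nu> \<Longrightarrow> v x \<bullet> \<nu> = 0"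
    using sol unfolding neumann_solution_def by blast
  have sub: "\<Omega> \<subseteq> closure \<Omega>" by (rule closure_subset)
  have vF1: "v x = (\<Sum>b\<in>Basis. F1 x b *\<^sub>R b)" if "x \<in> \<Omega>" for x
    using v(2)[OF that] frechet_derivative_at[OF F1[OF that]] by (simp add: grad_def)
  have \<phi>d: "(\<phi> has_derivative (\<lambda>h. v x \<bullet> h)) (at x)" if "x \<in> \<Omega>" for x
  proof -
    have "v x \<bullet> h = F1 x h" for h
      unfolding vF1[OF that] by (rule linear_functional_inner) (rule bounded_linear.linear[OF blinfun.bounded_linear_right])
    then show ?thesis using F1[OF that] by simp
  qed
  define v' where "v' x h = (\<Sum>b\<in>Basis. F2 x h b *\<^sub>R b)" for x h
  have vd: "(v has_derivative v' x) (at x)" if "x \<in> \<Omega>" for x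
  proof (rule has_derivative_transform_within_open[OF _ op that])
    show "((\<lambda>x. \<Sum>b\<in>Basis. F1 x b *\<^sub>R b) has_derivative v' x) (at x)"
      unfolding v'_def by (auto intro!: derivative_eq_intros F2[OF that])
  qed (simp add: vF1)
  have v'c: "continuous_on \<Omega> (\<lambda>x. v' x h)" for h
    unfolding v'_def by (intro continuous_intros F2c)

  obtain \<theta> where \<theta>: "0 \<le> \<theta>" "\<theta> < 1" "\<And>x. x \<in> \<Omega> \<Longrightarrow> norm (v x) \<le> \<theta>"
  proof -
    obtain t where t: "(SUP x\<in>\<Omega>. ereal (norm (grad \<phi> x))) < ereal t" "ereal t < 1"
      using ereal_dense2[OF subsonic[unfolded uniformly_subsonic_def]] by auto
    have "norm (v x) \<le> max 0 t" if "x \<in> \<Omega>" for x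
    proof -
      have "ereal (norm (grad \<phi> x)) \<le> (SUP x\<in>\<Omega>. ereal (norm (grad \<phi> x)))" using that by (rule SUP_upper)
      then have "ereal (norm (grad \<phi> x)) < ereal t" using t(1) by (rule le_less_trans)
      then show ?thesis using v(2)[OF that] by simp
    qed
    then show thesis using t(2) by (intro that[of "max 0 t"]) auto
  qed
  have \<theta>c: "norm (v x) \<le> \<theta>" if "x \<in> closure \<Omega>" for x
    by (rule continuous_le_on_closure[OF _ that, of "\<lambda>x. norm (v x)"]) (use \<theta>(3) v(1) in \<open>auto intro: continuous_intros\<close>)
  have unit: "(norm (v x))\<^sup>2 \<in> {0..<1}" if "x \<in> closure \<Omega>" for x
  proof -
    have "norm (v x) < 1" using \<theta>c[OF that] \<theta>(2) by simp
    then show ?thesis by (simp add: abs_square_less_1)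
  qed
  have \<rho>d: "(\<rho> has_real_derivative \<rho>' s) (at s)" if "s \<in> {0..<1}" for s
    using \<rho> that unfolding elliptic_density_def by blast
  have \<rho>c: "continuous_on {0..<1} \<rho>"
    by (intro continuous_at_imp_continuous_on ballI DERIV_isCont[OF \<rho>d])
  have \<rho>'c: "continuous_on {0..<1} \<rho>'" using \<rho> unfolding elliptic_density_def by blast
  have \<rho>v: "continuous_on (closure \<Omega>) (\<lambda>x. \<rho> ((norm (v x))\<^sup>2))"
    "continuous_on (closure \<Omega>) (\<lambda>x. \<rho>' ((norm (v x))\<^sup>2))"
    using unit by (auto intro!: continuous_on_compose2[OF \<rho>c] continuous_on_compose2[OF \<rho>'c] continuous_intros v)
  define F' where "F' x h = \<rho> ((norm (v x))\<^sup>2) *\<^sub>R v' x h + (\<rho>' ((norm (v x))\<^sup>2) * (2 * (v x \<bullet> v' x h))) *\<^sub>R v x" for x h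
  have Fd: "((\<lambda>x. \<rho> ((norm (v x))\<^sup>2) *\<^sub>R v x) has_derivative F' x) (at x)" if x: "x \<in> \<Omega>" for x
  proof -
    have "((\<lambda>x. v x \<bullet> v x) has_derivative (\<lambda>h. 2 * (v x \<bullet> v' x h))) (at x)"
      by (auto intro!: derivative_eq_intros vd[OF x] simp: inner_commute)
    then have 1: "((\<lambda>x. (norm (v x))\<^sup>2) has_derivative (\<lambda>h. 2 * (v x \<bullet> v' x h))) (at x)"
      by (simp add: power2_norm_eq_inner)
    have "x \<in> closure \<Omega>" using x sub by blast
    from has_derivative_compose[OF 1 \<rho>d[OF unit[OF this], unfolded has_field_derivative_def]]
    show ?thesis unfolding F'_def by (auto intro!: derivative_eq_intros vd[OF x] simp: add.commute)
  qed
  have F'c: "continuous_on \<Omega> (\<lambda>x. F' x h)" for h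
    unfolding F'_def
    by (intro continuous_intros v'c continuous_on_subset[OF v(1) sub] continuous_on_subset[OF \<rho>v(1) sub]
      continuous_on_subset[OF \<rho>v(2) sub])
  have div: "(\<Sum>b\<in>Basis. F' x b \<bullet> b) = 0" if x: "x \<in> \<Omega>" for x
  proof -
    have "((\<lambda>y. \<rho> ((norm (grad \<phi> y))\<^sup>2) *\<^sub>R grad \<phi> y) has_derivative F' x) (at x)"
      by (rule has_derivative_transform_within_open[OF Fd[OF x] op x]) (simp add: v(2))
    from frechet_derivative_at[OF this]
    have "divergence (\<lambda>y. \<rho> ((norm (grad \<phi> y))\<^sup>2) *\<^sub>R grad \<phi> y) x = (\<Sum>b\<in>Basis. F' x b \<bullet> b)"
      by (simp add: divergence_def)
    then show ?thesis using sol x unfolding neumann_solution_def by simp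
  qed
  show thesis
  proof (rule that[of \<theta> v F'])
    show "continuous_on (closure \<Omega>) \<phi>" using sol unfolding neumann_solution_def by blast
    show "continuous_on (closure \<Omega>) (\<lambda>x. \<rho> ((norm (v x))\<^sup>2) *\<^sub>R v x)" by (intro continuous_intros \<rho>v v)
  qed (fact \<theta>(1,2) v \<theta>c \<phi>d Fd F'c div normal)+
qed

lemma integral_zero_of_slices_zero:
  fixes H :: "'a::euclidean_space \<times> 'b::euclidean_space \<Rightarrow> real" and k :: "'b \<Rightarrow> real"
  assumes int: "set_integrable lborel \<Omega> (\<lambda>x. k (snd x) * H x)"
    and slice: "\<And>t. (LINT x:{x. (x, t) \<in> \<Omega>}|lborel. H (x, t)) = 0"
  shows "(LINT x:\<Omega>|lborel. k (snd x) * H x) = 0"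
proof -
  define f where "f x t = indicat_real \<Omega> (x, t) *\<^sub>R (k t * H (x, t))" for x t
  have eq: "(\<lambda>x. indicat_real \<Omega> x *\<^sub>R (k (snd x) * H x)) = case_prod f"
    by (auto simp: f_def fun_eq_iff)
  have slice0: "(LINT x|lborel. f x t) = 0" for t
  proof -
    have "(LINT x|lborel. f x t) = (LINT x|lborel. k t * (indicat_real {x. (x, t) \<in> \<Omega>} x *\<^sub>R H (x, t)))"
      by (rule Bochner_Integration.integral_cong) (auto simp: f_def indicator_def)
    also have "\<dots> = k t * (LINT x:{x. (x, t) \<in> \<Omega>}|lborel. H (x, t))"
      by (simp add: set_lebesgue_integral_def)
    finally show ?thesis by (simp add: slice)
  qed
  have "integrable (lborel \<Otimes>\<^sub>M lborel) (case_prod f)"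
    using int unfolding set_integrable_def eq by (simp add: lborel_prod)
  from lborel_pair.integral_snd[OF this]
  have "(LINT x:\<Omega>|lborel. k (snd x) * H x) = (LINT t|lborel. LINT x|lborel. f x t)"
    unfolding set_lebesgue_integral_def eq by (simp add: lborel_prod)
  also have "\<dots> = 0" by (simp add: slice0)
  finally show ?thesis .
qed

text \<open>
  Optimizing over \<open>\<delta>\<close>, the estimate is a discrete form of \<open>E \<le> 2 A \<surd>E'\<close>, whose positive solutions blow
  up. Taking \<open>\<delta> = 1\<close> bounds \<open>E\<close>; being monotone, \<open>E\<close> then converges, so the increments tend to \<open>0\<close> and
  the limit is at most \<open>A \<delta>\<close> for every \<open>\<delta>\<close>.
\<close>

lemma energy_sequence_zero:
  fixes E :: "nat \<Rightarrow> real"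
  assumes mono: "\<And>N. E N \<le> E (Suc N)" and A: "0 \<le> A"
    and step: "\<And>N. E (Suc N) - E N \<le> C"
    and est: "\<And>N \<delta>. 0 < \<delta> \<Longrightarrow> E N \<le> A * (\<delta> + (E (Suc N) - E N) / \<delta>)"
  shows "E N \<le> 0"
proof -
  have inc: "incseq E" using mono by (rule incseq_SucI)
  have "E N \<le> A * (1 + C)" for N
  proof -
    have "E N \<le> A * (1 + (E (Suc N) - E N))" using est[of 1 N] by simp
    also have "\<dots> \<le> A * (1 + C)" using step[of N] A by (intro mult_left_mono) auto
    finally show ?thesis .
  qed
  then obtain L where L: "E \<longlonglongrightarrow> L" "\<And>N. E N \<le> L" using incseq_convergent[OF inc] by blast
  have "(\<lambda>N. E (Suc N) - E N) \<longlonglongrightarrow> L - L" by (intro tendsto_diff LIMSEQ_Suc L)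
  then have e0: "(\<lambda>N. E (Suc N) - E N) \<longlonglongrightarrow> 0" by simp
  have "L \<le> A * \<delta>" if d: "\<delta> > 0" for \<delta>
  proof (rule LIMSEQ_le[OF L(1)])
    have "(\<lambda>N. A * (\<delta> + (E (Suc N) - E N) / \<delta>)) \<longlonglongrightarrow> A * (\<delta> + 0 / \<delta>)"
      by (intro tendsto_intros e0) (use d in auto)
    then show "(\<lambda>N. A * (\<delta> + (E (Suc N) - E N) / \<delta>)) \<longlonglongrightarrow> A * \<delta>" by simp
  qed (use est d in auto)
  then have "L \<le> 0 + e" if "e > 0" for e
    using that A by (cases "A = 0") (force dest: spec[of _ "e / A"] simp: field_simps)+
  then have "L \<le> 0" by (rule field_le_epsilon)
  then show ?thesis using L(2)[of N] by simp
qed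

text \<open>
  A product of two steps is used instead of a step in \<open>\<bar>t\<bar>\<close>, which would not be visibly smooth at \<open>0\<close>.
\<close>

definition axial_cutoff :: "nat \<Rightarrow> real \<Rightarrow> real" where
  "axial_cutoff N t = smooth_step (real N + 1 - t) * smooth_step (real N + 1 + t)"

definition axial_cutoff_deriv :: "nat \<Rightarrow> real \<Rightarrow> real" where
  "axial_cutoff_deriv N t = smooth_step (real N + 1 - t) * smooth_step_deriv (real N + 1 + t)
    - smooth_step_deriv (real N + 1 - t) * smooth_step (real N + 1 + t)"

lemma axial_cutoff_has_derivative:
  assumes "(f has_derivative f') (at x)"
  shows "((\<lambda>x. axial_cutoff N (f x)) has_derivative (\<lambda>h. axial_cutoff_deriv N (f x) * f' h)) (at x)"
  unfolding axial_cutoff_def axial_cutoff_deriv_def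
  by (auto intro!: derivative_eq_intros assms simp: fun_eq_iff algebra_simps)

lemma continuous_on_axial_cutoff [continuous_intros]:
  "continuous_on X f \<Longrightarrow> continuous_on X (\<lambda>x. axial_cutoff N (f x))"
  "continuous_on X f \<Longrightarrow> continuous_on X (\<lambda>x. axial_cutoff_deriv N (f x))"
  unfolding axial_cutoff_def axial_cutoff_deriv_def by (intro continuous_intros; assumption)+

lemma axial_cutoff_bounds: "0 \<le> axial_cutoff N t" "axial_cutoff N t \<le> 1"
  unfolding axial_cutoff_def by (simp_all add: smooth_step_bounds mult_le_one)

lemma axial_cutoff_eq_1: "\<bar>t\<bar> \<le> real N \<Longrightarrow> axial_cutoff N t = 1"
  by (simp add: axial_cutoff_def smooth_step_eq_1)

lemma axial_cutoff_eq_0: "real N + 1 \<le> \<bar>t\<bar> \<Longrightarrow> axial_cutoff N t = 0"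
  by (cases "t \<ge> 0") (simp_all add: axial_cutoff_def smooth_step_eq_0)

lemma axial_cutoff_deriv_eq_0:
  assumes "\<bar>t\<bar> \<le> real N \<or> real N + 1 \<le> \<bar>t\<bar>"
  shows "axial_cutoff_deriv N t = 0"
  using assms by (cases "t \<ge> 0")
    (auto simp: axial_cutoff_deriv_def smooth_step_eq_0 smooth_step_deriv_eq_0)

lemma axial_cutoff_deriv_bound: "\<bar>axial_cutoff_deriv N t\<bar> \<le> 2"
proof -
  have p: "0 \<le> smooth_step a * smooth_step_deriv b" "smooth_step a * smooth_step_deriv b \<le> 2" for a b
    using mult_mono[of "smooth_step a" 1 "smooth_step_deriv b" 2] smooth_step_bounds[of a] smooth_step_deriv_bounds[of b]
    by auto
  show ?thesis
    using p[of "real N + 1 - t" "real N + 1 + t"] p[of "real N + 1 + t" "real N + 1 - t"]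
    unfolding axial_cutoff_deriv_def by (simp add: mult.commute abs_le_iff)
qed

section \<open>Uniqueness\<close>

lemma norm_diff_le_of_derivative_bound:
  fixes S :: "'a::real_normed_vector \<Rightarrow> 'b::real_normed_vector" and S' :: "'a \<Rightarrow> 'a \<Rightarrow>\<^sub>L 'b"
  assumes "convex V" "\<And>b. b \<in> V \<Longrightarrow> (S has_derivative blinfun_apply (S' b)) (at b)"
    "\<And>b. b \<in> V \<Longrightarrow> norm (S' b) \<le> K" "a \<in> V" "b \<in> V"
  shows "norm (S a - S b) \<le> K * norm (a - b)"
  by (rule differentiable_bound[OF assms(1), of S "\<lambda>b. blinfun_apply (S' b)"])
    (use assms in \<open>auto intro: has_derivative_at_withinI simp: norm_blinfun.rep_eq[symmetric]\<close>)

text \<open>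
  The energy argument, for an abstract elliptic density. Notation: \<open>V\<close> is the difference of the
  velocities, \<open>G\<close> that of the mass fluxes, \<open>w\<close> the energy density, \<open>P N\<close> the part of the nozzle with
  \<open>\<bar>x\<^sub>n\<bar> \<le> N\<close> and \<open>\<Sigma> N\<close> the two slabs that \<open>P (N + 1)\<close> has in addition.
\<close>

lemma subsonic_gradient_unique:
  fixes \<Omega> :: "((real^'m) \<times> real) set" and \<phi>1 \<phi>2 :: "(real^'m) \<times> real \<Rightarrow> real"
  assumes noz: "nozzle \<alpha> \<Omega>" and \<rho>: "elliptic_density \<rho> \<rho>'"
    and sol1: "neumann_solution \<rho> \<Omega> \<phi>1" and sol2: "neumann_solution \<rho> \<Omega> \<phi>2"
    and sub1: "uniformly_subsonic \<Omega> \<phi>1" and sub2: "uniformly_subsonic \<Omega> \<phi>2"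
    and flux: "\<And>t. mass_flux \<rho> \<Omega> \<phi>1 t = mass_flux \<rho> \<Omega> \<phi>2 t"
    and z: "z \<in> \<Omega>"
  shows "grad \<phi>1 z = grad \<phi>2 z"
proof -
  obtain K :: real and S :: "(real^'m) \<times> real \<Rightarrow> (real^'m) \<times> real" and S' g D D' and A :: real
    where op: "open \<Omega>" and K: "0 \<le> K"
    and S: "\<And>b. b \<in> cylinder \<Longrightarrow> S b \<in> \<Omega> \<and> snd (S b) = snd b" "\<And>y. y \<in> \<Omega> \<Longrightarrow> \<exists>b\<in>cylinder. S b = y"
      "\<And>b. b \<in> cylinder \<Longrightarrow> (S has_derivative blinfun_apply (S' b)) (at b)"
      "\<And>b. b \<in> cylinder \<Longrightarrow> norm (S' b) \<le> K"
    and g: "continuous_on (closure \<Omega>) g" "\<And>y. y \<in> \<Omega> \<Longrightarrow> g y < 0" "\<And>y. y \<in> frontier \<Omega> \<Longrightarrow> g y = 0"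
      "\<And>y. y \<in> \<Omega> \<Longrightarrow> (g has_derivative (\<lambda>h. D y \<bullet> h)) (at y)"
    and D: "continuous_on (closure \<Omega>) D" "\<And>y. y \<in> frontier \<Omega> \<Longrightarrow> D y \<noteq> 0"
      "\<And>y. y \<in> \<Omega> \<Longrightarrow> (D has_derivative D' y) (at y)" "\<And>h. continuous_on \<Omega> (\<lambda>y. D' y h)"
      "\<And>y. y \<in> \<Omega> \<Longrightarrow> \<bar>\<Sum>b\<in>Basis. D' y b \<bullet> b\<bar> \<le> A"
    and normal: "\<And>y. y \<in> frontier \<Omega> \<Longrightarrow> is_outer_normal \<Omega> y (D y /\<^sub>R norm (D y))"
    using that by (rule nozzle_geometry[OF noz])
  have sub: "\<Omega> \<subseteq> closure \<Omega>" by (rule closure_subset)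
  define F where "F v = \<rho> ((norm v)\<^sup>2) *\<^sub>R v" for v :: "(real^'m) \<times> real"
  obtain \<theta>1 v1 F1' where \<theta>1: "0 \<le> \<theta>1" "\<theta>1 < 1"
    and v1: "continuous_on (closure \<Omega>) v1" "\<And>x. x \<in> closure \<Omega> \<Longrightarrow> norm (v1 x) \<le> \<theta>1"
      "\<And>x. x \<in> \<Omega> \<Longrightarrow> v1 x = grad \<phi>1 x" "\<And>x. x \<in> \<Omega> \<Longrightarrow> (\<phi>1 has_derivative (\<lambda>h. v1 x \<bullet> h)) (at x)"
      "continuous_on (closure \<Omega>) \<phi>1"
    and F1: "continuous_on (closure \<Omega>) (\<lambda>x. F (v1 x))" "\<And>x. x \<in> \<Omega> \<Longrightarrow> ((\<lambda>x. F (v1 x)) has_derivative F1' x) (at x)"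
      "\<And>h. continuous_on \<Omega> (\<lambda>x. F1' x h)" "\<And>x. x \<in> \<Omega> \<Longrightarrow> (\<Sum>b\<in>Basis. F1' x b \<bullet> b) = 0"
    and n1: "\<And>x \<nu>. x \<in> frontier \<Omega> \<Longrightarrow> is_outer_normal \<Omega> x \<nu> \<Longrightarrow> v1 x \<bullet> \<nu> = 0"
    using that unfolding F_def by (rule neumann_solution_flux[OF op \<rho> sol1 sub1])
  obtain \<theta>2 v2 F2' where \<theta>2: "0 \<le> \<theta>2" "\<theta>2 < 1"
    and v2: "continuous_on (closure \<Omega>) v2" "\<And>x. x \<in> closure \<Omega> \<Longrightarrow> norm (v2 x) \<le> \<theta>2"
      "\<And>x. x \<in> \<Omega> \<Longrightarrow> v2 x = grad \<phi>2 x" "\<And>x. x \<in> \<Omega> \<Longrightarrow> (\<phi>2 has_derivative (\<lambda>h. v2 x \<bullet> h)) (at x)"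
      "continuous_on (closure \<Omega>) \<phi>2"
    and F2: "continuous_on (closure \<Omega>) (\<lambda>x. F (v2 x))" "\<And>x. x \<in> \<Omega> \<Longrightarrow> ((\<lambda>x. F (v2 x)) has_derivative F2' x) (at x)"
      "\<And>h. continuous_on \<Omega> (\<lambda>x. F2' x h)" "\<And>x. x \<in> \<Omega> \<Longrightarrow> (\<Sum>b\<in>Basis. F2' x b \<bullet> b) = 0"
    and n2: "\<And>x \<nu>. x \<in> frontier \<Omega> \<Longrightarrow> is_outer_normal \<Omega> x \<nu> \<Longrightarrow> v2 x \<bullet> \<nu> = 0"
    using that unfolding F_def by (rule neumann_solution_flux[OF op \<rho> sol2 sub2])

  define u where "u x = \<phi>1 x - \<phi>2 x" for x
  define V where "V x = v1 x - v2 x" for x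
  define G where "G x = F (v1 x) - F (v2 x)" for x
  define w where "w x = G x \<bullet> V x" for x
  have ud: "(u has_derivative (\<lambda>h. V x \<bullet> h)) (at x)" if "x \<in> \<Omega>" for x
    unfolding u_def[abs_def] V_def
    by (auto intro!: derivative_eq_intros v1(4)[OF that] v2(4)[OF that] simp: inner_diff_left)
  have uc: "continuous_on (closure \<Omega>) u" unfolding u_def[abs_def] by (intro continuous_intros v1 v2)
  have Vc: "continuous_on (closure \<Omega>) V" unfolding V_def[abs_def] by (intro continuous_intros v1 v2)
  have Gc: "continuous_on (closure \<Omega>) G" unfolding G_def[abs_def] by (intro continuous_intros F1 F2)
  have wc: "continuous_on (closure \<Omega>) w" unfolding w_def[abs_def] by (intro continuous_intros Vc Gc)
  note c\<Omega> = continuous_on_subset[OF uc sub] continuous_on_subset[OF Vc sub] continuous_on_subset[OF Gc sub]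
    continuous_on_subset[OF wc sub]
  define \<theta> where "\<theta> = max \<theta>1 \<theta>2"
  have \<theta>: "0 \<le> \<theta>" "\<theta> < 1" using \<theta>1 \<theta>2 by (auto simp: \<theta>_def)
  have v\<theta>: "norm (v1 x) \<le> \<theta>" "norm (v2 x) \<le> \<theta>" if "x \<in> \<Omega>" for x
    using v1(2)[of x] v2(2)[of x] that sub by (auto simp: \<theta>_def)
  have V2: "norm (V x) \<le> 2" if "x \<in> \<Omega>" for x
    using norm_triangle_ineq4[of "v1 x" "v2 x"] v\<theta>[OF that] \<theta> by (simp add: V_def)
  obtain \<mu> \<Lambda> where \<mu>: "0 < \<mu>" "0 \<le> \<Lambda>"
    and coerc: "\<And>v w :: (real^'m) \<times> real. norm v \<le> \<theta> \<Longrightarrow> norm w \<le> \<theta> \<Longrightarrow>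
      \<mu> * (norm (v - w))\<^sup>2 \<le> (F v - F w) \<bullet> (v - w)"
    and lip: "\<And>v w :: (real^'m) \<times> real. norm v \<le> \<theta> \<Longrightarrow> norm w \<le> \<theta> \<Longrightarrow> norm (F v - F w) \<le> \<Lambda> * norm (v - w)"
    using that unfolding F_def by (rule elliptic_flux_monotone[OF \<rho> \<theta>])
  have wV: "\<mu> * (norm (V x))\<^sup>2 \<le> w x" if "x \<in> \<Omega>" for x
    using coerc[OF v\<theta>[OF that]] by (simp add: w_def V_def G_def)
  have GV: "norm (G x) \<le> \<Lambda> * norm (V x)" if "x \<in> \<Omega>" for x
    using lip[OF v\<theta>[OF that]] by (simp add: V_def G_def)
  have w0: "0 \<le> w x" if "x \<in> \<Omega>" for x
    using wV[OF that] \<mu> by (meson less_imp_le order_trans mult_nonneg_nonneg zero_le_power2)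
  have G2: "norm (G x) \<le> 2 * \<Lambda>" if "x \<in> \<Omega>" for x
    using GV[OF that] mult_left_mono[OF V2[OF that] \<mu>(2)] by simp
  have wb: "w x \<le> 4 * \<Lambda>" if "x \<in> \<Omega>" for x
  proof -
    have "w x \<le> norm (G x) * norm (V x)" unfolding w_def by (rule norm_cauchy_schwarz)
    also have "\<dots> \<le> (2 * \<Lambda>) * 2" by (intro mult_mono G2 V2 that) (use \<mu> in auto)
    finally show ?thesis by simp
  qed
  define B where "B = \<Lambda>\<^sup>2 / \<mu>"
  have B: "0 \<le> B" using \<mu> by (simp add: B_def)
  have GB: "(norm (G x))\<^sup>2 \<le> B * w x" if "x \<in> \<Omega>" for x
  proof -
    have "(norm (G x))\<^sup>2 \<le> (\<Lambda> * norm (V x))\<^sup>2" using GV[OF that] by (intro power_mono) auto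
    also have "\<dots> = B * (\<mu> * (norm (V x))\<^sup>2)" using \<mu> by (simp add: B_def power_mult_distrib)
    also have "\<dots> \<le> B * w x" using wV[OF that] B by (intro mult_left_mono)
    finally show ?thesis .
  qed
  have Gyoung: "norm (G x) \<le> \<delta> + B * w x / \<delta>" if "x \<in> \<Omega>" "\<delta> > 0" for x \<delta>
  proof -
    have "norm (G x) * \<delta> \<le> \<delta>\<^sup>2 + (norm (G x))\<^sup>2"
    proof -
      have "0 \<le> norm (G x) * \<delta>" using that(2) by simp
      moreover have "2 * (norm (G x) * \<delta>) \<le> (norm (G x))\<^sup>2 + \<delta>\<^sup>2"
        using sum_squares_bound[of "norm (G x)" \<delta>] by (simp only: mult.assoc)
      ultimately show ?thesis by linarith
    qed
    also have "\<dots> \<le> \<delta>\<^sup>2 + B * w x" using GB[OF that(1)] by simp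
    finally show ?thesis using that(2) by (simp add: field_simps power2_eq_square)
  qed

  \<comment> \<open>The oscillation of \<open>u\<close> over a cross-section is bounded uniformly: \<open>c\<close> is the value at the centre.\<close>
  have cyl0: "(0, t) \<in> cylinder" for t by (simp add: cylinder_def)
  have Slip: "norm (S a - S b) \<le> K * norm (a - b)" if "a \<in> cylinder" "b \<in> cylinder" for a b
    by (rule norm_diff_le_of_derivative_bound[OF convex_cylinder S(3,4) that])
  define c where "c t = u (S (0, t))" for t
  have cc: "continuous_on UNIV c"
  proof -
    have "continuous_on cylinder S"
      by (auto intro!: continuous_at_imp_continuous_on has_derivative_continuous[OF S(3)])
    then have "continuous_on UNIV (\<lambda>t. S (0, t))"
      by (rule continuous_on_compose2) (auto intro!: continuous_intros cyl0)
    with c\<Omega>(1) show ?thesis unfolding c_def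
      by (rule continuous_on_compose2) (use S(1)[OF cyl0] in auto)
  qed
  have osc: "\<bar>u x - c (snd x)\<bar> \<le> 2 * K" if x: "x \<in> \<Omega>" for x
  proof -
    obtain b where b: "b \<in> cylinder" "S b = x" using S(2)[OF x] by blast
    define b0 where "b0 = (0 :: real^'m, snd x)"
    have sb: "snd b = snd x" using S(1)[OF b(1)] b(2) by simp
    have "b - b0 = (fst b, 0)" using sb by (simp add: b0_def prod_eq_iff)
    then have nb: "norm (b - b0) \<le> 1" using b(1) by (auto simp: cylinder_def norm_Pair)
    have "norm (u (S b) - u (S b0)) \<le> (2 * K) * norm (b - b0)"
    proof (rule differentiable_bound[OF convex_cylinder, where f' = "\<lambda>b h. V (S b) \<bullet> S' b h"])
      fix a :: "(real^'m) \<times> real" assume a: "a \<in> cylinder"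
      show "((\<lambda>a. u (S a)) has_derivative (\<lambda>h. V (S a) \<bullet> S' a h)) (at a within cylinder)"
        using has_derivative_compose[OF S(3)[OF a] ud] S(1)[OF a] by (auto intro: has_derivative_at_withinI)
      show "onorm (\<lambda>h. V (S a) \<bullet> S' a h) \<le> 2 * K"
      proof (rule onorm_le)
        fix h
        have "norm (V (S a) \<bullet> S' a h) \<le> norm (V (S a)) * norm (S' a h)" by (rule Cauchy_Schwarz_ineq2[folded real_norm_def])
        also have "\<dots> \<le> 2 * (K * norm h)"
          using V2[of "S a"] S(1)[OF a] norm_blinfun[of "S' a" h] mult_right_mono[OF S(4)[OF a] norm_ge_zero[of h]]
          by (intro mult_mono) auto
        finally show "norm (V (S a) \<bullet> S' a h) \<le> 2 * K * norm h" by simp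
      qed
    qed (use b cyl0 in \<open>auto simp: b0_def\<close>)
    also have "\<dots> \<le> (2 * K) * 1" using nb K by (intro mult_left_mono) auto
    finally show ?thesis using b(2) by (simp add: c_def b0_def)
  qed

  \<comment> \<open>Every truncation of the nozzle is bounded, and the slabs have uniformly bounded volume.\<close>
  define r where "r N = norm (S 0) + K * (1 + (real N + 1))" for N :: nat
  have rN: "norm x \<le> r N" if x: "x \<in> \<Omega>" "\<bar>snd x\<bar> \<le> real N + 1" for x N
  proof -
    obtain b where b: "b \<in> cylinder" "S b = x" using S(2)[OF x(1)] by blast
    have "snd b = snd x" using S(1)[OF b(1)] b(2) by simp
    then have "norm b \<le> 1 + (real N + 1)"
      using norm_Pair_le[of "fst b" "snd b"] b(1) x(2) by (auto simp: cylinder_def)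
    then have "norm (S b - S 0) \<le> K * (1 + (real N + 1))"
      using Slip[OF b(1), of 0] cyl0[of 0] K
      by (auto simp: zero_prod_def[symmetric] intro: order_trans mult_left_mono)
    then show ?thesis using norm_triangle_ineq2[of x "S 0"] b(2) by (simp add: r_def)
  qed

  define P where "P N = {x \<in> \<Omega>. \<bar>snd x\<bar> \<le> real N}" for N :: nat
  define \<Sigma> where "\<Sigma> N = {x \<in> \<Omega>. real N < \<bar>snd x\<bar> \<and> \<bar>snd x\<bar> \<le> real N + 1}" for N :: nat
  have meas: "P N \<in> sets borel" "\<Sigma> N \<in> sets borel" for N
  proof -
    have c: "continuous_on UNIV (\<lambda>x :: (real^'m) \<times> real. \<bar>snd x\<bar>)" by (intro continuous_intros)
    have "closed {x :: (real^'m) \<times> real. \<bar>snd x\<bar> \<le> t}" "open {x :: (real^'m) \<times> real. t < \<bar>snd x\<bar>}" for t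
      using c by (auto intro: closed_Collect_le open_Collect_less continuous_on_const)
    moreover have "P N = \<Omega> \<inter> {x. \<bar>snd x\<bar> \<le> real N}"
      "\<Sigma> N = \<Omega> \<inter> ({x. real N < \<bar>snd x\<bar>} \<inter> {x. \<bar>snd x\<bar> \<le> real N + 1})"
      by (auto simp: P_def \<Sigma>_def)
    ultimately show "P N \<in> sets borel" "\<Sigma> N \<in> sets borel"
      using op by (simp_all add: sets.Int borel_open borel_closed)
  qed
  have PS: "P N \<subseteq> \<Omega>" "\<Sigma> N \<subseteq> \<Omega>" for N by (auto simp: P_def \<Sigma>_def)
  have bint: "set_integrable lborel X f"
    if "X \<in> sets borel" "X \<subseteq> \<Omega>" "continuous_on \<Omega> f" "\<And>x. x \<in> \<Omega> \<Longrightarrow> \<bar>snd x\<bar> \<le> real N + 1 \<Longrightarrow> \<bar>f x\<bar> \<le> M"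
      "\<And>x. x \<in> X \<Longrightarrow> f x \<noteq> 0 \<Longrightarrow> \<bar>snd x\<bar> \<le> real N + 1"
    for X N M and f :: "(real^'m) \<times> real \<Rightarrow> real"
  proof (rule set_integrable_continuous_bounded[OF that(1) continuous_on_subset[OF that(3,2)]])
    fix x assume x: "x \<in> X"
    show "\<bar>f x\<bar> \<le> max 0 M"
      using that(4)[of x] that(5)[OF x] that(2) x by (cases "f x = 0") (auto simp: le_max_iff_disj)
    show "f x \<noteq> 0 \<Longrightarrow> norm x \<le> r N" using rN[of x N] that(5)[OF x] that(2) x by auto
  qed
  define m where "m = 2 * measure lborel (cball (0 :: (real^'m) \<times> real) (2 * K))"
  have \<Sigma>m: "emeasure lborel (\<Sigma> N) < \<infinity>" "measure lborel (\<Sigma> N) \<le> m" for N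
  proof -
    have cover: "\<Sigma> N \<subseteq> cball (S (0, real N)) (2 * K) \<union> cball (S (0, - real N)) (2 * K)"
    proof
      fix x assume x: "x \<in> \<Sigma> N"
      then obtain b where b: "b \<in> cylinder" "S b = x" using S(2) PS by blast
      have sb: "snd b = snd x" using S(1)[OF b(1)] b(2) by simp
      define t where "t = (if snd x \<ge> 0 then real N else - real N)"
      have "\<bar>snd b - t\<bar> \<le> 1" using x sb by (auto simp: \<Sigma>_def t_def)
      moreover have "norm (fst b) \<le> 1" using b(1) by (auto simp: cylinder_def)
      ultimately have "norm (b - (0, t)) \<le> 2"
        using norm_Pair_le[of "fst b" "snd b - t"] by (simp add: minus_prod_def)
      then have "norm (x - S (0, t)) \<le> K * 2"
        using Slip[OF b(1) cyl0[of t]] K b(2) by (auto intro: order_trans mult_left_mono)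
      then show "x \<in> cball (S (0, real N)) (2 * K) \<union> cball (S (0, - real N)) (2 * K)"
        by (auto simp: t_def dist_norm norm_minus_commute mult.commute split: if_splits)
    qed
    let ?C = "cball (S (0, real N)) (2 * K) \<union> cball (S (0, - real N)) (2 * K)"
    have fin: "?C \<in> fmeasurable lborel" by (intro fmeasurable.Un) (auto intro!: fmeasurableI emeasure_lborel_cball_finite)
    then show "emeasure lborel (\<Sigma> N) < \<infinity>"
      using emeasure_mono[OF cover, of lborel] by (auto simp: fmeasurable_def intro: le_less_trans)
    have "measure lborel (\<Sigma> N) \<le> measure lborel ?C" by (rule measure_mono_fmeasurable[OF cover _ fin]) (use meas in auto)
    also have "\<dots> \<le> measure lborel (cball (S (0, real N)) (2 * K)) + measure lborel (cball (S (0, - real N)) (2 * K))"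
      by (rule measure_Un_le) auto
    also have "\<dots> = m" using K by (simp add: m_def content_cball)
    finally show "measure lborel (\<Sigma> N) \<le> m" .
  qed
  have m0: "0 \<le> m" by (simp add: m_def)

  define E where "E N = (LINT x:P N|lborel. w x)" for N
  have wint: "set_integrable lborel (P N) w" "set_integrable lborel (\<Sigma> N) w" for N
  proof -
    show "set_integrable lborel (P N) w"
      by (rule bint[of _ _ N "4 * \<Lambda>", OF meas(1) PS(1) c\<Omega>(4)]) (use w0 wb in \<open>auto simp: P_def\<close>)
    show "set_integrable lborel (\<Sigma> N) w"
      by (rule bint[of _ _ N "4 * \<Lambda>", OF meas(2) PS(2) c\<Omega>(4)]) (use w0 wb in \<open>auto simp: \<Sigma>_def\<close>)
  qed
  have Ediff: "E (Suc N) = E N + (LINT x:\<Sigma> N|lborel. w x)" for N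
  proof -
    have "P (Suc N) = P N \<union> \<Sigma> N" "P N \<inter> \<Sigma> N = {}" by (auto simp: P_def \<Sigma>_def)
    then show ?thesis using set_integral_Un[OF _ wint] by (simp add: E_def)
  qed
  have \<Sigma>const: "set_integrable lborel (\<Sigma> N) (\<lambda>x. k)" "(LINT x:\<Sigma> N|lborel. k) = k * measure lborel (\<Sigma> N)" for N and k :: real
    using \<Sigma>m(1)[of N] meas(2)[of N] unfolding set_integrable_def set_lebesgue_integral_def
    by (auto simp: integrable_indicator_iff)
  have Estep: "0 \<le> (LINT x:\<Sigma> N|lborel. w x)" "(LINT x:\<Sigma> N|lborel. w x) \<le> 4 * \<Lambda> * m" for N
  proof -
    show "0 \<le> (LINT x:\<Sigma> N|lborel. w x)"
      using w0[OF subsetD[OF PS(2)]] unfolding set_lebesgue_integral_def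
      by (intro integral_nonneg_AE AE_I2) (simp add: indicator_def)
    have "(LINT x:\<Sigma> N|lborel. w x) \<le> (LINT x:\<Sigma> N|lborel. 4 * \<Lambda>)"
      by (rule set_integral_mono[OF wint(2) \<Sigma>const(1)]) (rule wb[OF subsetD[OF PS(2)]])
    also have "\<dots> \<le> 4 * \<Lambda> * m"
      unfolding \<Sigma>const(2) using \<Sigma>m(2)[of N] \<mu> by (intro mult_left_mono) auto
    finally show "(LINT x:\<Sigma> N|lborel. w x) \<le> 4 * \<Lambda> * m" .
  qed

  have slice: "(LINT y:{y. (y, t) \<in> \<Omega>}|lborel. snd (G (y, t))) = 0" for t
  proof -
    have op_slice: "open {y. (y, t) \<in> \<Omega>}"
    proof -
      have "continuous_on UNIV (\<lambda>y :: real^'m. (y, t))" by (intro continuous_intros)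
      from open_vimage[OF op this] show ?thesis by (simp add: vimage_def)
    qed
    have int: "set_integrable lborel {y. (y, t) \<in> \<Omega>} (\<lambda>y. snd (F (v (y, t))))"
      if "continuous_on (closure \<Omega>) (\<lambda>x. F (v x))" "\<And>x. x \<in> \<Omega> \<Longrightarrow> norm (v x) \<le> \<theta>" for v
    proof (rule set_integrable_continuous_bounded)
      show "{y. (y, t) \<in> \<Omega>} \<in> sets borel" using op_slice by simp
      show "continuous_on {y. (y, t) \<in> \<Omega>} (\<lambda>y. snd (F (v (y, t))))"
        by (intro continuous_intros continuous_on_compose2[OF that(1)]) (use sub in auto)
      fix y assume "y \<in> {y. (y, t) \<in> \<Omega>}"
      then have y: "(y, t) \<in> \<Omega>" by simp
      have "norm (F (v (y, t)) - F 0) \<le> \<Lambda> * norm (v (y, t) - 0)"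
        using that(2)[OF y] \<theta> by (intro lip) auto
      also have "\<dots> \<le> \<Lambda> * 1" using that(2)[OF y] \<theta> \<mu> by (intro mult_left_mono) auto
      finally have "norm (F (v (y, t))) \<le> \<Lambda>" by (simp add: F_def)
      then show "\<bar>snd (F (v (y, t)))\<bar> \<le> \<Lambda>"
        using norm_snd_le[of "snd (F (v (y, t)))" "fst (F (v (y, t)))"] by simp
      have "norm (y, t) \<le> r (nat \<lceil>\<bar>t\<bar>\<rceil>)" using rN[OF y, of "nat \<lceil>\<bar>t\<bar>\<rceil>"] by simp linarith
      then show "norm y \<le> r (nat \<lceil>\<bar>t\<bar>\<rceil>)" using norm_fst_le[of y t] by simp
    qed
    have fl: "mass_flux \<rho> \<Omega> \<phi> t = (LINT y:{y. (y, t) \<in> \<Omega>}|lborel. snd (F (v (y, t))))"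
      if "\<And>x. x \<in> \<Omega> \<Longrightarrow> v x = grad \<phi> x" for \<phi> v
      unfolding mass_flux_def F_def
      by (rule set_lebesgue_integral_cong) (use op_slice that in \<open>auto simp: inner_prod_def\<close>)
    have "(LINT y:{y. (y, t) \<in> \<Omega>}|lborel. snd (F (v1 (y, t))) - snd (F (v2 (y, t)))) = 0"
      using set_integral_diff(2)[OF int[OF F1(1) v\<theta>(1)] int[OF F2(1) v\<theta>(2)]] flux[of t]
      by (simp add: fl[OF v1(3)] fl[OF v2(3)])
    then show ?thesis by (simp add: G_def)
  qed

  have Eest: "E N \<le> 4 * K * (\<delta> * m + B * (LINT x:\<Sigma> N|lborel. w x) / \<delta>)" if \<delta>: "\<delta> > 0" for N \<delta>
  proof -
    define \<eta> where "\<eta> x = axial_cutoff N (snd x)" for x :: "(real^'m) \<times> real"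
    define \<eta>' where "\<eta>' x = axial_cutoff_deriv N (snd x)" for x :: "(real^'m) \<times> real"
    have \<eta>c: "continuous_on X \<eta>" "continuous_on X \<eta>'" for X
      unfolding \<eta>_def[abs_def] \<eta>'_def[abs_def] by (intro continuous_intros)+
    have \<eta>b: "0 \<le> \<eta> x" "\<eta> x \<le> 1" "\<bar>\<eta>' x\<bar> \<le> 2" for x
      unfolding \<eta>_def \<eta>'_def by (simp_all add: axial_cutoff_bounds axial_cutoff_deriv_bound)
    have \<eta>0: "\<eta> x = 0" "\<eta>' x = 0" if "\<not> \<bar>snd x\<bar> \<le> real N + 1" for x
      using that unfolding \<eta>_def \<eta>'_def by (auto intro: axial_cutoff_eq_0 axial_cutoff_deriv_eq_0)
    have \<eta>'\<Sigma>: "\<eta>' x = 0" if "x \<in> \<Omega>" "x \<notin> \<Sigma> N" for x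
      using that unfolding \<eta>'_def \<Sigma>_def by (auto intro!: axial_cutoff_deriv_eq_0)
    obtain M where M: "0 \<le> M" "\<And>x. x \<in> \<Omega> \<Longrightarrow> \<bar>snd x\<bar> \<le> real N + 1 \<Longrightarrow> \<bar>u x\<bar> \<le> M"
    proof -
      have "compact (closure \<Omega> \<inter> cball 0 (r N))" by (intro closed_Int_compact) auto
      then have "bounded (u ` (closure \<Omega> \<inter> cball 0 (r N)))"
        by (intro compact_imp_bounded compact_continuous_image continuous_on_subset[OF uc]) auto
      then obtain M where M: "\<forall>y\<in>u ` (closure \<Omega> \<inter> cball 0 (r N)). norm y \<le> M" unfolding bounded_iff by blast
      have "\<bar>u x\<bar> \<le> max 0 M" if "x \<in> \<Omega>" "\<bar>snd x\<bar> \<le> real N + 1" for x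
        using M rN[OF that] that(1) sub by (auto simp: le_max_iff_disj)
      then show thesis by (intro that[of "max 0 M"]) auto
    qed
    define D\<psi> where "D\<psi> x = \<eta> x *\<^sub>R V x + (u x * \<eta>' x) *\<^sub>R (0, 1)" for x
    have weak: "(LINT x:\<Omega>|lborel. D\<psi> x \<bullet> G x) = 0"
    proof (rule weak_form_of_zero_divergence[OF op g D Gc, where \<psi> = "\<lambda>x. \<eta> x * u x" and M = "2 + M * 2" and r = "r N"])
      fix x assume x: "x \<in> frontier \<Omega>"
      have "v1 x \<bullet> D x = 0" "v2 x \<bullet> D x = 0"
        using n1[OF x normal[OF x]] n2[OF x normal[OF x]] D(2)[OF x] by simp_all
      then show "G x \<bullet> D x = 0" by (simp add: G_def F_def inner_diff_left)
    next
      fix x assume x: "x \<in> \<Omega>"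
      show "(G has_derivative (\<lambda>h. F1' x h - F2' x h)) (at x)"
        unfolding G_def[abs_def] by (intro has_derivative_diff F1(2) F2(2) x)
      show "(\<Sum>b\<in>Basis. (F1' x b - F2' x b) \<bullet> b) = 0"
        by (simp add: inner_diff_left sum_subtractf F1(4)[OF x] F2(4)[OF x])
      show "((\<lambda>x. \<eta> x * u x) has_derivative (\<lambda>h. D\<psi> x \<bullet> h)) (at x)"
      proof -
        have "(\<eta> has_derivative (\<lambda>h. \<eta>' x * snd h)) (at x)"
          unfolding \<eta>_def[abs_def] \<eta>'_def
          by (rule axial_cutoff_has_derivative) (auto intro!: derivative_eq_intros)
        from has_derivative_mult[OF this ud[OF x]] show ?thesis
          by (rule has_derivative_eq_rhs) (simp add: D\<psi>_def fun_eq_iff inner_add_left inner_prod_def algebra_simps)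
      qed
      show "\<bar>\<eta> x * u x\<bar> \<le> 2 + M * 2"
      proof (cases "\<bar>snd x\<bar> \<le> real N + 1")
        case True
        have "\<bar>\<eta> x\<bar> * \<bar>u x\<bar> \<le> 1 * M" using \<eta>b[of x] M(2)[OF x True] by (intro mult_mono) auto
        then show ?thesis using M(1) by (simp add: abs_mult)
      qed (use \<eta>0 M(1) in auto)
      show "norm (D\<psi> x) \<le> 2 + M * 2"
      proof (cases "\<bar>snd x\<bar> \<le> real N + 1")
        case True
        have 1: "norm (\<eta> x *\<^sub>R V x) \<le> 1 * 2"
          unfolding norm_scaleR using \<eta>b[of x] V2[OF x] by (intro mult_mono) auto
        have "\<bar>u x\<bar> * \<bar>\<eta>' x\<bar> \<le> M * 2" using \<eta>b[of x] M(2)[OF x True] M(1) by (intro mult_mono) auto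
        then have 2: "norm ((u x * \<eta>' x) *\<^sub>R (0 :: real^'m, 1 :: real)) \<le> M * 2" by (simp add: abs_mult norm_Pair)
        show ?thesis unfolding D\<psi>_def using norm_triangle_le[of "\<eta> x *\<^sub>R V x"] 1 2 by simp
      qed (use \<eta>0 M(1) in \<open>auto simp: D\<psi>_def\<close>)
      show "r N < norm x \<Longrightarrow> \<eta> x * u x = 0" using \<eta>0[of x] rN[OF x, of N] by fastforce
    next
      show "continuous_on \<Omega> (\<lambda>x. F1' x b - F2' x b)" for b by (intro continuous_intros F1 F2)
      show "continuous_on \<Omega> D\<psi>" unfolding D\<psi>_def[abs_def] by (intro continuous_intros \<eta>c c\<Omega>)
    qed
    have Gn: "\<bar>snd (G x)\<bar> \<le> norm (G x)" for x using norm_snd_le[of "snd (G x)" "fst (G x)"] by simp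
    have int1: "set_integrable lborel \<Omega> (\<lambda>x. \<eta> x * w x)"
    proof (rule bint[of _ _ N "4 * \<Lambda>"])
      show "\<bar>\<eta> x * w x\<bar> \<le> 4 * \<Lambda>" if "x \<in> \<Omega>" for x
        using \<eta>b[of x] w0[OF that] wb[OF that] mult_mono[of "\<eta> x" 1 "w x" "4 * \<Lambda>"] by (simp add: abs_mult)
    qed (use op \<eta>0 in \<open>auto intro!: continuous_intros \<eta>c c\<Omega>\<close>)
    have int2: "set_integrable lborel \<Omega> (\<lambda>x. (u x - c (snd x)) * (\<eta>' x * snd (G x)))"
    proof (rule bint[of _ _ N "2 * K * (2 * (2 * \<Lambda>))"])
      show "continuous_on \<Omega> (\<lambda>x. (u x - c (snd x)) * (\<eta>' x * snd (G x)))"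
        by (intro continuous_intros \<eta>c c\<Omega> continuous_on_compose2[OF cc]) auto
      show "\<bar>(u x - c (snd x)) * (\<eta>' x * snd (G x))\<bar> \<le> 2 * K * (2 * (2 * \<Lambda>))" if "x \<in> \<Omega>" for x
        unfolding abs_mult using osc[OF that] \<eta>b[of x] order_trans[OF Gn G2[OF that]] K by (intro mult_mono) auto
    qed (use op \<eta>0 in auto)
    obtain Mc where Mc: "\<And>t. \<bar>t\<bar> \<le> real N + 1 \<Longrightarrow> \<bar>c t\<bar> \<le> Mc" "0 \<le> Mc"
    proof -
      have "bounded (c ` cball 0 (real N + 1))"
        by (intro compact_imp_bounded compact_continuous_image continuous_on_subset[OF cc]) auto
      then obtain M where M: "\<forall>y\<in>c ` cball 0 (real N + 1). norm y \<le> M" unfolding bounded_iff by blast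
      then have "\<bar>c t\<bar> \<le> max 0 M" if "\<bar>t\<bar> \<le> real N + 1" for t
        using that by (auto simp: le_max_iff_disj dist_norm)
      then show thesis by (intro that[of "max 0 M"]) auto
    qed
    have int3: "set_integrable lborel \<Omega> (\<lambda>x. (c (snd x) * axial_cutoff_deriv N (snd x)) * snd (G x))"
      unfolding \<eta>'_def[symmetric]
    proof (rule bint[of _ _ N "Mc * 2 * (2 * \<Lambda>)"])
      show "continuous_on \<Omega> (\<lambda>x. c (snd x) * \<eta>' x * snd (G x))"
        by (intro continuous_intros \<eta>c c\<Omega> continuous_on_compose2[OF cc]) auto
      show "\<bar>c (snd x) * \<eta>' x * snd (G x)\<bar> \<le> Mc * 2 * (2 * \<Lambda>)" if "x \<in> \<Omega>" "\<bar>snd x\<bar> \<le> real N + 1" for x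
        unfolding abs_mult using Mc that \<eta>b[of x] order_trans[OF Gn G2[OF that(1)]] by (intro mult_mono) auto
    qed (use op \<eta>0 in auto)
    have "(LINT x:\<Omega>|lborel. (c (snd x) * axial_cutoff_deriv N (snd x)) * snd (G x)) = 0"
      using integral_zero_of_slices_zero[where k = "\<lambda>t. c t * axial_cutoff_deriv N t", OF int3] slice by simp
    then have zero: "(LINT x:\<Omega>|lborel. (c (snd x) * \<eta>' x) * snd (G x)) = 0" by (simp add: \<eta>'_def)
    \<comment> \<open>Subtracting \<open>c (x\<^sub>n)\<close> from \<open>u\<close> does not change the integral.\<close>
    have "D\<psi> x \<bullet> G x = \<eta> x * w x + ((u x - c (snd x)) * (\<eta>' x * snd (G x)) + (c (snd x) * \<eta>' x) * snd (G x))" for x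
      by (simp add: D\<psi>_def w_def inner_add_left inner_prod_def[of "(0, _)"] inner_commute[of "V x"] algebra_simps)
    then have "(LINT x:\<Omega>|lborel. \<eta> x * w x) + ((LINT x:\<Omega>|lborel. (u x - c (snd x)) * (\<eta>' x * snd (G x)))
        + (LINT x:\<Omega>|lborel. (c (snd x) * \<eta>' x) * snd (G x))) = 0"
      using weak int1 int2 int3[folded \<eta>'_def] by (simp add: set_integral_add)
    then have eq: "(LINT x:\<Omega>|lborel. \<eta> x * w x) = (LINT x:\<Omega>|lborel. - ((u x - c (snd x)) * (\<eta>' x * snd (G x))))"
      using zero by (simp add: set_integral_uminus[OF int2])
    note sum_int = set_integral_add[OF \<Sigma>const(1)[of N "4 * K * \<delta>"]
        set_integrable_mult_right[OF wint(2)[of N], of "4 * K * B / \<delta>"]]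
    have "E N \<le> (LINT x:\<Omega>|lborel. \<eta> x * w x)"
      unfolding E_def set_lebesgue_integral_def
    proof (rule integral_mono)
      show "integrable lborel (\<lambda>x. indicat_real (P N) x *\<^sub>R w x)" "integrable lborel (\<lambda>x. indicat_real \<Omega> x *\<^sub>R (\<eta> x * w x))"
        using wint(1) int1 by (simp_all add: set_integrable_def)
      show "indicat_real (P N) x *\<^sub>R w x \<le> indicat_real \<Omega> x *\<^sub>R (\<eta> x * w x)" for x
      proof (cases "x \<in> P N")
        case True
        then show ?thesis by (simp add: P_def \<eta>_def axial_cutoff_eq_1)
      next
        case False
        then show ?thesis using w0[of x] \<eta>b[of x] by (simp add: indicator_def)
      qed
    qed
    also have "\<dots> \<le> (LINT x:\<Sigma> N|lborel. 4 * K * \<delta> + (4 * K * B / \<delta>) * w x)"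
      unfolding eq unfolding set_lebesgue_integral_def
    proof (rule integral_mono)
      show "integrable lborel (\<lambda>x. indicat_real \<Omega> x *\<^sub>R - ((u x - c (snd x)) * (\<eta>' x * snd (G x))))"
        using int2 by (simp add: set_integrable_def)
      show "integrable lborel (\<lambda>x. indicat_real (\<Sigma> N) x *\<^sub>R (4 * K * \<delta> + (4 * K * B / \<delta>) * w x))"
        using sum_int(1) unfolding set_integrable_def .
      show "indicat_real \<Omega> x *\<^sub>R - ((u x - c (snd x)) * (\<eta>' x * snd (G x)))
          \<le> indicat_real (\<Sigma> N) x *\<^sub>R (4 * K * \<delta> + (4 * K * B / \<delta>) * w x)" for x
      proof (cases "x \<in> \<Sigma> N")
        case True
        then have x: "x \<in> \<Omega>" using PS by blast
        have "- ((u x - c (snd x)) * (\<eta>' x * snd (G x))) \<le> \<bar>u x - c (snd x)\<bar> * (\<bar>\<eta>' x\<bar> * \<bar>snd (G x)\<bar>)"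
          by (simp flip: abs_mult)
        also have "\<dots> \<le> (2 * K) * (2 * (\<delta> + B * w x / \<delta>))"
          using osc[OF x] \<eta>b[of x] order_trans[OF Gn Gyoung[OF x \<delta>]] K by (intro mult_mono) auto
        also have "\<dots> = 4 * K * \<delta> + (4 * K * B / \<delta>) * w x" by (simp add: algebra_simps)
        finally show ?thesis using True x by simp
      next
        case False
        then show ?thesis using \<eta>'\<Sigma>[of x] by (simp add: indicator_def)
      qed
    qed
    also have "\<dots> = 4 * K * \<delta> * measure lborel (\<Sigma> N) + (4 * K * B / \<delta>) * (LINT x:\<Sigma> N|lborel. w x)"
      unfolding sum_int(2) \<Sigma>const(2) set_integral_mult_right by (simp only: mult.assoc)
    also have "\<dots> \<le> 4 * K * \<delta> * m + (4 * K * B / \<delta>) * (LINT x:\<Sigma> N|lborel. w x)"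
      using \<Sigma>m(2)[of N] K \<delta> by (intro add_right_mono mult_left_mono) auto
    also have "\<dots> = 4 * K * (\<delta> * m + B * (LINT x:\<Sigma> N|lborel. w x) / \<delta>)" by (simp add: algebra_simps)
    finally show ?thesis .
  qed
  have E0: "E N \<le> 0" for N
  proof (rule energy_sequence_zero[where A = "4 * K * max m B" and C = "4 * \<Lambda> * m"])
    show "0 \<le> 4 * K * max m B" using K m0 by (simp add: le_max_iff_disj)
    show "E N \<le> E (Suc N)" "E (Suc N) - E N \<le> 4 * \<Lambda> * m" for N using Ediff[of N] Estep[of N] by auto
    fix N and \<delta> :: real assume \<delta>: "0 < \<delta>"
    define I where "I = (LINT x:\<Sigma> N|lborel. w x)"
    have "\<delta> * m + B * I / \<delta> \<le> \<delta> * max m B + max m B * I / \<delta>"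
      using \<delta> Estep(1)[of N] by (intro add_mono divide_right_mono mult_left_mono mult_right_mono) (auto simp: I_def)
    also have "\<dots> = max m B * (\<delta> + I / \<delta>)" by (simp add: algebra_simps)
    finally have "4 * K * (\<delta> * m + B * I / \<delta>) \<le> 4 * K * (max m B * (\<delta> + I / \<delta>))"
      using K by (intro mult_left_mono) auto
    then show "E N \<le> 4 * K * max m B * (\<delta> + (E (Suc N) - E N) / \<delta>)"
      using Eest[OF \<delta>, of N] Ediff[of N] by (simp add: I_def mult.assoc)
  qed

  \<comment> \<open>A continuous nonnegative density with vanishing integrals is zero.\<close>
  have "w z = 0"
  proof (rule ccontr)
    assume "w z \<noteq> 0"
    then have wz: "w z > 0" using w0[OF z] by simp
    obtain N :: nat where N: "\<bar>snd z\<bar> < real N" using reals_Archimedean2 by blast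
    define U where "U = \<Omega> \<inter> {x. \<bar>snd x\<bar> < real N}"
    have U: "open U" "z \<in> U" "U \<subseteq> \<Omega>"
      using op z N unfolding U_def by (auto intro!: open_Int open_Collect_less continuous_intros)
    have "continuous_on U w" using c\<Omega>(4) U(3) continuous_on_subset by blast
    then have "open (w -` {w z / 2<..} \<inter> U)"
      using continuous_on_open_vimage[OF U(1), of w] open_greaterThan[of "w z / 2"] by blast
    moreover have "w -` {w z / 2<..} \<inter> U = {x \<in> U. w z / 2 < w x}" by auto
    ultimately have "open {x \<in> U. w z / 2 < w x}" by simp
    moreover have "z \<in> {x \<in> U. w z / 2 < w x}" using U(2) wz by simp
    ultimately obtain e where e: "e > 0" "ball z e \<subseteq> {x \<in> U. w z / 2 < w x}"
      by (rule openE)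
    have "0 < w z / 2 * measure lborel (ball z e)"
      using wz e(1) by (simp add: content_ball unit_ball_vol_pos)
    also have "\<dots> = (LINT x|lborel. indicat_real (ball z e) x *\<^sub>R (w z / 2))" by simp
    also have "\<dots> \<le> E N"
      unfolding E_def set_lebesgue_integral_def
    proof (rule integral_mono)
      show "integrable lborel (\<lambda>x. indicat_real (ball z e) x *\<^sub>R (w z / 2))"
        by (intro integrable_scaleR_left) (use emeasure_lborel_ball_finite[of z e] in \<open>auto simp: integrable_indicator_iff less_top\<close>)
      show "integrable lborel (\<lambda>x. indicat_real (P N) x *\<^sub>R w x)" using wint(1) by (simp add: set_integrable_def)
      show "indicat_real (ball z e) x *\<^sub>R (w z / 2) \<le> indicat_real (P N) x *\<^sub>R w x" for x
      proof (cases "x \<in> ball z e")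
        case True
        then have "x \<in> U" "w z / 2 < w x" using e(2) by auto
        then show ?thesis using True by (simp add: U_def P_def)
      next
        case False
        then show ?thesis using w0[of x] by (simp add: indicator_def P_def)
      qed
    qed
    finally show False using E0[of N] by simp
  qed
  then have "\<mu> * (norm (V z))\<^sup>2 \<le> 0" using wV[OF z] by simp
  then have "V z = 0" using \<mu>(1) by (simp add: mult_le_0_iff)
  then show ?thesis using v1(3)[OF z] v2(3)[OF z] by (simp add: V_def)
qed

theorem theorem4p1:
  fixes \<Omega> :: "((real^'m) \<times> real) set"
    and \<phi>1 \<phi>2 :: "(real^'m) \<times> real \<Rightarrow> real"
    and p :: "real \<Rightarrow> real" and \<alpha> c m0 :: real
  assumes "0 < \<alpha>" and "\<alpha> < 1"
    and "nozzle \<alpha> \<Omega>"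
    and "pressure_law p"
    and "\<exists>r>0. enthalpy p r = c"
    and "neumann_solution (nondim_density p c) \<Omega> \<phi>1"
    and "neumann_solution (nondim_density p c) \<Omega> \<phi>2"
    and "uniformly_subsonic \<Omega> \<phi>1"
    and "uniformly_subsonic \<Omega> \<phi>2"
    and "\<forall>t. mass_flux (nondim_density p c) \<Omega> \<phi>1 t = m0"
    and "\<forall>t. mass_flux (nondim_density p c) \<Omega> \<phi>2 t = m0"
  shows "\<forall>x\<in>\<Omega>. grad \<phi>1 x = grad \<phi>2 x"
proof
  fix x assume "x \<in> \<Omega>"
  obtain \<rho>' where "elliptic_density (nondim_density p c) \<rho>'"
    using nondim_density_elliptic[OF assms(4,5)] by blast
  from subsonic_gradient_unique[OF assms(3) this assms(6-9) _ \<open>x \<in> \<Omega>\<close>] assms(10,11)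
  show "grad \<phi>1 x = grad \<phi>2 x" by simp
qed

end
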